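(* The representation $\rho$ of $\mathcal{Y}_{r,n}(q)$ on $V^{\otimes n}$ given by $t_i\mapsto\mathbf{T}_i$, $g_i\mapsto\mathbf{G}_i$, and, for every specialization $\mathcal{K}$ as described in the context, the specialized representation $\rho^{\mathcal{K}}$ of $\mathcal{Y}^{\mathcal{K}}_{r,n}(q)$, are faithful (i.e. $\rho$ and $\rho^{\mathcal{K}}$ are injective).
   Context: Let $n,r\ge 1$ be integers, $\xi=e^{2\pi i/r}\in\mathbb{C}$, $\Delta=\prod_{0\le i<j\le r-1}(\xi^i-\xi^j)$, $q$ an indeterminate and $R=\mathbb{Z}[q,q^{-1},\xi,r^{-1},\Delta^{-1}]$. The symmetric group $\mathfrak{S}_n$ acts on the right on $\{1,\dots,n\}$ (products are composed from left to right) and $s_i=(i,i+1)$. The Yokonuma-Hecke algebra $\mathcal{Y}_{r,n}(q)$ is the associative unital $R$-algebra generated by $g_1,\dots,g_{n-1},t_1,\dots,t_n$ with relations: $t_i^r=1$; $t_it_j=t_jt_i$; $t_jg_i=g_it_{js_i}$ for all $i,j$; $g_ig_j=g_jg_i$ for $|i-j|>1$; $g_ig_{i+1}g_i=g_{i+1}g_ig_{i+1}$; and $g_i^2=1+(q-q^{-1})e_ig_i$, where $e_i=\frac1r\sum_{s=0}^{r-1}t_i^st_{i+1}^{-s}$. Specializations: $\mathcal{K}$ is a commutative ring with elements $q,\xi\in\mathcal{K}^{\times}$ such that $\xi$ is an $r$-th root of unity and $r$ and $\prod_{0\le i<j\le r-1}(\xi^i-\xi^j)$ are invertible in $\mathcal{K}$;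 $\mathcal{K}$ is an $R$-algebra via $q\mapsto q$, $\xi\mapsto\xi$, and $\mathcal{Y}^{\mathcal{K}}_{r,n}(q)=\mathcal{Y}_{r,n}(q)\otimes_R\mathcal{K}$. Let $V$ be the free $R$-module with basis $\{v_i^t\mid 1\le i\le n,\ 0\le t\le r-1\}$. Define $\mathbf{T}\in\mathrm{End}_R(V)$ and $\mathbf{G}\in\mathrm{End}_R(V^{\otimes 2})$, written on the right, by $(v_i^t)\mathbf{T}=\xi^tv_i^t$ and $$(v_i^t\otimes v_j^s)\mathbf{G}=\begin{cases}v_j^s\otimes v_i^t& t\ne s\\ q\,v_i^t\otimes v_j^s& t=s,\ i=j\\ v_j^s\otimes v_i^t& t=s,\ i>j\\ (q-q^{-1})v_i^t\otimes v_j^s+v_j^s\otimes v_i^t& t=s,\ i<j.\end{cases}$$ $\mathbf{T}_i$ acts on $V^{\otimes n}$ as $\mathbf{T}$ in the $i$-th factor; $\mathbf{G}_i$ acts as $\mathbf{G}$ in the $i$-th and $(i+1)$-st factors. Operators are written on the right, so a product $XY$ means first $X$, then $Y$. The assignment $t_i\mapsto\mathbf{T}_i$, $g_i\mapsto\mathbf{G}_i$ defines a representation $\rho$ of $\mathcal{Y}_{r,n}(q)$ on $V^{\otimes n}$; the same formulas over $\mathcal{K}$ (with $V$ replaced by the free $\mathcal{K}$-module on the same basis) define the representation $\rho^{\mathcal{K}}$ of $\mathcal{Y}^{\mathcal{K}}_{r,n}(q)$. *)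

theory Defs
  imports
    "HOL-Algebra.Algebra"
    "HOL-Algebra.Algebraic_Closure_Type"
    "HOL-Computational_Algebra.Computational_Algebra"
    "HOL-Combinatorics.Transposition"
begin

section \<open>Algebras given by generators and relations\<close>

text \<open>
  The algebra \<open>B[M]\<close> of a monoid \<open>M\<close> over a commutative ring \<open>B\<close>: finitely supported functions
  \<open>M \<rightarrow> B\<close> with convolution. For \<open>M\<close> a word monoid this is the free associative algebra.
\<close>

definition monoid_algebra ::
    "('b, 'x) ring_scheme \<Rightarrow> ('m, 'y) monoid_scheme \<Rightarrow> ('b, 'm \<Rightarrow> 'b) module" where
  "monoid_algebra B M =
    \<lparr>carrier = {f. (\<forall>w. f w \<in> carrier B) \<and> finite {w. f w \<noteq> \<zero>\<^bsub>B\<^esub>} \<and> {w. f w \<noteq> \<zero>\<^bsub>B\<^esub>} \<subseteq> carrier M},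
     monoid.mult = (\<lambda>f g w. \<Oplus>\<^bsub>B\<^esub>p \<in> {(u, v). f u \<noteq> \<zero>\<^bsub>B\<^esub> \<and> g v \<noteq> \<zero>\<^bsub>B\<^esub> \<and> u \<otimes>\<^bsub>M\<^esub> v = w}.
       f (fst p) \<otimes>\<^bsub>B\<^esub> g (snd p)),
     one = (\<lambda>w. if w = \<one>\<^bsub>M\<^esub> then \<one>\<^bsub>B\<^esub> else \<zero>\<^bsub>B\<^esub>),
     ring.zero = (\<lambda>w. \<zero>\<^bsub>B\<^esub>),
     add = (\<lambda>f g w. f w \<oplus>\<^bsub>B\<^esub> g w),
     module.smult = (\<lambda>c f w. c \<otimes>\<^bsub>B\<^esub> f w)\<rparr>"

definition monomial :: "('b, 'x) ring_scheme \<Rightarrow> 'm \<Rightarrow> 'm \<Rightarrow> 'b" where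
  "monomial B m = (\<lambda>w. if w = m then \<one>\<^bsub>B\<^esub> else \<zero>\<^bsub>B\<^esub>)"

definition word_monoid :: "'s set \<Rightarrow> 's list monoid" where
  "word_monoid S = \<lparr>carrier = lists S, monoid.mult = (@), one = []\<rparr>"

definition quotient_algebra :: "('b, 'a) module \<Rightarrow> 'a set \<Rightarrow> ('b, 'a set) module" where
  "quotient_algebra A I = ring.extend (A Quot I)
     \<lparr>module.smult = (\<lambda>c C. \<Union>x\<in>C. I +>\<^bsub>A\<^esub> (c \<odot>\<^bsub>A\<^esub> x))\<rparr>"

text \<open>\<open>A\<close> is not assumed to be commutative, in contrast to the library's locale \<open>algebra\<close>.\<close>

definition algebra_hom ::
    "('b, 'x) ring_scheme \<Rightarrow> ('b, 'a) module \<Rightarrow> ('b, 'e) module \<Rightarrow> ('a \<Rightarrow> 'e) set" where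
  "algebra_hom B A E =
    {h \<in> ring_hom A E. \<forall>c\<in>carrier B. \<forall>x\<in>carrier A. h (c \<odot>\<^bsub>A\<^esub> x) = c \<odot>\<^bsub>E\<^esub> h x}"

text \<open>Endomorphisms act on the right: the product \<open>f \<otimes> g\<close> is first \<open>f\<close>, then \<open>g\<close>.\<close>

definition End_algebra ::
    "('b, 'x) ring_scheme \<Rightarrow> ('b, 'v) module \<Rightarrow> ('b, 'v \<Rightarrow> 'v) module" where
  "End_algebra B M =
    \<lparr>carrier = {f \<in> carrier M \<rightarrow>\<^sub>E carrier M.
       (\<forall>x\<in>carrier M. \<forall>y\<in>carrier M. f (x \<oplus>\<^bsub>M\<^esub> y) = f x \<oplus>\<^bsub>M\<^esub> f y) \<and>
       (\<forall>c\<in>carrier B. \<forall>x\<in>carrier M. f (c \<odot>\<^bsub>M\<^esub> x) = c \<odot>\<^bsub>M\<^esub> f x)},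
     monoid.mult = (\<lambda>f g. compose (carrier M) g f),
     one = (\<lambda>x\<in>carrier M. x),
     ring.zero = (\<lambda>x\<in>carrier M. \<zero>\<^bsub>M\<^esub>),
     add = (\<lambda>f g. \<lambda>x\<in>carrier M. f x \<oplus>\<^bsub>M\<^esub> g x),
     module.smult = (\<lambda>c f. \<lambda>x\<in>carrier M. c \<odot>\<^bsub>M\<^esub> f x)\<rparr>"

section \<open>Extension of scalars\<close>

text \<open>
  For an \<open>R\<close>-algebra \<open>A\<close> and a ring homomorphism \<open>\<phi> : R \<rightarrow> K\<close>, the tensor product \<open>A \<otimes>\<^sub>R K\<close>
  is the free abelian group on \<open>A \<times> K\<close> modulo the subgroup generated by the bilinearity and
  balancing relations. Here the free abelian group carries the product
  \<open>(a, k) (b, l) = (ab, kl)\<close>, that is, it is the monoid ring \<open>\<int>[A \<times> K]\<close>. The set of relators is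
  stable under multiplication by elements of \<open>A \<times> K\<close> on both sides, so the subgroup it generates
  is already an ideal, and the quotient by the generated ideal is the usual tensor product with
  its usual multiplication.
\<close>

definition tensor_monoid_ring ::
    "('r, 'a) module \<Rightarrow> 'k ring \<Rightarrow> (int, 'a \<times> 'k \<Rightarrow> int) module" where
  "tensor_monoid_ring A K = monoid_algebra \<Z> (A \<times>\<times> K)"

definition tensor_relators ::
    "'r ring \<Rightarrow> ('r, 'a) module \<Rightarrow> 'k ring \<Rightarrow> ('r \<Rightarrow> 'k) \<Rightarrow> ('a \<times> 'k \<Rightarrow> int) set" where
  "tensor_relators R A K \<phi> =
    (let P = tensor_monoid_ring A K; p = (\<lambda>a k. monomial \<Z> (a, k)) in
      {p (a \<oplus>\<^bsub>A\<^esub> b) k \<ominus>\<^bsub>P\<^esub> (p a k \<oplus>\<^bsub>P\<^esub> p b k) | a b k.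
         a \<in> carrier A \<and> b \<in> carrier A \<and> k \<in> carrier K} \<union>
      {p a (k \<oplus>\<^bsub>K\<^esub> l) \<ominus>\<^bsub>P\<^esub> (p a k \<oplus>\<^bsub>P\<^esub> p a l) | a k l.
         a \<in> carrier A \<and> k \<in> carrier K \<and> l \<in> carrier K} \<union>
      {p (c \<odot>\<^bsub>A\<^esub> a) k \<ominus>\<^bsub>P\<^esub> p a (\<phi> c \<otimes>\<^bsub>K\<^esub> k) | c a k.
         c \<in> carrier R \<and> a \<in> carrier A \<and> k \<in> carrier K})"

definition tensor_ideal ::
    "'r ring \<Rightarrow> ('r, 'a) module \<Rightarrow> 'k ring \<Rightarrow> ('r \<Rightarrow> 'k) \<Rightarrow> ('a \<times> 'k \<Rightarrow> int) set" where
  "tensor_ideal R A K \<phi> = Idl\<^bsub>tensor_monoid_ring A K\<^esub> (tensor_relators R A K \<phi>)"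

definition pure_tensor ::
    "'r ring \<Rightarrow> ('r, 'a) module \<Rightarrow> 'k ring \<Rightarrow> ('r \<Rightarrow> 'k) \<Rightarrow> 'a \<Rightarrow> 'k \<Rightarrow> ('a \<times> 'k \<Rightarrow> int) set" where
  "pure_tensor R A K \<phi> a k =
     tensor_ideal R A K \<phi> +>\<^bsub>tensor_monoid_ring A K\<^esub> monomial \<Z> (a, k)"

definition scalar_extension ::
    "'r ring \<Rightarrow> ('r, 'a) module \<Rightarrow> 'k ring \<Rightarrow> ('r \<Rightarrow> 'k) \<Rightarrow> ('k, ('a \<times> 'k \<Rightarrow> int) set) module" where
  "scalar_extension R A K \<phi> =
    (let Q = tensor_monoid_ring A K Quot tensor_ideal R A K \<phi> in
      ring.extend Q \<lparr>module.smult = (\<lambda>c C. pure_tensor R A K \<phi> \<one>\<^bsub>A\<^esub> c \<otimes>\<^bsub>Q\<^esub> C)\<rparr>)"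

section \<open>The Yokonuma--Hecke algebra\<close>

datatype yh_gen = Gen_t nat | Gen_g nat

definition yh_gens :: "nat \<Rightarrow> yh_gen set" where
  "yh_gens n = Gen_t ` {1..n} \<union> Gen_g ` {1..<n}"

definition yh_free :: "'b ring \<Rightarrow> nat \<Rightarrow> ('b, yh_gen list \<Rightarrow> 'b) module" where
  "yh_free B n = monoid_algebra B (word_monoid (yh_gens n))"

text \<open>
  \<open>e\<^sub>i = r\<^sup>-\<^sup>1 \<Sum>\<^sub>s t\<^sub>i\<^sup>s t\<^sub>i\<^sub>+\<^sub>1\<^sup>-\<^sup>s\<close>, where \<open>t\<^sub>i\<^sub>+\<^sub>1\<^sup>-\<^sup>s\<close> is written as
  \<open>t\<^sub>i\<^sub>+\<^sub>1\<^sup>r\<^sup>-\<^sup>s\<close> because of the relation \<open>t\<^sub>i\<^sub>+\<^sub>1\<^sup>r = 1\<close>.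
\<close>

definition yh_e :: "'b ring \<Rightarrow> nat \<Rightarrow> nat \<Rightarrow> nat \<Rightarrow> yh_gen list \<Rightarrow> 'b" where
  "yh_e B r n i =
    (let A = yh_free B n; t = (\<lambda>i. monomial B [Gen_t i]) in
      (inv\<^bsub>B\<^esub> ([r] \<cdot>\<^bsub>B\<^esub> \<one>\<^bsub>B\<^esub>)) \<odot>\<^bsub>A\<^esub>
        (\<Oplus>\<^bsub>A\<^esub>s\<in>{..<r}. (t i [^]\<^bsub>A\<^esub> s) \<otimes>\<^bsub>A\<^esub> (t (Suc i) [^]\<^bsub>A\<^esub> (r - s))))"

definition yh_relators :: "'b ring \<Rightarrow> 'b \<Rightarrow> nat \<Rightarrow> nat \<Rightarrow> (yh_gen list \<Rightarrow> 'b) set" where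
  "yh_relators B q r n =
    (let A = yh_free B n;
         t = (\<lambda>i. monomial B [Gen_t i]);
         g = (\<lambda>i. monomial B [Gen_g i]) in
      {(t i [^]\<^bsub>A\<^esub> r) \<ominus>\<^bsub>A\<^esub> \<one>\<^bsub>A\<^esub> | i. i \<in> {1..n}} \<union>
      {(t i \<otimes>\<^bsub>A\<^esub> t j) \<ominus>\<^bsub>A\<^esub> (t j \<otimes>\<^bsub>A\<^esub> t i) | i j. i \<in> {1..n} \<and> j \<in> {1..n}} \<union>
      {(t j \<otimes>\<^bsub>A\<^esub> g i) \<ominus>\<^bsub>A\<^esub> (g i \<otimes>\<^bsub>A\<^esub> t (transpose i (Suc i) j)) | i j.
         i \<in> {1..<n} \<and> j \<in> {1..n}} \<union>
      {(g i \<otimes>\<^bsub>A\<^esub> g j) \<ominus>\<^bsub>A\<^esub> (g j \<otimes>\<^bsub>A\<^esub> g i) | i j.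
         i \<in> {1..<n} \<and> j \<in> {1..<n} \<and> \<bar>int i - int j\<bar> > 1} \<union>
      {(g i \<otimes>\<^bsub>A\<^esub> g (Suc i) \<otimes>\<^bsub>A\<^esub> g i) \<ominus>\<^bsub>A\<^esub> (g (Suc i) \<otimes>\<^bsub>A\<^esub> g i \<otimes>\<^bsub>A\<^esub> g (Suc i)) | i.
         i \<in> {1..<n} \<and> Suc i \<in> {1..<n}} \<union>
      {(g i \<otimes>\<^bsub>A\<^esub> g i) \<ominus>\<^bsub>A\<^esub>
         (\<one>\<^bsub>A\<^esub> \<oplus>\<^bsub>A\<^esub> (q \<ominus>\<^bsub>B\<^esub> inv\<^bsub>B\<^esub> q) \<odot>\<^bsub>A\<^esub> (yh_e B r n i \<otimes>\<^bsub>A\<^esub> g i)) | i.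
         i \<in> {1..<n}})"

definition yh_ideal :: "'b ring \<Rightarrow> 'b \<Rightarrow> nat \<Rightarrow> nat \<Rightarrow> (yh_gen list \<Rightarrow> 'b) set" where
  "yh_ideal B q r n = Idl\<^bsub>yh_free B n\<^esub> (yh_relators B q r n)"

definition yh_algebra :: "'b ring \<Rightarrow> 'b \<Rightarrow> nat \<Rightarrow> nat \<Rightarrow> ('b, (yh_gen list \<Rightarrow> 'b) set) module" where
  "yh_algebra B q r n = quotient_algebra (yh_free B n) (yh_ideal B q r n)"

definition yh_t :: "'b ring \<Rightarrow> 'b \<Rightarrow> nat \<Rightarrow> nat \<Rightarrow> nat \<Rightarrow> (yh_gen list \<Rightarrow> 'b) set" where
  "yh_t B q r n i = yh_ideal B q r n +>\<^bsub>yh_free B n\<^esub> monomial B [Gen_t i]"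

definition yh_g :: "'b ring \<Rightarrow> 'b \<Rightarrow> nat \<Rightarrow> nat \<Rightarrow> nat \<Rightarrow> (yh_gen list \<Rightarrow> 'b) set" where
  "yh_g B q r n i = yh_ideal B q r n +>\<^bsub>yh_free B n\<^esub> monomial B [Gen_g i]"

section \<open>The tensor space and its operators\<close>

text \<open>
  The pair \<open>(i, t)\<close> stands for the basis vector \<open>v\<^sub>i\<^sup>t\<close> of \<open>V\<close>. The tensor algebra of the free
  module \<open>V\<close> is the free algebra on this basis; the tensor power \<open>V\<^sup>\<otimes>\<^sup>m\<close> is its homogeneous
  component of degree \<open>m\<close>, with the word \<open>[a\<^sub>1, \<dots>, a\<^sub>m]\<close> standing for
  \<open>v(a\<^sub>1) \<otimes> \<dots> \<otimes> v(a\<^sub>m)\<close>. The product of the tensor algebra is the tensor product of tensors.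
\<close>

definition tensor_algebra ::
    "'b ring \<Rightarrow> nat \<Rightarrow> nat \<Rightarrow> ('b, (nat \<times> nat) list \<Rightarrow> 'b) module" where
  "tensor_algebra B r n = monoid_algebra B (word_monoid ({1..n} \<times> {0..<r}))"

text \<open>Only the module structure of this record is meaningful.\<close>

definition tensor_power ::
    "'b ring \<Rightarrow> nat \<Rightarrow> nat \<Rightarrow> nat \<Rightarrow> ('b, (nat \<times> nat) list \<Rightarrow> 'b) module" where
  "tensor_power B r n m = (tensor_algebra B r n)
     \<lparr>carrier := {x \<in> carrier (tensor_algebra B r n). \<forall>w. x w \<noteq> \<zero>\<^bsub>B\<^esub> \<longrightarrow> length w = m}\<rparr>"

definition linear_extension ::
    "('b, 'x) ring_scheme \<Rightarrow> ('b, 'm \<Rightarrow> 'b) module \<Rightarrow> ('m \<Rightarrow> 'm \<Rightarrow> 'b) \<Rightarrow> ('m \<Rightarrow> 'b) \<Rightarrow> 'm \<Rightarrow> 'b" where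
  "linear_extension B M f = (\<lambda>x\<in>carrier M. \<Oplus>\<^bsub>M\<^esub>w\<in>{w. x w \<noteq> \<zero>\<^bsub>B\<^esub>}. x w \<odot>\<^bsub>M\<^esub> f w)"

definition T_basis :: "'b ring \<Rightarrow> 'b \<Rightarrow> nat \<Rightarrow> nat \<Rightarrow> nat \<times> nat \<Rightarrow> (nat \<times> nat) list \<Rightarrow> 'b" where
  "T_basis B \<xi> r n = (\<lambda>(i, t).
     (\<xi> [^]\<^bsub>B\<^esub> t) \<odot>\<^bsub>tensor_algebra B r n\<^esub> monomial B [(i, t)])"

definition G_basis ::
    "'b ring \<Rightarrow> 'b \<Rightarrow> nat \<Rightarrow> nat \<Rightarrow> nat \<times> nat \<Rightarrow> nat \<times> nat \<Rightarrow> (nat \<times> nat) list \<Rightarrow> 'b" where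
  "G_basis B q r n = (\<lambda>(i, t) (j, s).
    (let A = tensor_algebra B r n;
         x = monomial B [(i, t)] \<otimes>\<^bsub>A\<^esub> monomial B [(j, s)];
         y = monomial B [(j, s)] \<otimes>\<^bsub>A\<^esub> monomial B [(i, t)] in
      if t \<noteq> s then y
      else if i = j then q \<odot>\<^bsub>A\<^esub> x
      else if i > j then y
      else ((q \<ominus>\<^bsub>B\<^esub> inv\<^bsub>B\<^esub> q) \<odot>\<^bsub>A\<^esub> x) \<oplus>\<^bsub>A\<^esub> y))"

text \<open>Factors of a tensor are numbered from \<open>1\<close>, letters of a list from \<open>0\<close>.\<close>

definition T_op ::
    "'b ring \<Rightarrow> 'b \<Rightarrow> nat \<Rightarrow> nat \<Rightarrow> nat \<Rightarrow> ((nat \<times> nat) list \<Rightarrow> 'b) \<Rightarrow> (nat \<times> nat) list \<Rightarrow> 'b" where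
  "T_op B \<xi> r n i =
    (let A = tensor_algebra B r n in
      linear_extension B (tensor_power B r n n)
        (\<lambda>w. monomial B (take (i - 1) w) \<otimes>\<^bsub>A\<^esub> T_basis B \<xi> r n (w ! (i - 1))
               \<otimes>\<^bsub>A\<^esub> monomial B (drop i w)))"

definition G_op ::
    "'b ring \<Rightarrow> 'b \<Rightarrow> nat \<Rightarrow> nat \<Rightarrow> nat \<Rightarrow> ((nat \<times> nat) list \<Rightarrow> 'b) \<Rightarrow> (nat \<times> nat) list \<Rightarrow> 'b" where
  "G_op B q r n i =
    (let A = tensor_algebra B r n in
      linear_extension B (tensor_power B r n n)
        (\<lambda>w. monomial B (take (i - 1) w) \<otimes>\<^bsub>A\<^esub> G_basis B q r n (w ! (i - 1)) (w ! i)
               \<otimes>\<^bsub>A\<^esub> monomial B (drop (i + 1) w)))"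

text \<open>
  \<open>\<rho>\<close> is the representation on \<open>V\<^sup>\<otimes>\<^sup>n\<close> of the \<open>B\<close>-algebra \<open>A\<close>, generated by elements
  \<open>t i\<close> and \<open>g i\<close>, that sends these to the operators above.
\<close>

definition is_tensor_rep ::
    "'b ring \<Rightarrow> 'b \<Rightarrow> 'b \<Rightarrow> nat \<Rightarrow> nat \<Rightarrow> ('b, 'a) module \<Rightarrow> (nat \<Rightarrow> 'a) \<Rightarrow> (nat \<Rightarrow> 'a) \<Rightarrow>
     ('a \<Rightarrow> ((nat \<times> nat) list \<Rightarrow> 'b) \<Rightarrow> (nat \<times> nat) list \<Rightarrow> 'b) \<Rightarrow> bool" where
  "is_tensor_rep B q \<xi> r n A t g \<rho> \<longleftrightarrow>
     \<rho> \<in> algebra_hom B A (End_algebra B (tensor_power B r n n)) \<and>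
     (\<forall>i\<in>{1..n}. \<rho> (t i) = T_op B \<xi> r n i) \<and>
     (\<forall>i\<in>{1..<n}. \<rho> (g i) = G_op B q r n i)"

section \<open>The generic ground ring and its specializations\<close>

text \<open>\<open>R = \<int>[q, q\<^sup>-\<^sup>1, \<xi>, r\<^sup>-\<^sup>1, \<Delta>\<^sup>-\<^sup>1]\<close> as a subring of the field \<open>\<complex>(q)\<close>.\<close>

definition gen_q :: "complex poly fract" where
  "gen_q = Fract [:0, 1:] 1"

definition gen_xi :: "nat \<Rightarrow> complex poly fract" where
  "gen_xi r = Fract [:exp (2 * of_real pi * \<i> / of_nat r):] 1"

definition gen_Delta :: "nat \<Rightarrow> complex poly fract" where
  "gen_Delta r = (\<Prod>(i, j)\<in>{(i, j). i < j \<and> j < r}. gen_xi r ^ i - gen_xi r ^ j)"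

definition gen_ring :: "nat \<Rightarrow> complex poly fract ring" where
  "gen_ring r = (ring_of_type_algebra :: complex poly fract ring)
     \<lparr>carrier := generate_ring (ring_of_type_algebra :: complex poly fract ring)
        {gen_q, inverse gen_q, gen_xi r, inverse (of_nat r), inverse (gen_Delta r)}\<rparr>"

text \<open>
  The homomorphism \<open>\<phi>\<close> is the structure map of \<open>K\<close> as an \<open>R\<close>-algebra via \<open>q \<mapsto> q\<close> and
  \<open>\<xi> \<mapsto> \<xi>\<close>. The zero ring is allowed.
\<close>

definition is_specialization ::
    "nat \<Rightarrow> 'k ring \<Rightarrow> 'k \<Rightarrow> 'k \<Rightarrow> (complex poly fract \<Rightarrow> 'k) \<Rightarrow> bool" where
  "is_specialization r K q \<xi> \<phi> \<longleftrightarrow>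
     cring K \<and> q \<in> Units K \<and> \<xi> \<in> Units K \<and> \<xi> [^]\<^bsub>K\<^esub> r = \<one>\<^bsub>K\<^esub> \<and>
     [r] \<cdot>\<^bsub>K\<^esub> \<one>\<^bsub>K\<^esub> \<in> Units K \<and>
     (\<Otimes>\<^bsub>K\<^esub>p\<in>{(i, j). i < j \<and> j < r}. (\<xi> [^]\<^bsub>K\<^esub> fst p) \<ominus>\<^bsub>K\<^esub> (\<xi> [^]\<^bsub>K\<^esub> snd p)) \<in> Units K \<and>
     \<phi> \<in> ring_hom (gen_ring r) K \<and> \<phi> gen_q = q \<and> \<phi> (gen_xi r) = \<xi>"

text \<open>\<open>\<Y>\<^sub>r\<^sub>,\<^sub>n(q)\<close> over \<open>R\<close> and \<open>\<Y>\<^sub>r\<^sub>,\<^sub>n(q) \<otimes>\<^sub>R K\<close>.\<close>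

abbreviation YH :: "nat \<Rightarrow> nat \<Rightarrow> _" where
  "YH r n \<equiv> yh_algebra (gen_ring r) gen_q r n"

abbreviation YH_t :: "nat \<Rightarrow> nat \<Rightarrow> nat \<Rightarrow> _" where
  "YH_t r n \<equiv> yh_t (gen_ring r) gen_q r n"

abbreviation YH_g :: "nat \<Rightarrow> nat \<Rightarrow> nat \<Rightarrow> _" where
  "YH_g r n \<equiv> yh_g (gen_ring r) gen_q r n"

abbreviation YH_spec :: "nat \<Rightarrow> nat \<Rightarrow> 'k ring \<Rightarrow> (complex poly fract \<Rightarrow> 'k) \<Rightarrow> _" where
  "YH_spec r n K \<phi> \<equiv> scalar_extension (gen_ring r) (YH r n) K \<phi>"

abbreviation YH_spec_t :: "nat \<Rightarrow> nat \<Rightarrow> 'k ring \<Rightarrow> (complex poly fract \<Rightarrow> 'k) \<Rightarrow> nat \<Rightarrow> _" where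
  "YH_spec_t r n K \<phi> i \<equiv> pure_tensor (gen_ring r) (YH r n) K \<phi> (YH_t r n i) \<one>\<^bsub>K\<^esub>"

abbreviation YH_spec_g :: "nat \<Rightarrow> nat \<Rightarrow> 'k ring \<Rightarrow> (complex poly fract \<Rightarrow> 'k) \<Rightarrow> nat \<Rightarrow> _" where
  "YH_spec_g r n K \<phi> i \<equiv> pure_tensor (gen_ring r) (YH r n) K \<phi> (YH_g r n i) \<one>\<^bsub>K\<^esub>"

end

theory Submission
  imports Defs
begin

text \<open>
  By the defining relations the algebra is spanned over the ground ring by the products of a monomial in
  \<open>t\<^sub>1, \<dots>, t\<^sub>n\<close>, with exponents less than \<open>r\<close>, and a normal word in the \<open>g\<^sub>i\<close>, one for each permutation.
  These products act linearly independently. Apply them to the tensors \<open>v\<^sub>n \<otimes> v\<^sub>n\<^sub>-\<^sub>1 \<otimes> \<cdots> \<otimes> v\<^sub>1\<close> with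
  arbitrary upper indices, the colours: the monomial in the \<open>t\<^sub>i\<close> multiplies such a tensor by a power of \<open>\<xi>\<close>,
  and since the lower indices decrease, the normal word then merely permutes the tensor factors, different
  words by different permutations. Letting the colours vary, the coefficients are recovered by Fourier
  inversion over \<open>\<int>/r\<close>, which is possible because \<open>r\<close> and the differences \<open>\<xi>\<^sup>i - \<xi>\<^sup>j\<close> are invertible. The
  argument applies verbatim to every algebra that satisfies the relations and is generated by the \<open>t\<^sub>i\<close>
  and \<open>g\<^sub>i\<close> over a ring with these properties, hence both to \<open>\<Y>\<^sub>r\<^sub>,\<^sub>n(q)\<close> and to its specializations.
\<close>

section \<open>Noncommutative algebras\<close>

text \<open>Injectivity is not preserved by tensoring, so the statement over \<open>K\<close> cannot
  be deduced from the one over \<open>R\<close>; this is why the argument is phrased for any algebra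
  satisfying the relations. No basis is exhibited: it suffices that every element is a combination
  of normal products and that such a combination vanishes if it acts as zero. The normal words
  follow the chain of symmetric groups, one coset factor \<open>desc m d\<close> at a time, and they
  are taken apart in the opposite order: the last factor is recognised by the position to which it
  moves the letter of smallest lower index. The coefficients met on the way are elements of a
  smaller submodule of the algebra; scalars appear only at the bottom, in the torus part. Since
  operators act on the right, a product \<open>h N\<close> applies \<open>h\<close> first, so torus
  monomials written on the left meet the decreasing tensor while it is still an eigenvector that
  they can see undisturbed. The relations must also be checked for the operators themselves, because
  the existence of the representations is part of the claim.\<close>

locale nc_algebra = module R M + M?: ring M for R and M (structure) +
  assumes smult_mult_l: "\<lbrakk>a \<in> carrier R; x \<in> carrier M; y \<in> carrier M\<rbrakk> \<Longrightarrow>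
      (a \<odot>\<^bsub>M\<^esub> x) \<otimes>\<^bsub>M\<^esub> y = a \<odot>\<^bsub>M\<^esub> (x \<otimes>\<^bsub>M\<^esub> y)"
    and smult_mult_r: "\<lbrakk>a \<in> carrier R; x \<in> carrier M; y \<in> carrier M\<rbrakk> \<Longrightarrow>
      x \<otimes>\<^bsub>M\<^esub> (a \<odot>\<^bsub>M\<^esub> y) = a \<odot>\<^bsub>M\<^esub> (x \<otimes>\<^bsub>M\<^esub> y)"

lemma nc_algebraI:
  fixes R (structure) and M (structure)
  assumes "module R M" "ring M"
    "\<And>a x y. \<lbrakk>a \<in> carrier R; x \<in> carrier M; y \<in> carrier M\<rbrakk> \<Longrightarrow> (a \<odot>\<^bsub>M\<^esub> x) \<otimes>\<^bsub>M\<^esub> y = a \<odot>\<^bsub>M\<^esub> (x \<otimes>\<^bsub>M\<^esub> y)"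
    "\<And>a x y. \<lbrakk>a \<in> carrier R; x \<in> carrier M; y \<in> carrier M\<rbrakk> \<Longrightarrow> x \<otimes>\<^bsub>M\<^esub> (a \<odot>\<^bsub>M\<^esub> y) = a \<odot>\<^bsub>M\<^esub> (x \<otimes>\<^bsub>M\<^esub> y)"
  shows "nc_algebra R M"
proof -
  interpret module R M by fact
  interpret M: ring M by fact
  show ?thesis by unfold_locales (use assms in auto)
qed

section \<open>Monoid algebras\<close>

definition single :: "('b, 'x) ring_scheme \<Rightarrow> 'b \<Rightarrow> 'm \<Rightarrow> 'm \<Rightarrow> 'b" where
  "single B c m = (\<lambda>w. if w = m then c else \<zero>\<^bsub>B\<^esub>)"

lemma monomial_single: "monomial B m = single B \<one>\<^bsub>B\<^esub> m"
  by (simp add: monomial_def single_def)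

locale monoid_alg = B: cring B + M: monoid M for B (structure) and M (structure)
begin

abbreviation P where "P \<equiv> monoid_algebra B M"
abbreviation supp where "supp f \<equiv> {w. f w \<noteq> \<zero>}"

lemma zero_P: "\<zero>\<^bsub>P\<^esub> = (\<lambda>w. \<zero>)" and one_P: "\<one>\<^bsub>P\<^esub> = single B \<one> \<one>\<^bsub>M\<^esub>"
  and add_P: "f \<oplus>\<^bsub>P\<^esub> g = (\<lambda>w. f w \<oplus> g w)" and smult_P: "c \<odot>\<^bsub>P\<^esub> f = (\<lambda>w. c \<otimes> f w)"
  by (simp_all add: monoid_algebra_def single_def)

lemma carrier_P: "f \<in> carrier P \<longleftrightarrow> (\<forall>w. f w \<in> carrier B) \<and> finite (supp f) \<and> supp f \<subseteq> carrier M"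
  by (simp add: monoid_algebra_def)

lemma mult_P: "(f \<otimes>\<^bsub>P\<^esub> g) w = (\<Oplus>p \<in> {(u, v). f u \<noteq> \<zero> \<and> g v \<noteq> \<zero> \<and> u \<otimes>\<^bsub>M\<^esub> v = w}. f (fst p) \<otimes> g (snd p))"
  by (simp add: monoid_algebra_def)

lemma single_closed: "c \<in> carrier B \<Longrightarrow> m \<in> carrier M \<Longrightarrow> single B c m \<in> carrier P"
  by (auto simp: carrier_P single_def)

lemma single_supp: "supp (single B c m) \<subseteq> {m}"
  by (auto simp: single_def)

lemma P_closed: "f \<in> carrier P \<Longrightarrow> f w \<in> carrier B"
  by (simp add: carrier_P)

lemma carrier_PI: "finite S \<Longrightarrow> S \<subseteq> carrier M \<Longrightarrow> supp f \<subseteq> S \<Longrightarrow> (\<And>w. f w \<in> carrier B) \<Longrightarrow> f \<in> carrier P"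
  unfolding carrier_P by (auto intro: finite_subset)

lemma supp_P: "f \<in> carrier P \<Longrightarrow> finite (supp f)" "f \<in> carrier P \<Longrightarrow> supp f \<subseteq> carrier M"
  by (auto simp: carrier_P)

text \<open>In the definition the index set of the convolution depends on the supports of both
  factors. Passing to a fixed finite rectangle adds only zero terms and makes the sums for different
  factors comparable, as distributivity requires.\<close>

lemma mult_eq:
  assumes f: "f \<in> carrier P" and g: "g \<in> carrier P" and U: "finite U" "supp f \<subseteq> U" and V: "finite V" "supp g \<subseteq> V"
  shows "(f \<otimes>\<^bsub>P\<^esub> g) w = (\<Oplus>p \<in> {p \<in> U \<times> V. fst p \<otimes>\<^bsub>M\<^esub> snd p = w}. f (fst p) \<otimes> g (snd p))"
  unfolding mult_P
  apply (rule B.add.finprod_mono_neutral_cong_left)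
  using U V P_closed[OF f] P_closed[OF g] by auto

lemma abelian_group_P: "abelian_group P"
proof (rule abelian_groupI)
  fix f g assume f: "f \<in> carrier P" and g: "g \<in> carrier P"
  show "f \<oplus>\<^bsub>P\<^esub> g \<in> carrier P"
    by (rule carrier_PI[of "supp f \<union> supp g"]) (use f g in \<open>auto simp: add_P carrier_P\<close>)
next
  show "\<zero>\<^bsub>P\<^esub> \<in> carrier P" by (simp add: carrier_P zero_P)
next
  fix f assume f: "f \<in> carrier P"
  show "\<exists>g\<in>carrier P. g \<oplus>\<^bsub>P\<^esub> f = \<zero>\<^bsub>P\<^esub>"
  proof
    show "(\<lambda>w. \<ominus> f w) \<in> carrier P"
      by (rule carrier_PI[of "supp f"]) (use f in \<open>auto simp: carrier_P\<close>)
    show "(\<lambda>w. \<ominus> f w) \<oplus>\<^bsub>P\<^esub> f = \<zero>\<^bsub>P\<^esub>"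
      using f by (simp add: carrier_P add_P zero_P B.l_neg)
  qed
qed (auto simp: add_P zero_P carrier_P B.a_ac)

lemma module_P: "module B P"
proof (rule moduleI)
  fix a f assume a: "a \<in> carrier B" and f: "f \<in> carrier P"
  show "a \<odot>\<^bsub>P\<^esub> f \<in> carrier P"
    by (rule carrier_PI[of "supp f"]) (use a f in \<open>auto simp: carrier_P smult_P\<close>)
qed (auto simp: abelian_group_P B.is_cring smult_P add_P carrier_P B.l_distr B.r_distr B.m_assoc)

sublocale P: module B P by (rule module_P)

lemma smult_single: "a \<odot>\<^bsub>P\<^esub> single B c m = single B (a \<otimes> c) m" if "a \<in> carrier B"
  using that by (auto simp: smult_P single_def)

lemma mult_closed: 
  assumes f: "f \<in> carrier P" and g: "g \<in> carrier P"
  shows "f \<otimes>\<^bsub>P\<^esub> g \<in> carrier P"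
proof -
  have 1: "(f \<otimes>\<^bsub>P\<^esub> g) w \<in> carrier B" for w
    unfolding mult_P by (rule B.finsum_closed) (use P_closed[OF f] P_closed[OF g] in auto)
  have *: "supp (f \<otimes>\<^bsub>P\<^esub> g) \<subseteq> (\<lambda>(u,v). u \<otimes>\<^bsub>M\<^esub> v) ` (supp f \<times> supp g)"
  proof
    fix w assume w: "w \<in> supp (f \<otimes>\<^bsub>P\<^esub> g)"
    have "{(u, v). f u \<noteq> \<zero> \<and> g v \<noteq> \<zero> \<and> u \<otimes>\<^bsub>M\<^esub> v = w} \<noteq> {}"
    proof
      assume "{(u, v). f u \<noteq> \<zero> \<and> g v \<noteq> \<zero> \<and> u \<otimes>\<^bsub>M\<^esub> v = w} = {}"
      then have "(f \<otimes>\<^bsub>P\<^esub> g) w = \<zero>" by (simp only: mult_P B.finsum_empty)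
      with w show False by simp
    qed
    then show "w \<in> (\<lambda>(u,v). u \<otimes>\<^bsub>M\<^esub> v) ` (supp f \<times> supp g)" by force
  qed
  show ?thesis
    by (rule carrier_PI[OF _ _ * 1]) (use supp_P[OF f] supp_P[OF g] in auto)
qed

lemma add_mult:
  assumes f: "f \<in> carrier P" "f' \<in> carrier P" and g: "g \<in> carrier P"
  shows "(f \<oplus>\<^bsub>P\<^esub> f') \<otimes>\<^bsub>P\<^esub> g = f \<otimes>\<^bsub>P\<^esub> g \<oplus>\<^bsub>P\<^esub> f' \<otimes>\<^bsub>P\<^esub> g"
proof
  fix w
  let ?U = "supp f \<union> supp f'"
  have U: "finite ?U" "supp (f \<oplus>\<^bsub>P\<^esub> f') \<subseteq> ?U" "supp f \<subseteq> ?U" "supp f' \<subseteq> ?U" 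
    and V: "finite (supp g)" "supp g \<subseteq> supp g"
    using f g by (auto simp: carrier_P add_P)
  note c = P_closed[OF f(1)] P_closed[OF f(2)] P_closed[OF g]
  show "((f \<oplus>\<^bsub>P\<^esub> f') \<otimes>\<^bsub>P\<^esub> g) w = (f \<otimes>\<^bsub>P\<^esub> g \<oplus>\<^bsub>P\<^esub> f' \<otimes>\<^bsub>P\<^esub> g) w"
    unfolding add_P[of "f \<otimes>\<^bsub>P\<^esub> g"]
    apply (subst mult_eq[OF P.M.a_closed[OF f] g U(1,2) V])
    apply (subst mult_eq[OF f(1) g U(1,3) V])
    apply (subst mult_eq[OF f(2) g U(1,4) V])
    apply (subst B.finsum_addf[symmetric])
    using c by (auto simp: add_P B.l_distr intro!: B.finsum_cong')
qed

lemma mult_add: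
  assumes f: "f \<in> carrier P" "f' \<in> carrier P" and g: "g \<in> carrier P"
  shows "g \<otimes>\<^bsub>P\<^esub> (f \<oplus>\<^bsub>P\<^esub> f') = g \<otimes>\<^bsub>P\<^esub> f \<oplus>\<^bsub>P\<^esub> g \<otimes>\<^bsub>P\<^esub> f'"
proof
  fix w
  let ?U = "supp f \<union> supp f'"
  have U: "finite ?U" "supp (f \<oplus>\<^bsub>P\<^esub> f') \<subseteq> ?U" "supp f \<subseteq> ?U" "supp f' \<subseteq> ?U" 
    and V: "finite (supp g)" "supp g \<subseteq> supp g"
    using f g by (auto simp: carrier_P add_P)
  note c = P_closed[OF f(1)] P_closed[OF f(2)] P_closed[OF g]
  show "(g \<otimes>\<^bsub>P\<^esub> (f \<oplus>\<^bsub>P\<^esub> f')) w = (g \<otimes>\<^bsub>P\<^esub> f \<oplus>\<^bsub>P\<^esub> g \<otimes>\<^bsub>P\<^esub> f') w"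
    unfolding add_P[of "g \<otimes>\<^bsub>P\<^esub> f"]
    apply (subst mult_eq[OF g P.M.a_closed[OF f] V U(1,2)])
    apply (subst mult_eq[OF g f(1) V U(1,3)])
    apply (subst mult_eq[OF g f(2) V U(1,4)])
    apply (subst B.finsum_addf[symmetric])
    using c by (auto simp: add_P B.r_distr intro!: B.finsum_cong')
qed

lemma single_mult:
  assumes "c \<in> carrier B" "d \<in> carrier B" "u \<in> carrier M" "v \<in> carrier M"
  shows "single B c u \<otimes>\<^bsub>P\<^esub> single B d v = single B (c \<otimes> d) (u \<otimes>\<^bsub>M\<^esub> v)"
proof
  fix w
  have e: "{p \<in> {u} \<times> {v}. fst p \<otimes>\<^bsub>M\<^esub> snd p = w} = (if u \<otimes>\<^bsub>M\<^esub> v = w then {(u,v)} else {})" by auto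
  have "(single B c u \<otimes>\<^bsub>P\<^esub> single B d v) w =
    (\<Oplus>p \<in> {p \<in> {u} \<times> {v}. fst p \<otimes>\<^bsub>M\<^esub> snd p = w}. single B c u (fst p) \<otimes> single B d v (snd p))"
    by (rule mult_eq) (use assms single_closed in \<open>auto simp: single_supp\<close>)
  also have "\<dots> = single B (c \<otimes> d) (u \<otimes>\<^bsub>M\<^esub> v) w"
    unfolding e using assms by (auto simp: single_def)
  finally show "(single B c u \<otimes>\<^bsub>P\<^esub> single B d v) w = single B (c \<otimes> d) (u \<otimes>\<^bsub>M\<^esub> v) w" .
qed

text \<open>The support is emptied one point at a time. Identities that are additive in an argument
  are thereby reduced to scaled monomials.\<close>

lemma P_induct [consumes 1, case_names zero add]:
  assumes f: "f \<in> carrier P" and z: "Q (\<lambda>w. \<zero>)"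
    and step: "\<And>c m f. c \<in> carrier B \<Longrightarrow> m \<in> carrier M \<Longrightarrow> f \<in> carrier P \<Longrightarrow> Q f \<Longrightarrow> Q (single B c m \<oplus>\<^bsub>P\<^esub> f)"
  shows "Q f"
proof -
  have "finite S \<Longrightarrow> f \<in> carrier P \<Longrightarrow> supp f \<subseteq> S \<Longrightarrow> Q f" for S
  proof (induction S arbitrary: f rule: finite_induct)
    case empty
    then have "f = (\<lambda>w. \<zero>)" by auto
    then show ?case using z by simp
  next
    case (insert m S)
    let ?g = "f(m := \<zero>)"
    have fin: "finite (supp f)" using insert.prems by (simp add: carrier_P)
    have g: "?g \<in> carrier P"
      using insert.prems unfolding carrier_P by (auto intro: finite_subset[OF _ fin])
    have "Q ?g" using insert by (intro insert.IH g) auto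
    show ?case
    proof (cases "f m = \<zero>")
      case True
      then have "?g = f" by auto
      with \<open>Q ?g\<close> show ?thesis by simp
    next
      case False
      then have m: "m \<in> carrier M" and c: "f m \<in> carrier B" using insert.prems by (auto simp: carrier_P)
      have "f = single B (f m) m \<oplus>\<^bsub>P\<^esub> ?g"
        using insert.prems by (auto simp: add_P single_def carrier_P)
      with step[OF c m g \<open>Q ?g\<close>] show ?thesis by simp
    qed
  qed
  then show ?thesis using f by (auto simp: carrier_P)
qed

lemma mult_zero: "f \<in> carrier P \<Longrightarrow> f \<otimes>\<^bsub>P\<^esub> (\<lambda>w. \<zero>) = (\<lambda>w. \<zero>)" "f \<in> carrier P \<Longrightarrow> (\<lambda>w. \<zero>) \<otimes>\<^bsub>P\<^esub> f = (\<lambda>w. \<zero>)"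
  by (auto simp: mult_P)

text \<open>Both sides are additive in each factor, so the factors become scaled monomials from
  right to left: \<open>1\<close> treats the third, \<open>2\<close> the second and the last
  induction the first. On monomials only associativity in \<open>B\<close> and \<open>M\<close> is
  left.\<close>

lemma mult_assoc_P:
  assumes f: "f \<in> carrier P" and g: "g \<in> carrier P" and h: "h \<in> carrier P"
  shows "(f \<otimes>\<^bsub>P\<^esub> g) \<otimes>\<^bsub>P\<^esub> h = f \<otimes>\<^bsub>P\<^esub> (g \<otimes>\<^bsub>P\<^esub> h)"
proof -
  have 1: "(single B a u \<otimes>\<^bsub>P\<^esub> single B b v) \<otimes>\<^bsub>P\<^esub> h = single B a u \<otimes>\<^bsub>P\<^esub> (single B b v \<otimes>\<^bsub>P\<^esub> h)"
    if "h \<in> carrier P" "a \<in> carrier B" "b \<in> carrier B" "u \<in> carrier M" "v \<in> carrier M" for a b u v h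
    using that
  proof (induction h rule: P_induct)
    case zero then show ?case by (simp add: mult_zero single_closed mult_closed)
  next
    case (add c w h)
    then show ?case 
      by (simp add: mult_add single_closed mult_closed single_mult B.m_assoc M.m_assoc)
  qed
  have 2: "(single B a u \<otimes>\<^bsub>P\<^esub> g) \<otimes>\<^bsub>P\<^esub> h = single B a u \<otimes>\<^bsub>P\<^esub> (g \<otimes>\<^bsub>P\<^esub> h)"
    if "g \<in> carrier P" "h \<in> carrier P" "a \<in> carrier B" "u \<in> carrier M" for a u g h
    using that
  proof (induction g rule: P_induct)
    case zero then show ?case by (simp add: mult_zero single_closed mult_closed)
  next
    case (add c w g)
    then show ?case 
      by (simp add: mult_add add_mult single_closed mult_closed 1)
  qed
  show ?thesis using f g h
  proof (induction f rule: P_induct)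
    case zero then show ?case by (simp add: mult_zero single_closed mult_closed)
  next
    case (add c w f)
    then show ?case 
      by (simp add: add_mult single_closed mult_closed 2)
  qed
qed

lemma one_mult_P:
  assumes "f \<in> carrier P"
  shows "\<one>\<^bsub>P\<^esub> \<otimes>\<^bsub>P\<^esub> f = f" "f \<otimes>\<^bsub>P\<^esub> \<one>\<^bsub>P\<^esub> = f"
  using assms
  by (induction f rule: P_induct) (simp_all add: one_P mult_zero mult_add add_mult single_closed single_mult)

lemma ring_P: "ring P"
  by (rule ringI[OF abelian_group_P monoidI])
    (auto simp: mult_closed mult_assoc_P one_mult_P add_mult mult_add single_closed one_P[symmetric] intro: single_closed[of \<one> "\<one>\<^bsub>M\<^esub>", folded one_P])

text \<open>Scalars act through their multiples of the unit, which are central because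
  \<open>B\<close> is commutative. Compatibility of scalars with products thus becomes
  associativity.\<close>

lemma smult_as_mult:
  assumes a: "a \<in> carrier B" and f: "f \<in> carrier P"
  shows "a \<odot>\<^bsub>P\<^esub> f = single B a \<one>\<^bsub>M\<^esub> \<otimes>\<^bsub>P\<^esub> f" "a \<odot>\<^bsub>P\<^esub> f = f \<otimes>\<^bsub>P\<^esub> single B a \<one>\<^bsub>M\<^esub>"
  using f a
  by (induction f rule: P_induct) (simp_all add: smult_P[of _ "\<lambda>w. \<zero>"] mult_zero mult_add add_mult single_closed single_mult
     P.smult_r_distr smult_single B.m_comm)

lemma nc_algebra_P: "nc_algebra B P"
proof (rule nc_algebraI[OF module_P ring_P])
  interpret Pr: ring P by (rule ring_P)
  fix a f g assume *: "a \<in> carrier B" "f \<in> carrier P" "g \<in> carrier P"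
  show "a \<odot>\<^bsub>P\<^esub> f \<otimes>\<^bsub>P\<^esub> g = a \<odot>\<^bsub>P\<^esub> (f \<otimes>\<^bsub>P\<^esub> g)"
    using * by (simp add: smult_as_mult(1) Pr.m_assoc single_closed)
  have "f \<otimes>\<^bsub>P\<^esub> (a \<odot>\<^bsub>P\<^esub> g) = f \<otimes>\<^bsub>P\<^esub> (g \<otimes>\<^bsub>P\<^esub> single B a \<one>\<^bsub>M\<^esub>)"
    using * smult_as_mult(2) by metis
  also have "\<dots> = a \<odot>\<^bsub>P\<^esub> (f \<otimes>\<^bsub>P\<^esub> g)"
    using * by (simp add: smult_as_mult(2) Pr.m_assoc single_closed)
  finally show "f \<otimes>\<^bsub>P\<^esub> (a \<odot>\<^bsub>P\<^esub> g) = a \<odot>\<^bsub>P\<^esub> (f \<otimes>\<^bsub>P\<^esub> g)" .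
qed

end

definition alg_lift :: "('b, 'x) ring_scheme \<Rightarrow> ('e, 'y) ring_scheme \<Rightarrow> ('b \<Rightarrow> 'e) \<Rightarrow> ('m \<Rightarrow> 'e) \<Rightarrow> ('m \<Rightarrow> 'b) \<Rightarrow> 'e" where
  "alg_lift B E \<psi> h f = (\<Oplus>\<^bsub>E\<^esub>w \<in> {w. f w \<noteq> \<zero>\<^bsub>B\<^esub>}. \<psi> (f w) \<otimes>\<^bsub>E\<^esub> h w)"

text \<open>The universal property of the monoid algebra with a noncommutative target: the images of
  \<open>\<psi>\<close> and \<open>h\<close> have to commute, which is \<open>h_comm\<close>. It
  serves twice, for the free algebra on the generators and for the integral monoid ring behind the
  tensor product.\<close>

locale monoid_alg_lift = monoid_alg B M + E: ring E + \<psi>: ring_hom_ring B E \<psi>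
  for B (structure) and M (structure) and E (structure) and \<psi> +
  fixes h
  assumes h_closed: "m \<in> carrier M \<Longrightarrow> h m \<in> carrier E"
    and h_one: "h \<one>\<^bsub>M\<^esub> = \<one>\<^bsub>E\<^esub>"
    and h_mult: "m \<in> carrier M \<Longrightarrow> k \<in> carrier M \<Longrightarrow> h (m \<otimes>\<^bsub>M\<^esub> k) = h m \<otimes>\<^bsub>E\<^esub> h k"
    and h_comm: "m \<in> carrier M \<Longrightarrow> c \<in> carrier B \<Longrightarrow> h m \<otimes>\<^bsub>E\<^esub> \<psi> c = \<psi> c \<otimes>\<^bsub>E\<^esub> h m"
begin

abbreviation L where "L \<equiv> alg_lift B E \<psi> h"

lemma lift_eq:
  assumes f: "f \<in> carrier P" and U: "finite U" "supp f \<subseteq> U" "U \<subseteq> carrier M"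
  shows "L f = (\<Oplus>\<^bsub>E\<^esub>w \<in> U. \<psi> (f w) \<otimes>\<^bsub>E\<^esub> h w)"
  unfolding alg_lift_def
  by (rule E.add.finprod_mono_neutral_cong_left) (use assms in \<open>auto simp: P_closed h_closed subset_iff\<close>)

lemma lift_closed: "f \<in> carrier P \<Longrightarrow> L f \<in> carrier E"
  unfolding alg_lift_def by (auto intro!: E.finsum_closed simp: carrier_P h_closed subset_iff)

lemma lift_add:
  assumes f: "f \<in> carrier P" and g: "g \<in> carrier P"
  shows "L (f \<oplus>\<^bsub>P\<^esub> g) = L f \<oplus>\<^bsub>E\<^esub> L g"
proof -
  let ?U = "supp f \<union> supp g"
  have U: "finite ?U" "supp f \<subseteq> ?U" "supp g \<subseteq> ?U" "supp (f \<oplus>\<^bsub>P\<^esub> g) \<subseteq> ?U" "?U \<subseteq> carrier M"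
    using f g by (auto simp: carrier_P add_P)
  have c: "(\<lambda>w. \<psi> (f w) \<otimes>\<^bsub>E\<^esub> h w) \<in> ?U \<rightarrow> carrier E" "(\<lambda>w. \<psi> (g w) \<otimes>\<^bsub>E\<^esub> h w) \<in> ?U \<rightarrow> carrier E"
    using U(5) P_closed[OF f] P_closed[OF g] h_closed by (auto simp: subset_iff)
  have "L (f \<oplus>\<^bsub>P\<^esub> g) = (\<Oplus>\<^bsub>E\<^esub>w \<in> ?U. \<psi> (f w) \<otimes>\<^bsub>E\<^esub> h w \<oplus>\<^bsub>E\<^esub> \<psi> (g w) \<otimes>\<^bsub>E\<^esub> h w)"
    unfolding lift_eq[OF P.M.a_closed[OF f g] U(1,4,5)]
    using U(5) P_closed[OF f] P_closed[OF g] h_closed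
    by (intro E.finsum_cong') (auto simp: add_P E.l_distr subset_iff)
  then show ?thesis
    unfolding lift_eq[OF f U(1,2,5)] lift_eq[OF g U(1,3,5)] using E.finsum_addf[OF c] by simp
qed

lemma lift_single: "c \<in> carrier B \<Longrightarrow> m \<in> carrier M \<Longrightarrow> L (single B c m) = \<psi> c \<otimes>\<^bsub>E\<^esub> h m"
  by (subst lift_eq[OF _ _ single_supp]) (auto simp: single_closed, auto simp: single_def h_closed)

lemma lift_zero: "L (\<lambda>w. \<zero>) = \<zero>\<^bsub>E\<^esub>"
  by (simp add: alg_lift_def)

lemma lift_mult:
  assumes f: "f \<in> carrier P" and g: "g \<in> carrier P"
  shows "L (f \<otimes>\<^bsub>P\<^esub> g) = L f \<otimes>\<^bsub>E\<^esub> L g"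
proof -
  have 1: "L (single B c u \<otimes>\<^bsub>P\<^esub> g) = L (single B c u) \<otimes>\<^bsub>E\<^esub> L g"
    if "g \<in> carrier P" "c \<in> carrier B" "u \<in> carrier M" for c u g
    using that
  proof (induction g rule: P_induct)
    case zero then show ?case by (simp add: mult_zero single_closed lift_zero lift_closed)
  next
    case (add d v g)
    have "\<psi> c \<otimes>\<^bsub>E\<^esub> \<psi> d \<otimes>\<^bsub>E\<^esub> (h u \<otimes>\<^bsub>E\<^esub> h v) = \<psi> c \<otimes>\<^bsub>E\<^esub> (\<psi> d \<otimes>\<^bsub>E\<^esub> h u) \<otimes>\<^bsub>E\<^esub> h v"
      using add by (simp add: E.m_assoc h_closed)
    also have "\<dots> = \<psi> c \<otimes>\<^bsub>E\<^esub> (h u \<otimes>\<^bsub>E\<^esub> \<psi> d) \<otimes>\<^bsub>E\<^esub> h v" using add h_comm by simp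
    also have "\<dots> = \<psi> c \<otimes>\<^bsub>E\<^esub> h u \<otimes>\<^bsub>E\<^esub> (\<psi> d \<otimes>\<^bsub>E\<^esub> h v)"
      using add by (simp add: E.m_assoc h_closed)
    finally show ?case using add
      by (simp add: mult_add single_closed mult_closed lift_add single_mult lift_single lift_closed h_closed h_mult E.r_distr)
  qed
  show ?thesis using f g
  proof (induction f rule: P_induct)
    case zero then show ?case by (simp add: mult_zero single_closed lift_zero lift_closed)
  next
    case (add d v f)
    then show ?case by (simp add: add_mult 1 single_closed mult_closed lift_add lift_closed E.l_distr)
  qed
qed

lemma lift_ring_hom: "L \<in> ring_hom P E"
  by (rule ring_hom_memI) (auto simp: lift_closed lift_mult lift_add one_P lift_single h_one)

end

section \<open>Quotients and endomorphisms\<close>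

text \<open>\<open>quotient_algebra\<close> and \<open>scalar_extension\<close> add a scalar
  multiplication to a quotient ring. The ring axioms only involve the fields common to both records,
  so they carry over.\<close>

lemma ring_cong:
  fixes R :: "('a, 'x) ring_scheme" and S :: "('a, 'y) ring_scheme"
  assumes "ring R" and e: "carrier S = carrier R" "monoid.mult S = monoid.mult R" "one S = one R" "ring.zero S = ring.zero R" "add S = add R"
  shows "ring S"
proof -
  interpret R: ring R by fact
  show ?thesis
  proof (rule ringI)
    show "abelian_group S"
    proof (rule abelian_groupI)
      fix x assume "x \<in> carrier S"
      then show "\<exists>y\<in>carrier S. y \<oplus>\<^bsub>S\<^esub> x = \<zero>\<^bsub>S\<^esub>" unfolding e using R.l_neg by auto
    qed (auto simp: e R.a_ac)
    show "monoid S" by (rule monoidI) (auto simp: e R.m_assoc)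
  qed (auto simp: e R.l_distr R.r_distr)
qed

lemma ring_hom_cong_left:
  assumes "carrier S = carrier R" "monoid.mult S = monoid.mult R" "one S = one R" "add S = add R"
  shows "ring_hom S E = ring_hom R E"
  using assms by (simp add: ring_hom_def)

lemma ring_hom_cong_right:
  assumes "carrier S = carrier R" "monoid.mult S = monoid.mult R" "one S = one R" "add S = add R"
  shows "ring_hom E S = ring_hom E R"
  using assms by (simp add: ring_hom_def)

text \<open>The map induced on a quotient; on a coset the choice of the representative is irrelevant
  when the ideal is contained in the kernel.\<close>

definition quot_lift :: "('a \<Rightarrow> 'e) \<Rightarrow> 'a set \<Rightarrow> 'e" where
  "quot_lift h C = h (SOME x. x \<in> C)"

lemma FactRing_sel:
  "carrier (A Quot I) = a_rcosets\<^bsub>A\<^esub> I" "monoid.mult (A Quot I) = rcoset_mult A I"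
  "one (A Quot I) = I +>\<^bsub>A\<^esub> \<one>\<^bsub>A\<^esub>" "ring.zero (A Quot I) = I" "add (A Quot I) = set_add A"
  by (simp_all add: FactRing_def)

lemma carrier_Quot: "carrier (A Quot I) = (\<lambda>x. I +>\<^bsub>A\<^esub> x) ` carrier A"
  unfolding FactRing_sel by (auto simp: A_RCOSETS_defs a_r_coset_def r_coset_def)

lemma quot_lift_coset:
  assumes "ideal I A" "ring_hom_ring A E h" "\<And>x. x \<in> I \<Longrightarrow> h x = \<zero>\<^bsub>E\<^esub>" "x \<in> carrier A"
  shows "quot_lift h (I +>\<^bsub>A\<^esub> x) = h x"
proof -
  interpret ideal I A by fact
  interpret h: ring_hom_ring A E h by fact
  let ?y = "SOME y. y \<in> I +>\<^bsub>A\<^esub> x"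
  have "?y \<in> I +>\<^bsub>A\<^esub> x" by (rule someI[of _ x]) (rule a_rcos_self[OF assms(4)])
  then obtain i where i: "i \<in> I" "?y = i \<oplus>\<^bsub>A\<^esub> x" by (auto simp: a_r_coset_def r_coset_def)
  have "h ?y = h x" unfolding i(2) using i(1) assms(3)[OF i(1)] assms(4) a_Hcarr by simp
  then show ?thesis by (simp add: quot_lift_def)
qed

lemma quot_lift_ring_hom:
  assumes "ideal I A" "ring_hom_ring A E h" "\<And>x. x \<in> I \<Longrightarrow> h x = \<zero>\<^bsub>E\<^esub>"
  shows "quot_lift h \<in> ring_hom (A Quot I) E"
proof -
  interpret ideal I A by fact
  interpret h: ring_hom_ring A E h by fact
  note [simp] = quot_lift_coset[OF assms]
  show ?thesis
    by (rule ring_hom_memI) (auto simp: carrier_Quot FactRing_sel rcoset_mult_add a_rcos_sum)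
qed

section \<open>Quotients of noncommutative algebras by two-sided ideals\<close>

locale quot_alg = A: nc_algebra B A + ideal I A for B :: "('b, 'x) ring_scheme" and A :: "('b, 'a) module" and I
begin

abbreviation Q where "Q \<equiv> quotient_algebra A I"
abbreviation cls where "cls x \<equiv> I +>\<^bsub>A\<^esub> x"

lemma Q_sel: "carrier Q = carrier (A Quot I)" "monoid.mult Q = monoid.mult (A Quot I)" "one Q = one (A Quot I)"
  "ring.zero Q = ring.zero (A Quot I)" "add Q = add (A Quot I)"
  by (simp_all add: quotient_algebra_def ring.defs)

lemma cls_hom: "cls \<in> ring_hom A Q"
  unfolding ring_hom_cong_right[OF Q_sel(1-3,5)] by (rule rcos_ring_hom)

lemma ring_Q: "ring Q"
  by (rule ring_cong[OF quotient_is_ring Q_sel])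

lemma carrier_Q: "carrier Q = cls ` carrier A"
  by (simp only: Q_sel carrier_Quot)

text \<open>A scalar acts as left multiplication by a multiple of the unit, so every two-sided ideal
  is a submodule.\<close>

lemma smult_I: "c \<in> carrier B \<Longrightarrow> x \<in> I \<Longrightarrow> c \<odot>\<^bsub>A\<^esub> x \<in> I"
proof -
  assume c: "c \<in> carrier B" and x: "x \<in> I"
  have "c \<odot>\<^bsub>A\<^esub> x = (c \<odot>\<^bsub>A\<^esub> \<one>\<^bsub>A\<^esub>) \<otimes>\<^bsub>A\<^esub> x"
    using c x a_Hcarr by (simp add: A.smult_mult_l)
  then show ?thesis using c x I_l_closed by simp
qed

text \<open>The scalar multiple of a coset is defined as a union over all of its representatives. By
  \<open>smult_I\<close> each representative contributes the same coset.\<close>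

lemma smult_cls:
  assumes c: "c \<in> carrier B" and x: "x \<in> carrier A"
  shows "c \<odot>\<^bsub>Q\<^esub> cls x = cls (c \<odot>\<^bsub>A\<^esub> x)"
proof -
  have "cls (c \<odot>\<^bsub>A\<^esub> y) = cls (c \<odot>\<^bsub>A\<^esub> x)" if y: "y \<in> cls x" for y
  proof -
    obtain i where i: "i \<in> I" "y = i \<oplus>\<^bsub>A\<^esub> x" using y by (auto simp: a_r_coset_def r_coset_def)
    have "c \<odot>\<^bsub>A\<^esub> y = c \<odot>\<^bsub>A\<^esub> i \<oplus>\<^bsub>A\<^esub> c \<odot>\<^bsub>A\<^esub> x"
      using i c x a_Hcarr by (simp add: A.smult_r_distr)
    then have "c \<odot>\<^bsub>A\<^esub> y \<in> cls (c \<odot>\<^bsub>A\<^esub> x)"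
      using smult_I[OF c i(1)] by (auto simp: a_r_coset_def r_coset_def)
    then show ?thesis by (rule A.M.a_repr_independence[OF _ A.smult_closed[OF c x] a_subgroup, symmetric])
  qed
  moreover have "x \<in> cls x" using x by (rule a_rcos_self)
  ultimately have "(\<Union>y\<in>cls x. cls (c \<odot>\<^bsub>A\<^esub> y)) = cls (c \<odot>\<^bsub>A\<^esub> x)" by blast
  then show ?thesis by (simp only: quotient_algebra_def ring.defs module.simps)
qed

lemma Q_cases:
  assumes "u \<in> carrier Q" obtains x where "x \<in> carrier A" "u = cls x"
  using assms unfolding carrier_Q by auto

lemma nc_algebra_Q: "nc_algebra B Q"
proof -
  note m = ring_hom_mult[OF cls_hom] and a = ring_hom_add[OF cls_hom]
  have "module B Q"
  proof (rule moduleI)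
    show "cring B" by (rule A.R.is_cring)
    show "abelian_group Q" by (rule ring.is_abelian_group[OF ring_Q])
  next
    fix c u assume c: "c \<in> carrier B" and "u \<in> carrier Q"
    then obtain x where x: "x \<in> carrier A" "u = cls x" by (elim Q_cases)
    show "c \<odot>\<^bsub>Q\<^esub> u \<in> carrier Q" unfolding x(2) smult_cls[OF c x(1)] carrier_Q using c x by blast
  next
    fix c d u assume c: "c \<in> carrier B" and d: "d \<in> carrier B" and "u \<in> carrier Q"
    then obtain x where x: "x \<in> carrier A" "u = cls x" by (elim Q_cases)
    show "(c \<oplus>\<^bsub>B\<^esub> d) \<odot>\<^bsub>Q\<^esub> u = c \<odot>\<^bsub>Q\<^esub> u \<oplus>\<^bsub>Q\<^esub> d \<odot>\<^bsub>Q\<^esub> u"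
      unfolding x(2) smult_cls[OF A.R.a_closed[OF c d] x(1)] smult_cls[OF c x(1)] smult_cls[OF d x(1)]
        A.smult_l_distr[OF c d x(1)] by (rule a[OF A.smult_closed[OF c x(1)] A.smult_closed[OF d x(1)]])
    show "(c \<otimes>\<^bsub>B\<^esub> d) \<odot>\<^bsub>Q\<^esub> u = c \<odot>\<^bsub>Q\<^esub> (d \<odot>\<^bsub>Q\<^esub> u)"
      unfolding x(2) smult_cls[OF A.R.m_closed[OF c d] x(1)] smult_cls[OF d x(1)]
        smult_cls[OF c A.smult_closed[OF d x(1)]] A.smult_assoc1[OF c d x(1)] by (rule refl)
  next
    fix c u v assume c: "c \<in> carrier B" and "u \<in> carrier Q" "v \<in> carrier Q"
    then obtain x y where x: "x \<in> carrier A" "u = cls x" and y: "y \<in> carrier A" "v = cls y" by (elim Q_cases)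
    show "c \<odot>\<^bsub>Q\<^esub> (u \<oplus>\<^bsub>Q\<^esub> v) = c \<odot>\<^bsub>Q\<^esub> u \<oplus>\<^bsub>Q\<^esub> c \<odot>\<^bsub>Q\<^esub> v"
      unfolding x(2) y(2) a[OF x(1) y(1), symmetric] smult_cls[OF c A.M.a_closed[OF x(1) y(1)]] 
        smult_cls[OF c x(1)] smult_cls[OF c y(1)] A.smult_r_distr[OF c x(1) y(1)] by (rule a[OF A.smult_closed[OF c x(1)] A.smult_closed[OF c y(1)]])
  next
    fix u assume "u \<in> carrier Q"
    then obtain x where x: "x \<in> carrier A" "u = cls x" by (elim Q_cases)
    show "\<one>\<^bsub>B\<^esub> \<odot>\<^bsub>Q\<^esub> u = u"
      unfolding x(2) smult_cls[OF A.R.one_closed x(1)] A.smult_one[OF x(1)] by (rule refl)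
  qed
  then show ?thesis
  proof (rule nc_algebraI[OF _ ring_Q])
    fix c u v assume c: "c \<in> carrier B" and "u \<in> carrier Q" "v \<in> carrier Q"
    then obtain x y where x: "x \<in> carrier A" "u = cls x" and y: "y \<in> carrier A" "v = cls y" by (elim Q_cases)
    show "c \<odot>\<^bsub>Q\<^esub> u \<otimes>\<^bsub>Q\<^esub> v = c \<odot>\<^bsub>Q\<^esub> (u \<otimes>\<^bsub>Q\<^esub> v)"
      unfolding x(2) y(2) smult_cls[OF c x(1)] m[OF A.smult_closed[OF c x(1)] y(1), symmetric] m[OF x(1) y(1), symmetric]
        smult_cls[OF c A.M.m_closed[OF x(1) y(1)]] A.smult_mult_l[OF c x(1) y(1)] by (rule refl)
    show "u \<otimes>\<^bsub>Q\<^esub> (c \<odot>\<^bsub>Q\<^esub> v) = c \<odot>\<^bsub>Q\<^esub> (u \<otimes>\<^bsub>Q\<^esub> v)"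
      unfolding x(2) y(2) smult_cls[OF c y(1)] m[OF x(1) A.smult_closed[OF c y(1)], symmetric] m[OF x(1) y(1), symmetric]
        smult_cls[OF c A.M.m_closed[OF x(1) y(1)]] A.smult_mult_r[OF c x(1) y(1)] by (rule refl)
  qed
qed

end

section \<open>Endomorphism algebras with the product of right operators\<close>

lemma End_sel: "\<one>\<^bsub>End_algebra B M\<^esub> = (\<lambda>x\<in>carrier M. x)" "\<zero>\<^bsub>End_algebra B M\<^esub> = (\<lambda>x\<in>carrier M. \<zero>\<^bsub>M\<^esub>)"
   "f \<otimes>\<^bsub>End_algebra B M\<^esub> g = compose (carrier M) g f" "f \<oplus>\<^bsub>End_algebra B M\<^esub> g = (\<lambda>x\<in>carrier M. f x \<oplus>\<^bsub>M\<^esub> g x)"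
   "c \<odot>\<^bsub>End_algebra B M\<^esub> f = (\<lambda>x\<in>carrier M. c \<odot>\<^bsub>M\<^esub> f x)"
  by (simp_all add: End_algebra_def)

lemma End_carrier: "f \<in> carrier (End_algebra B M) \<longleftrightarrow> f \<in> carrier M \<rightarrow>\<^sub>E carrier M \<and>
       (\<forall>x\<in>carrier M. \<forall>y\<in>carrier M. f (x \<oplus>\<^bsub>M\<^esub> y) = f x \<oplus>\<^bsub>M\<^esub> f y) \<and>
       (\<forall>c\<in>carrier B. \<forall>x\<in>carrier M. f (c \<odot>\<^bsub>M\<^esub> x) = c \<odot>\<^bsub>M\<^esub> f x)"
  by (simp add: End_algebra_def)

lemma End_eqI:
  assumes "f \<in> carrier (End_algebra B M)" "g \<in> carrier (End_algebra B M)" "\<And>x. x \<in> carrier M \<Longrightarrow> f x = g x"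
  shows "f = g"
  using assms by (intro extensionalityI[of _ "carrier M"]) (auto simp: End_carrier PiE_def)

lemma nc_algebra_End: 
  fixes R (structure) and M :: "('b, 'v) module" (structure)
  assumes "module R M"
  shows "nc_algebra R (End_algebra R M)"
proof -
  interpret module R M by fact
  let ?E = "End_algebra R M"
  have cl: "f x \<in> carrier M" if "f \<in> carrier ?E" "x \<in> carrier M" for f x
    using that unfolding End_carrier by (blast dest: PiE_mem)
  have ad: "f (x \<oplus>\<^bsub>M\<^esub> y) = f x \<oplus>\<^bsub>M\<^esub> f y" if "f \<in> carrier ?E" "x \<in> carrier M" "y \<in> carrier M" for f x y
    using that unfolding End_carrier by blast
  have sm: "f (c \<odot>\<^bsub>M\<^esub> x) = c \<odot>\<^bsub>M\<^esub> f x" if "f \<in> carrier ?E" "x \<in> carrier M" "c \<in> carrier R" for f x c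
    using that unfolding End_carrier by blast
  \<comment> \<open>A scalar multiple of an endomorphism is again linear only because scalars
    commute with one another.\<close>
  have swap: "c \<odot>\<^bsub>M\<^esub> (d \<odot>\<^bsub>M\<^esub> x) = d \<odot>\<^bsub>M\<^esub> (c \<odot>\<^bsub>M\<^esub> x)" if "c \<in> carrier R" "d \<in> carrier R" "x \<in> carrier M" for c d x
    using that smult_assoc1[of c d x] smult_assoc1[of d c x] R.m_comm[of c d] by simp
  have EI: "f \<in> carrier ?E" if "\<And>x. x \<in> carrier M \<Longrightarrow> f x \<in> carrier M" "f \<in> extensional (carrier M)"
    "\<And>x y. x \<in> carrier M \<Longrightarrow> y \<in> carrier M \<Longrightarrow> f (x \<oplus>\<^bsub>M\<^esub> y) = f x \<oplus>\<^bsub>M\<^esub> f y"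
    "\<And>c x. c \<in> carrier R \<Longrightarrow> x \<in> carrier M \<Longrightarrow> f (c \<odot>\<^bsub>M\<^esub> x) = c \<odot>\<^bsub>M\<^esub> f x" for f
    unfolding End_carrier PiE_def using that by blast
  have ap: "(f \<otimes>\<^bsub>?E\<^esub> g) x = g (f x)" "(f \<oplus>\<^bsub>?E\<^esub> g) x = f x \<oplus>\<^bsub>M\<^esub> g x" "(c \<odot>\<^bsub>?E\<^esub> f) x = c \<odot>\<^bsub>M\<^esub> f x"
     "\<one>\<^bsub>?E\<^esub> x = x" "\<zero>\<^bsub>?E\<^esub> x = \<zero>\<^bsub>M\<^esub>" if "x \<in> carrier M" for f g x c
    using that by (simp_all add: End_sel compose_def)
  have ex: "f \<otimes>\<^bsub>?E\<^esub> g \<in> extensional (carrier M)" "f \<oplus>\<^bsub>?E\<^esub> g \<in> extensional (carrier M)"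
    "c \<odot>\<^bsub>?E\<^esub> f \<in> extensional (carrier M)" "\<one>\<^bsub>?E\<^esub> \<in> extensional (carrier M)" "\<zero>\<^bsub>?E\<^esub> \<in> extensional (carrier M)" for f g c
    by (simp_all add: End_sel)
  have 1: "f \<oplus>\<^bsub>?E\<^esub> g \<in> carrier ?E" if "f \<in> carrier ?E" "g \<in> carrier ?E" for f g
    by (rule EI) (simp_all add: ap ex cl ad sm that smult_r_distr M.a_ac)
  have 2: "f \<otimes>\<^bsub>?E\<^esub> g \<in> carrier ?E" if "f \<in> carrier ?E" "g \<in> carrier ?E" for f g
    by (rule EI) (simp_all add: ap ex cl ad sm that)
  have 3: "c \<odot>\<^bsub>?E\<^esub> f \<in> carrier ?E" if "f \<in> carrier ?E" "c \<in> carrier R" for f c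
    by (rule EI) (simp_all add: ap ex cl ad sm that smult_r_distr, simp add: swap cl that)
  have 4: "\<zero>\<^bsub>?E\<^esub> \<in> carrier ?E" "\<one>\<^bsub>?E\<^esub> \<in> carrier ?E"
    by (rule EI; simp add: ap ex)+
  note eqI = End_eqI[of _ R M]
  have ab: "abelian_group ?E"
  proof (rule abelian_groupI)
    fix f assume f: "f \<in> carrier ?E"
    have "(\<ominus> \<one>) \<odot>\<^bsub>?E\<^esub> f \<oplus>\<^bsub>?E\<^esub> f = \<zero>\<^bsub>?E\<^esub>"
      by (rule eqI) (simp_all add: 1 3 4 f ap cl smult_l_minus M.l_neg)
    then show "\<exists>g\<in>carrier ?E. g \<oplus>\<^bsub>?E\<^esub> f = \<zero>\<^bsub>?E\<^esub>" using 3 f by blast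
  next
    fix f g k assume fgk: "f \<in> carrier ?E" "g \<in> carrier ?E" "k \<in> carrier ?E"
    show "f \<oplus>\<^bsub>?E\<^esub> g \<oplus>\<^bsub>?E\<^esub> k = f \<oplus>\<^bsub>?E\<^esub> (g \<oplus>\<^bsub>?E\<^esub> k)"
      by (rule eqI) (simp_all add: 1 fgk ap cl M.a_assoc)
  next
    fix f g assume fg: "f \<in> carrier ?E" "g \<in> carrier ?E"
    show "f \<oplus>\<^bsub>?E\<^esub> g = g \<oplus>\<^bsub>?E\<^esub> f"
      by (rule eqI) (simp_all add: 1 fg ap cl M.a_comm)
  next
    fix f assume f: "f \<in> carrier ?E"
    show "\<zero>\<^bsub>?E\<^esub> \<oplus>\<^bsub>?E\<^esub> f = f"
      by (rule eqI) (simp_all add: 1 4 f ap cl)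
  qed (simp_all add: 1 4)
  have mon: "monoid ?E"
    by (rule monoidI; (simp add: 2 4; fail)?; rule eqI) (simp_all add: 2 4 ap cl)
  have rg: "ring ?E"
    by (rule ringI[OF ab mon]; rule eqI) (simp_all add: 1 2 ap cl ad)
  have md: "module R ?E"
    by (rule moduleI[OF R.is_cring ab]; (simp add: 3; fail)?; rule eqI)
       (simp_all add: 1 3 ap cl smult_l_distr smult_r_distr smult_assoc1)
  show ?thesis
    by (rule nc_algebraI[OF md rg]; rule eqI) (simp_all add: 2 3 ap cl sm)
qed

section \<open>Semilinear maps and the defining relations\<close>

text \<open>Semilinearity over \<open>\<phi>\<close> lets one notion cover homomorphisms over a
  fixed ring, where \<open>\<phi>\<close> is the identity, and maps from an \<open>R\<close>-algebra
  into a \<open>K\<close>-algebra, such as the passage to the scalar extension.\<close>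

locale alg_map = A: nc_algebra B A + E: nc_algebra K E + \<phi>: ring_hom_ring B K \<phi> + h: ring_hom_ring A E h
  for B A K E \<phi> h +
  assumes h_smult: "c \<in> carrier B \<Longrightarrow> x \<in> carrier A \<Longrightarrow> h (c \<odot>\<^bsub>A\<^esub> x) = \<phi> c \<odot>\<^bsub>E\<^esub> h x"

lemma alg_mapI:
  assumes "nc_algebra B A" "nc_algebra K E" "\<phi> \<in> ring_hom B K" "h \<in> ring_hom A E"
    "\<And>c x. c \<in> carrier B \<Longrightarrow> x \<in> carrier A \<Longrightarrow> h (c \<odot>\<^bsub>A\<^esub> x) = \<phi> c \<odot>\<^bsub>E\<^esub> h x"
  shows "alg_map B A K E \<phi> h"
proof -
  interpret A: nc_algebra B A by fact
  interpret E: nc_algebra K E by fact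
  show ?thesis by unfold_locales (use assms in auto)
qed

lemma id_ring_hom: "(\<lambda>x. x) \<in> ring_hom R R"
  by (rule ring_hom_memI) auto

lemma ring_hom_inv:
  assumes "cring B" "cring K" "\<phi> \<in> ring_hom B K" "x \<in> Units B"
  shows "\<phi> (inv\<^bsub>B\<^esub> x) = inv\<^bsub>K\<^esub> (\<phi> x)" "\<phi> x \<in> Units K"
proof -
  interpret B: cring B by fact
  interpret K: cring K by fact
  interpret \<phi>: ring_hom_cring B K \<phi> by unfold_locales fact
  have "\<phi> x \<otimes>\<^bsub>K\<^esub> \<phi> (inv\<^bsub>B\<^esub> x) = \<one>\<^bsub>K\<^esub>"
    using assms(4) by (metis B.Units_closed B.Units_inv_closed B.Units_r_inv \<phi>.hom_mult \<phi>.hom_one)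
  moreover have c: "\<phi> x \<in> carrier K" "\<phi> (inv\<^bsub>B\<^esub> x) \<in> carrier K" using assms(4) by auto
  ultimately show "\<phi> (inv\<^bsub>B\<^esub> x) = inv\<^bsub>K\<^esub> (\<phi> x)" "\<phi> x \<in> Units K"
    using K.comm_inv_char[OF c] K.m_comm[OF c] unfolding Units_def[of K] by auto
qed

lemma ring_hom_nat:
  assumes "ring B" "ring K" "\<phi> \<in> ring_hom B K"
  shows "\<phi> ([(k::nat)] \<cdot>\<^bsub>B\<^esub> \<one>\<^bsub>B\<^esub>) = [k] \<cdot>\<^bsub>K\<^esub> \<one>\<^bsub>K\<^esub>"
proof -
  interpret B: ring B by fact
  interpret K: ring K by fact
  interpret \<phi>: ring_hom_ring B K \<phi> by unfold_locales fact
  show ?thesis by (induction k) (auto simp: B.add.nat_pow_Suc)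
qed

text \<open>With \<open>x = t\<^sub>i\<close> and \<open>y = t\<^sub>i\<^sub>+\<^sub>1\<close> this is \<open>e\<^sub>i\<close>.\<close>

definition torus_e :: "('b, 'x) ring_scheme \<Rightarrow> ('b, 'a, 'y) module_scheme \<Rightarrow> nat \<Rightarrow> 'a \<Rightarrow> 'a \<Rightarrow> 'a" where
  "torus_e B A r x y = (inv\<^bsub>B\<^esub> ([r] \<cdot>\<^bsub>B\<^esub> \<one>\<^bsub>B\<^esub>)) \<odot>\<^bsub>A\<^esub>
     (\<Oplus>\<^bsub>A\<^esub>s\<in>{..<r}. (x [^]\<^bsub>A\<^esub> s) \<otimes>\<^bsub>A\<^esub> (y [^]\<^bsub>A\<^esub> (r - s)))"

text \<open>Stated for arbitrary elements of an arbitrary algebra, the relations can be asserted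
  alike of the presented algebra, of its scalar extension and of the operators on tensor
  space.\<close>

definition yh_rel :: "('b, 'x) ring_scheme \<Rightarrow> ('b, 'a, 'y) module_scheme \<Rightarrow> 'b \<Rightarrow> nat \<Rightarrow> nat \<Rightarrow> (nat \<Rightarrow> 'a) \<Rightarrow> (nat \<Rightarrow> 'a) \<Rightarrow> bool" where
  "yh_rel B A q r n t g \<longleftrightarrow>
    (\<forall>i\<in>{1..n}. t i [^]\<^bsub>A\<^esub> r = \<one>\<^bsub>A\<^esub>) \<and>
    (\<forall>i\<in>{1..n}. \<forall>j\<in>{1..n}. t i \<otimes>\<^bsub>A\<^esub> t j = t j \<otimes>\<^bsub>A\<^esub> t i) \<and>
    (\<forall>i\<in>{1..<n}. \<forall>j\<in>{1..n}. t j \<otimes>\<^bsub>A\<^esub> g i = g i \<otimes>\<^bsub>A\<^esub> t (transpose i (Suc i) j)) \<and>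
    (\<forall>i\<in>{1..<n}. \<forall>j\<in>{1..<n}. \<bar>int i - int j\<bar> > 1 \<longrightarrow> g i \<otimes>\<^bsub>A\<^esub> g j = g j \<otimes>\<^bsub>A\<^esub> g i) \<and>
    (\<forall>i\<in>{1..<n}. Suc i \<in> {1..<n} \<longrightarrow>
       g i \<otimes>\<^bsub>A\<^esub> g (Suc i) \<otimes>\<^bsub>A\<^esub> g i = g (Suc i) \<otimes>\<^bsub>A\<^esub> g i \<otimes>\<^bsub>A\<^esub> g (Suc i)) \<and>
    (\<forall>i\<in>{1..<n}. g i \<otimes>\<^bsub>A\<^esub> g i =
       \<one>\<^bsub>A\<^esub> \<oplus>\<^bsub>A\<^esub> (q \<ominus>\<^bsub>B\<^esub> inv\<^bsub>B\<^esub> q) \<odot>\<^bsub>A\<^esub> (torus_e B A r (t i) (t (Suc i)) \<otimes>\<^bsub>A\<^esub> g i))"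

context nc_algebra begin

lemma torus_e_closed: 
  assumes "[r] \<cdot>\<^bsub>R\<^esub> \<one>\<^bsub>R\<^esub> \<in> Units R" "x \<in> carrier M" "y \<in> carrier M"
  shows "torus_e R M r x y \<in> carrier M"
  unfolding torus_e_def using assms by (intro smult_closed M.finsum_closed) auto

end

context alg_map begin

lemma hom_torus_e:
  assumes r: "[r] \<cdot>\<^bsub>B\<^esub> \<one>\<^bsub>B\<^esub> \<in> Units B" and x: "x \<in> carrier A" "y \<in> carrier A"
  shows "h (torus_e B A r x y) = torus_e K E r (h x) (h y)"
proof -
  have 1: "(\<lambda>s. (x [^]\<^bsub>A\<^esub> s) \<otimes>\<^bsub>A\<^esub> (y [^]\<^bsub>A\<^esub> (r - s))) \<in> {..<r} \<rightarrow> carrier A" using x by auto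
  have inv: "\<phi> (inv\<^bsub>B\<^esub> ([r] \<cdot>\<^bsub>B\<^esub> \<one>\<^bsub>B\<^esub>)) = inv\<^bsub>K\<^esub> ([r] \<cdot>\<^bsub>K\<^esub> \<one>\<^bsub>K\<^esub>)"
    using ring_hom_inv(1)[OF A.R.is_cring E.R.is_cring \<phi>.homh r] ring_hom_nat[OF A.R.ring_axioms E.R.ring_axioms \<phi>.homh] by simp
  have "h (\<Oplus>\<^bsub>A\<^esub>s\<in>{..<r}. (x [^]\<^bsub>A\<^esub> s) \<otimes>\<^bsub>A\<^esub> (y [^]\<^bsub>A\<^esub> (r - s))) =
      (\<Oplus>\<^bsub>E\<^esub>s\<in>{..<r}. (h x [^]\<^bsub>E\<^esub> s) \<otimes>\<^bsub>E\<^esub> (h y [^]\<^bsub>E\<^esub> (r - s)))"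
    unfolding h.hom_finsum[OF 1] o_def using x by (intro E.M.finsum_cong') (auto simp: h.hom_nat_pow)
  with h_smult[OF A.R.Units_inv_closed[OF r] A.M.finsum_closed[OF 1]] show ?thesis
    by (simp only: torus_e_def inv)
qed

lemma hom_rel_iff:
  assumes x: "x \<in> carrier A" "y \<in> carrier A"
  shows "h (x \<ominus>\<^bsub>A\<^esub> y) = \<zero>\<^bsub>E\<^esub> \<longleftrightarrow> h x = h y"
proof -
  have "h (x \<ominus>\<^bsub>A\<^esub> y) = h x \<ominus>\<^bsub>E\<^esub> h y" using x by (simp add: A.M.minus_eq E.M.minus_eq)
  then show ?thesis using E.M.r_right_minus_eq[of "h x" "h y"] x by simp
qed

end

lemma yh_e_torus_e: "yh_e B r n i = torus_e B (yh_free B n) r (monomial B [Gen_t i]) (monomial B [Gen_t (Suc i)])"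
  by (simp add: yh_e_def torus_e_def Let_def)

lemma word_monoid_monoid: "monoid (word_monoid S)"
  by (rule monoidI) (auto simp: word_monoid_def)

locale yh_free_map = alg_map B "yh_free B n" K E \<phi> h for B n K E \<phi> h +
  fixes r :: nat and q
  assumes r_unit: "[r] \<cdot>\<^bsub>B\<^esub> \<one>\<^bsub>B\<^esub> \<in> Units B" and q_unit: "q \<in> Units B"
begin

abbreviation F where "F \<equiv> yh_free B n"
abbreviation t where "t i \<equiv> monomial B [Gen_t i]"
abbreviation g where "g i \<equiv> monomial B [Gen_g i]"

lemma gens_closed: "i \<in> {1..n} \<Longrightarrow> t i \<in> carrier F" "i \<in> {1..<n} \<Longrightarrow> g i \<in> carrier F"
proof -
  interpret W: monoid_alg B "word_monoid (yh_gens n)"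
    by (intro monoid_alg.intro A.R.is_cring word_monoid_monoid)
  show "i \<in> {1..n} \<Longrightarrow> t i \<in> carrier F" "i \<in> {1..<n} \<Longrightarrow> g i \<in> carrier F"
    unfolding yh_free_def monomial_single by (rule W.single_closed; simp add: word_monoid_def yh_gens_def image_iff)+
qed

lemma hom_z: "\<phi> (q \<ominus>\<^bsub>B\<^esub> inv\<^bsub>B\<^esub> q) = \<phi> q \<ominus>\<^bsub>K\<^esub> inv\<^bsub>K\<^esub> (\<phi> q)"
  using A.R.Units_closed[OF q_unit] q_unit ring_hom_inv(1)[OF A.R.is_cring E.R.is_cring \<phi>.homh q_unit]
  by (simp add: A.R.minus_eq E.R.minus_eq)

lemma z_closed: "q \<ominus>\<^bsub>B\<^esub> inv\<^bsub>B\<^esub> q \<in> carrier B"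
  using A.R.Units_closed[OF q_unit] q_unit by simp

text \<open>The bridge between the presentation and \<open>yh_rel\<close>. From left to right it
  yields the relations in a quotient in which the relators vanish; from right to left it shows that
  a map prescribed on generators kills the relators and hence descends to the quotient.\<close>

lemma relators_iff:
  "(\<forall>x\<in>yh_relators B q r n. h x = \<zero>\<^bsub>E\<^esub>) \<longleftrightarrow> yh_rel K E (\<phi> q) r n (\<lambda>i. h (t i)) (\<lambda>i. h (g i))"
proof -
  note [simp] = gens_closed
  have tr: "transpose i (Suc i) j \<in> {1..n}" if "i \<in> {1..<n}" "j \<in> {1..n}" for i j
    using that by (auto simp: transpose_def)
  have 1: "h (t i [^]\<^bsub>F\<^esub> r \<ominus>\<^bsub>F\<^esub> \<one>\<^bsub>F\<^esub>) = \<zero>\<^bsub>E\<^esub> \<longleftrightarrow> h (t i) [^]\<^bsub>E\<^esub> r = \<one>\<^bsub>E\<^esub>" if "i \<in> {1..n}" for i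
    using that by (subst hom_rel_iff) (auto simp: h.hom_nat_pow)
  have 2: "h ((t i \<otimes>\<^bsub>F\<^esub> t j) \<ominus>\<^bsub>F\<^esub> (t j \<otimes>\<^bsub>F\<^esub> t i)) = \<zero>\<^bsub>E\<^esub> \<longleftrightarrow> h (t i) \<otimes>\<^bsub>E\<^esub> h (t j) = h (t j) \<otimes>\<^bsub>E\<^esub> h (t i)"
    if "i \<in> {1..n} \<and> j \<in> {1..n}" for i j
    using that by (subst hom_rel_iff) auto
  have 3: "h ((t j \<otimes>\<^bsub>F\<^esub> g i) \<ominus>\<^bsub>F\<^esub> (g i \<otimes>\<^bsub>F\<^esub> t (transpose i (Suc i) j))) = \<zero>\<^bsub>E\<^esub> \<longleftrightarrow>
      h (t j) \<otimes>\<^bsub>E\<^esub> h (g i) = h (g i) \<otimes>\<^bsub>E\<^esub> h (t (transpose i (Suc i) j))"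
    if "i \<in> {1..<n} \<and> j \<in> {1..n}" for i j
  proof -
    have "t j \<in> carrier F" "g i \<in> carrier F" "t (transpose i (Suc i) j) \<in> carrier F"
      using that tr[of i j] gens_closed by auto
    then show ?thesis by (subst hom_rel_iff) auto
  qed
  have 4: "h ((g i \<otimes>\<^bsub>F\<^esub> g j) \<ominus>\<^bsub>F\<^esub> (g j \<otimes>\<^bsub>F\<^esub> g i)) = \<zero>\<^bsub>E\<^esub> \<longleftrightarrow> h (g i) \<otimes>\<^bsub>E\<^esub> h (g j) = h (g j) \<otimes>\<^bsub>E\<^esub> h (g i)"
    if "i \<in> {1..<n} \<and> j \<in> {1..<n} \<and> \<bar>int i - int j\<bar> > 1" for i j
    using that by (subst hom_rel_iff) auto
  have 5: "h ((g i \<otimes>\<^bsub>F\<^esub> g (Suc i) \<otimes>\<^bsub>F\<^esub> g i) \<ominus>\<^bsub>F\<^esub> (g (Suc i) \<otimes>\<^bsub>F\<^esub> g i \<otimes>\<^bsub>F\<^esub> g (Suc i))) = \<zero>\<^bsub>E\<^esub> \<longleftrightarrow>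
      h (g i) \<otimes>\<^bsub>E\<^esub> h (g (Suc i)) \<otimes>\<^bsub>E\<^esub> h (g i) = h (g (Suc i)) \<otimes>\<^bsub>E\<^esub> h (g i) \<otimes>\<^bsub>E\<^esub> h (g (Suc i))"
    if "i \<in> {1..<n} \<and> Suc i \<in> {1..<n}" for i
    using that by (subst hom_rel_iff) auto
  have 6: "h ((g i \<otimes>\<^bsub>F\<^esub> g i) \<ominus>\<^bsub>F\<^esub> (\<one>\<^bsub>F\<^esub> \<oplus>\<^bsub>F\<^esub> (q \<ominus>\<^bsub>B\<^esub> inv\<^bsub>B\<^esub> q) \<odot>\<^bsub>F\<^esub> (yh_e B r n i \<otimes>\<^bsub>F\<^esub> g i))) = \<zero>\<^bsub>E\<^esub> \<longleftrightarrow>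
      h (g i) \<otimes>\<^bsub>E\<^esub> h (g i) = \<one>\<^bsub>E\<^esub> \<oplus>\<^bsub>E\<^esub> (\<phi> q \<ominus>\<^bsub>K\<^esub> inv\<^bsub>K\<^esub> (\<phi> q)) \<odot>\<^bsub>E\<^esub> (torus_e K E r (h (t i)) (h (t (Suc i))) \<otimes>\<^bsub>E\<^esub> h (g i))"
    if "i \<in> {1..<n}" for i
  proof -
    have c: "t i \<in> carrier F" "t (Suc i) \<in> carrier F" "g i \<in> carrier F" using that by auto
    show ?thesis
      using c z_closed A.torus_e_closed[OF r_unit c(1,2)]
      by (subst hom_rel_iff) (auto simp: yh_e_torus_e h_smult hom_z hom_torus_e[OF r_unit c(1,2)])
  qed
  show ?thesis
    unfolding yh_relators_def yh_rel_def Let_def ball_Un conj_assoc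
    apply (intro conj_cong)
    using 1 apply blast
    using 2 apply blast
    using 3 apply blast
    using 4 apply blast
    using 5 apply blast
    using 6 by blast
qed

lemma relators_closed: "yh_relators B q r n \<subseteq> carrier F"
proof -
  have "t (transpose i (Suc i) j) \<in> carrier F" if "i \<in> {1..<n}" "j \<in> {1..n}" for i j
    using that by (intro gens_closed) (auto simp: transpose_def)
  moreover have "yh_e B r n i \<in> carrier F" if "i \<in> {1..<n}" for i
    unfolding yh_e_torus_e using that by (intro A.torus_e_closed r_unit gens_closed) auto
  ultimately show ?thesis
    using gens_closed z_closed unfolding yh_relators_def Let_def
    by (intro Un_least subsetI; clarify; intro A.M.minus_closed A.M.a_closed A.smult_closed A.M.m_closed A.M.nat_pow_closed A.M.one_closed; blast)
qed

end

section \<open>A spanning set\<close>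

text \<open>Matsumoto's theorem is avoided: instead of \<open>g\<^sub>w\<close> for all \<open>w\<close> only the products of the
  descending words \<open>g\<^sub>m g\<^sub>m\<^sub>-\<^sub>1 \<cdots> g\<^sub>m\<^sub>-\<^sub>d\<^sub>+\<^sub>1\<close> for \<open>m = 1, 2, \<dots>, n - 1\<close> are used.\<close>

context nc_algebra begin

definition sub :: "'c set \<Rightarrow> bool" where
  "sub S \<longleftrightarrow> S \<subseteq> carrier M \<and> \<zero> \<in> S \<and> (\<forall>x\<in>S. \<forall>y\<in>S. x \<oplus> y \<in> S) \<and> (\<forall>c\<in>carrier R. \<forall>x\<in>S. c \<odot> x \<in> S)"

lemma subD: 
  assumes "sub S"
  shows "x \<in> S \<Longrightarrow> x \<in> carrier M" "\<zero> \<in> S" "x \<in> S \<Longrightarrow> y \<in> S \<Longrightarrow> x \<oplus> y \<in> S"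
    "c \<in> carrier R \<Longrightarrow> x \<in> S \<Longrightarrow> c \<odot> x \<in> S"
  using assms by (auto simp: sub_def)

lemma sub_finsum:
  assumes "sub S" "\<And>i. i \<in> I \<Longrightarrow> f i \<in> S"
  shows "(\<Oplus>i\<in>I. f i) \<in> S"
  using assms(2)
proof (induction I rule: infinite_finite_induct)
  case (insert i I)
  moreover have "f \<in> I \<rightarrow> carrier M" "f i \<in> carrier M" using insert subD(1)[OF assms(1)] by auto
  ultimately show ?case using subD(3)[OF assms(1)] by simp
qed (simp_all add: subD(2)[OF assms(1)])

text \<open>Coefficients stand on the left because elements will be extended by generators on the
  right. Taking them from a submodule \<open>S\<close> instead of the ground ring permits iteration;
  the sum is not claimed to be direct.\<close>

definition comb :: "'c set \<Rightarrow> (nat \<Rightarrow> 'c) \<Rightarrow> nat set \<Rightarrow> 'c set" where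
  "comb S N I = {\<Oplus>i\<in>I. h i \<otimes> N i | h. h \<in> I \<rightarrow> S}"

lemma comb_incl:
  assumes S: "sub S" and I: "finite I" and N: "N \<in> I \<rightarrow> carrier M" and i: "i \<in> I" and x: "x \<in> S"
  shows "x \<otimes> N i \<in> comb S N I"
proof -
  let ?h = "\<lambda>j. if i = j then x else \<zero>"
  have Ni: "N j \<in> carrier M" if "j \<in> I" for j using N that by auto
  have "(\<Oplus>j\<in>I. ?h j \<otimes> N j) = (\<Oplus>j\<in>I. if i = j then x \<otimes> N j else \<zero>)"
    using Ni subD(1)[OF S x] by (intro M.finsum_cong') auto
  also have "\<dots> = x \<otimes> N i"
    using i I Ni subD(1)[OF S x] by (intro M.finsum_singleton) auto
  finally show ?thesis
    unfolding comb_def using x subD(2)[OF S] by (intro CollectI exI[of _ ?h]) auto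
qed

lemma sub_comb:
  assumes S: "sub S" and I: "finite I" and N: "N \<in> I \<rightarrow> carrier M"
  shows "sub (comb S N I)"
  unfolding sub_def
proof (intro conjI ballI)
  have Ni: "N j \<in> carrier M" if "j \<in> I" for j using N that by auto
  have cl: "(\<lambda>i. h i \<otimes> N i) \<in> I \<rightarrow> carrier M" if "h \<in> I \<rightarrow> S" for h
    using that N subD(1)[OF S] by auto
  show "comb S N I \<subseteq> carrier M" unfolding comb_def using cl by auto
  have "(\<Oplus>i\<in>I. \<zero> \<otimes> N i) = (\<Oplus>i\<in>I. \<zero>)"
    using Ni by (intro M.finsum_cong') auto
  then show "\<zero> \<in> comb S N I"
    unfolding comb_def using subD(2)[OF S] by (intro CollectI exI[of _ "\<lambda>_. \<zero>"]) auto
  fix x assume "x \<in> comb S N I"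
  then obtain h where h: "h \<in> I \<rightarrow> S" "x = (\<Oplus>i\<in>I. h i \<otimes> N i)" by (auto simp: comb_def)
  {
    fix y assume "y \<in> comb S N I"
    then obtain k where k: "k \<in> I \<rightarrow> S" "y = (\<Oplus>i\<in>I. k i \<otimes> N i)" by (auto simp: comb_def)
    have "x \<oplus> y = (\<Oplus>i\<in>I. h i \<otimes> N i \<oplus> k i \<otimes> N i)"
      unfolding h k by (rule M.finsum_addf[OF cl[OF h(1)] cl[OF k(1)], symmetric])
    also have "\<dots> = (\<Oplus>i\<in>I. (h i \<oplus> k i) \<otimes> N i)"
      using h(1) k(1) N subD(1)[OF S] by (intro M.finsum_cong') (auto simp: M.l_distr Pi_iff)
    finally show "x \<oplus> y \<in> comb S N I"
      unfolding comb_def using h(1) k(1) subD(3)[OF S] by (intro CollectI exI[of _ "\<lambda>i. h i \<oplus> k i"]) auto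
  }
  fix c assume c: "c \<in> carrier R"
  have "c \<odot> x = (\<Oplus>i\<in>I. c \<odot> (h i \<otimes> N i))"
    unfolding h by (rule finsum_smult_ldistr[OF I c cl[OF h(1)]])
  also have "\<dots> = (\<Oplus>i\<in>I. (c \<odot> h i) \<otimes> N i)"
    using h(1) N c subD(1)[OF S] by (intro M.finsum_cong') (auto simp: smult_mult_l Pi_iff)
  finally show "c \<odot> x \<in> comb S N I"
    unfolding comb_def using h(1) c subD(4)[OF S] by (intro CollectI exI[of _ "\<lambda>i. c \<odot> h i"]) auto
qed

lemma comb_mult:
  assumes S: "sub S" and I: "finite I" and N: "N \<in> I \<rightarrow> carrier M" and T: "sub T" and x: "x \<in> carrier M"
    and *: "\<And>i h. i \<in> I \<Longrightarrow> h \<in> S \<Longrightarrow> (h \<otimes> N i) \<otimes> x \<in> T" and y: "y \<in> comb S N I"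
  shows "y \<otimes> x \<in> T"
proof -
  obtain h where h: "h \<in> I \<rightarrow> S" "y = (\<Oplus>i\<in>I. h i \<otimes> N i)" using y by (auto simp: comb_def)
  have "(\<lambda>i. h i \<otimes> N i) \<in> I \<rightarrow> carrier M" using h N subD(1)[OF S] by auto
  then have "y \<otimes> x = (\<Oplus>i\<in>I. (h i \<otimes> N i) \<otimes> x)"
    unfolding h by (rule M.finsum_ldistr[OF I x])
  also have "\<dots> \<in> T" using h * by (intro sub_finsum[OF T]) auto
  finally show ?thesis .
qed

lemma sub_scalars: "sub {c \<odot> \<one> | c. c \<in> carrier R}" (is "sub ?S")
  unfolding sub_def
proof (intro conjI ballI)
  show "?S \<subseteq> carrier M" by auto
  have "\<zero> = \<zero>\<^bsub>R\<^esub> \<odot> \<one>" by simp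
  then show "\<zero> \<in> ?S" using R.zero_closed by blast
  fix x assume "x \<in> ?S"
  then obtain c where c: "c \<in> carrier R" "x = c \<odot> \<one>" by blast
  {
    fix y assume "y \<in> ?S"
    then obtain d where d: "d \<in> carrier R" "y = d \<odot> \<one>" by blast
    have "x \<oplus> y = (c \<oplus>\<^bsub>R\<^esub> d) \<odot> \<one>" unfolding c(2) d(2) using c(1) d(1) by (simp add: smult_l_distr)
    then show "x \<oplus> y \<in> ?S" using R.a_closed[OF c(1) d(1)] by blast
  }
  fix d assume d: "d \<in> carrier R"
  have "d \<odot> x = (d \<otimes>\<^bsub>R\<^esub> c) \<odot> \<one>" unfolding c(2) using c(1) d by (simp add: smult_assoc1)
  then show "d \<odot> x \<in> ?S" using R.m_closed[OF d c(1)] by blast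
qed

text \<open>Generation as an algebra, in the form of an induction principle over words read from
  left to right: \<open>S\<close> only has to be a submodule stable under right multiplication by
  generators, not a subalgebra.\<close>

definition generates :: "'c set \<Rightarrow> bool" where
  "generates T \<longleftrightarrow> (\<forall>S. sub S \<longrightarrow> \<one> \<in> S \<longrightarrow> (\<forall>x\<in>S. \<forall>a\<in>T. x \<otimes> a \<in> S) \<longrightarrow> carrier M \<subseteq> S)"

lemma generatesD:
  assumes "generates T" "sub S" "\<one> \<in> S" "\<And>x a. x \<in> S \<Longrightarrow> a \<in> T \<Longrightarrow> x \<otimes> a \<in> S"
  shows "carrier M \<subseteq> S"
  using assms unfolding generates_def by blast

end

text \<open>The elements whose image lies in \<open>S\<close> form a submodule to which
  \<open>generates\<close> applies. In this way generation passes to the quotient algebra and to the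
  elements \<open>a \<otimes> 1\<close> of the scalar extension.\<close>

lemma (in alg_map) generates_image:
  assumes gen: "A.generates T" and T: "T \<subseteq> carrier A" and S: "E.sub S" and one: "\<one>\<^bsub>E\<^esub> \<in> S"
    and mult: "\<And>x a. x \<in> S \<Longrightarrow> a \<in> T \<Longrightarrow> x \<otimes>\<^bsub>E\<^esub> h a \<in> S" and x: "x \<in> carrier A"
  shows "h x \<in> S"
proof -
  have "carrier A \<subseteq> {x \<in> carrier A. h x \<in> S}"
  proof (rule A.generatesD[OF gen])
    show "A.sub {x \<in> carrier A. h x \<in> S}"
      unfolding A.sub_def using A.M.zero_closed E.subD[OF S] h.hom_zero by (auto simp: h_smult)
    show "\<one>\<^bsub>A\<^esub> \<in> {x \<in> carrier A. h x \<in> S}" using one by simp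
    fix x a assume "x \<in> {x \<in> carrier A. h x \<in> S}" and a: "a \<in> T"
    then have x: "x \<in> carrier A" "h x \<in> S" by auto
    have "a \<in> carrier A" using a T by blast
    then show "x \<otimes>\<^bsub>A\<^esub> a \<in> {x \<in> carrier A. h x \<in> S}" using mult[OF x(2) a] x(1) by simp
  qed
  then show ?thesis using x by blast
qed

section \<open>Normal forms in an algebra satisfying the Yokonuma-Hecke relations\<close>

locale yh_alg = nc_algebra K A for K :: "'b ring" and A :: "('b, 'a) module" (structure) +
  fixes q and r n :: nat and t g :: "nat \<Rightarrow> 'a"
  assumes n_pos: "n \<ge> 1" and r_pos: "r \<ge> 1"
    and t_closed: "i \<in> {1..n} \<Longrightarrow> t i \<in> carrier A" and g_closed: "i \<in> {1..<n} \<Longrightarrow> g i \<in> carrier A"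
    and rel: "yh_rel K A q r n t g"
    and r_unit: "[r] \<cdot>\<^bsub>K\<^esub> \<one>\<^bsub>K\<^esub> \<in> Units K" and q_unit: "q \<in> Units K"
begin

abbreviation z where "z \<equiv> q \<ominus>\<^bsub>K\<^esub> inv\<^bsub>K\<^esub> q"

lemma t_pow: "i \<in> {1..n} \<Longrightarrow> t i [^] r = \<one>"
  and t_comm: "i \<in> {1..n} \<Longrightarrow> j \<in> {1..n} \<Longrightarrow> t i \<otimes> t j = t j \<otimes> t i"
  and t_g: "i \<in> {1..<n} \<Longrightarrow> j \<in> {1..n} \<Longrightarrow> t j \<otimes> g i = g i \<otimes> t (transpose i (Suc i) j)"
  and g_comm: "i \<in> {1..<n} \<Longrightarrow> j \<in> {1..<n} \<Longrightarrow> Suc i < j \<or> Suc j < i \<Longrightarrow> g i \<otimes> g j = g j \<otimes> g i"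
  and braid: "i \<in> {1..<n} \<Longrightarrow> Suc i \<in> {1..<n} \<Longrightarrow>
      g i \<otimes> g (Suc i) \<otimes> g i = g (Suc i) \<otimes> g i \<otimes> g (Suc i)"
  and quad: "i \<in> {1..<n} \<Longrightarrow> g i \<otimes> g i =
       \<one> \<oplus> z \<odot> (torus_e K A r (t i) (t (Suc i)) \<otimes> g i)"
  using rel unfolding yh_rel_def by (blast, blast, blast, force, blast, blast)

lemma z_closed: "z \<in> carrier K"
  using R.Units_closed[OF q_unit] q_unit by simp

lemma transpose_range: "i \<in> {1..<n} \<Longrightarrow> j \<in> {1..n} \<Longrightarrow> transpose i (Suc i) j \<in> {1..n}"
  by (auto simp: transpose_def)

lemma g_t:
  assumes "i \<in> {1..<n}" "j \<in> {1..n}"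
  shows "g i \<otimes> t j = t (transpose i (Suc i) j) \<otimes> g i"
  using t_g[OF assms(1) transpose_range[OF assms]] by simp

text \<open>The torus part: the span of the monomials in the first \<open>k\<close> generators
  \<open>t\<close>, with exponents below \<open>r\<close>. Adjoining one generator at a time allows
  Fourier inversion to be applied to one variable at a time.\<close>

primrec D :: "nat \<Rightarrow> 'a set" where
  "D 0 = {c \<odot> \<one> | c. c \<in> carrier K}"
| "D (Suc k) = comb (D k) (\<lambda>s. t (Suc k) [^] s) {..<r}"

lemma sub_D: "k \<le> n \<Longrightarrow> sub (D k)"
  by (induction k) (auto intro!: sub_comb simp del: D.simps(1) simp: sub_scalars[folded D.simps(1)] t_closed)

lemma one_D: "k \<le> n \<Longrightarrow> \<one> \<in> D k"
proof (induction k)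
  case 0
  then show ?case by (auto intro!: exI[of _ "\<one>\<^bsub>K\<^esub>"])
next
  case (Suc k)
  then have "\<one> \<otimes> t (Suc k) [^] (0::nat) \<in> D (Suc k)"
    unfolding D.simps(2) using r_pos by (intro comb_incl sub_D) (auto simp: t_closed)
  then show ?case by simp
qed

lemma pow_t_comm:
  assumes "i \<in> {1..n}" "j \<in> {1..n}"
  shows "t i [^] (s::nat) \<otimes> t j = t j \<otimes> t i [^] s"
  by (rule M.group_commutes_pow[OF t_comm[OF assms] t_closed[OF assms(1)] t_closed[OF assms(2)]])

lemma D_mult_t: "k \<le> n \<Longrightarrow> i \<in> {1..k} \<Longrightarrow> x \<in> D k \<Longrightarrow> x \<otimes> t i \<in> D k"
proof (induction k arbitrary: x)
  case (Suc k)
  have k: "Suc k \<in> {1..n}" and i: "i \<in> {1..n}" using Suc by auto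
  note tc = t_closed[OF k] t_closed[OF i]
  have N: "(\<lambda>s. t (Suc k) [^] s) \<in> {..<r} \<rightarrow> carrier A" using tc by auto
  have S: "sub (D k)" using Suc by (intro sub_D) simp
  show ?case
  proof (rule comb_mult[OF S _ N sub_D[OF Suc.prems(1)] tc(2) _ Suc.prems(3)[unfolded D.simps]])
    fix s h assume s: "s \<in> {..<r}" and h: "h \<in> D k"
    have hc: "h \<in> carrier A" using h S subD by blast
    show "h \<otimes> t (Suc k) [^] s \<otimes> t i \<in> D (Suc k)"
    proof (cases "i = Suc k")
      case True
      have e: "h \<otimes> t (Suc k) [^] s \<otimes> t i = h \<otimes> t (Suc k) [^] (Suc s)"
        using True tc hc by (simp add: M.m_assoc)
      show ?thesis
      proof (cases "Suc s < r")
        case True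
        then show ?thesis unfolding e D.simps by (intro comb_incl[OF S _ N _ h]) auto
      next
        case False
        \<comment> \<open>The exponent that leaves the range wraps around to 0, since the
          \<open>r\<close>-th power is the unit.\<close>
        then have "Suc s = r" using s by auto
        then have "t (Suc k) [^] (Suc s) = t (Suc k) [^] (0::nat)" using t_pow[OF k] by simp
        then show ?thesis unfolding e D.simps using comb_incl[OF S _ N _ h, of 0] r_pos by simp
      qed
    next
      case False
      have "h \<otimes> t (Suc k) [^] s \<otimes> t i = (h \<otimes> t i) \<otimes> t (Suc k) [^] s"
        using pow_t_comm[OF k i] tc hc by (simp add: M.m_assoc)
      moreover have "h \<otimes> t i \<in> D k" using False Suc h by auto
      ultimately show ?thesis unfolding D.simps using comb_incl[OF S _ N s] by simp
    qed
  qed simp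
qed auto

primrec desc :: "nat \<Rightarrow> nat \<Rightarrow> 'a" where
  "desc m 0 = \<one>"
| "desc m (Suc d) = desc m d \<otimes> g (m - d)"

lemma desc_closed: "m < n \<Longrightarrow> d \<le> m \<Longrightarrow> desc m d \<in> carrier A"
  by (induction d) (auto intro!: M.m_closed g_closed)

text \<open>The index of the torus generator that appears on the left when \<open>t i\<close> is
  moved through \<open>desc m d\<close>. The last letter of the word is passed first, so its
  transposition is the innermost one.\<close>

primrec shf :: "nat \<Rightarrow> nat \<Rightarrow> nat \<Rightarrow> nat" where
  "shf m 0 i = i"
| "shf m (Suc d) i = shf m d (transpose (m - d) (Suc (m - d)) i)"

lemma shf_range: "m < n \<Longrightarrow> d \<le> m \<Longrightarrow> i \<in> {1..n} \<Longrightarrow> shf m d i \<in> {1..n}"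
proof (induction d arbitrary: i)
  case (Suc d)
  have k: "m - d \<in> {1..<n}" "d \<le> m" using Suc.prems by auto
  show ?case unfolding shf.simps by (rule Suc.IH[OF Suc.prems(1) k(2) transpose_range[OF k(1) Suc.prems(3)]])
qed simp

lemma desc_t: "m < n \<Longrightarrow> d \<le> m \<Longrightarrow> i \<in> {1..n} \<Longrightarrow> desc m d \<otimes> t i = t (shf m d i) \<otimes> desc m d"
proof (induction d arbitrary: i)
  case 0
  then show ?case using t_closed by simp
next
  case (Suc d)
  let ?k = "m - d" and ?j = "transpose (m - d) (Suc (m - d)) i"
  have k: "?k \<in> {1..<n}" using Suc by auto
  have j: "?j \<in> {1..n}" by (rule transpose_range[OF k Suc.prems(3)])
  have d: "d \<le> m" using Suc.prems by simp
  note c = desc_closed[OF Suc.prems(1) d] g_closed[OF k] t_closed[OF Suc.prems(3)] t_closed[OF j]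
    t_closed[OF shf_range[OF Suc.prems(1) d j]]
  have "desc m (Suc d) \<otimes> t i = desc m d \<otimes> (t ?j \<otimes> g ?k)"
    using c g_t[OF k Suc.prems(3)] by (simp add: M.m_assoc)
  also have "\<dots> = (desc m d \<otimes> t ?j) \<otimes> g ?k" using c by (simp add: M.m_assoc)
  also have "\<dots> = (t (shf m d ?j) \<otimes> desc m d) \<otimes> g ?k"
    unfolding Suc.IH[OF Suc.prems(1) d j] by (rule refl)
  finally show ?case using c by (simp add: M.m_assoc)
qed

text \<open>\<open>torus_e\<close> is a polynomial in its two arguments, so an element that
  intertwines the arguments intertwines the values.\<close>

lemma torus_e_conj:
  assumes x: "x \<in> carrier A" and a: "a \<in> carrier A" "a' \<in> carrier A" and b: "b \<in> carrier A" "b' \<in> carrier A"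
    and xa: "x \<otimes> a = a' \<otimes> x" and xb: "x \<otimes> b = b' \<otimes> x"
  shows "x \<otimes> torus_e K A r a b = torus_e K A r a' b' \<otimes> x"
proof -
  have pw: "x \<otimes> y [^] (s::nat) = y' [^] s \<otimes> x" if "y \<in> carrier A" "y' \<in> carrier A" "x \<otimes> y = y' \<otimes> x" for y y' s
  proof (induction s)
    case (Suc s)
    have "x \<otimes> y [^] Suc s = (x \<otimes> y [^] s) \<otimes> y" using that x by (simp add: M.m_assoc)
    also have "\<dots> = y' [^] s \<otimes> (x \<otimes> y)" unfolding Suc using that x by (simp add: M.m_assoc)
    finally show ?case using that x by (simp add: M.m_assoc)
  qed (use x in simp)
  have cl: "(\<lambda>s. a [^] s \<otimes> b [^] (r - s)) \<in> {..<r} \<rightarrow> carrier A" "(\<lambda>s. a' [^] s \<otimes> b' [^] (r - s)) \<in> {..<r} \<rightarrow> carrier A"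
    using a b by auto
  have 1: "x \<otimes> (a [^] s \<otimes> b [^] (r - s)) = (a' [^] s \<otimes> b' [^] (r - s)) \<otimes> x" for s
  proof -
    have "x \<otimes> (a [^] s \<otimes> b [^] (r - s)) = (x \<otimes> a [^] s) \<otimes> b [^] (r - s)" using x a b by (simp add: M.m_assoc)
    also have "\<dots> = a' [^] s \<otimes> (x \<otimes> b [^] (r - s))" unfolding pw[OF a xa] using x a b by (simp add: M.m_assoc)
    finally show ?thesis unfolding pw[OF b xb] using x a b by (simp add: M.m_assoc)
  qed
  show ?thesis
    unfolding torus_e_def
    using x r_unit M.finsum_closed[OF cl(1)] M.finsum_closed[OF cl(2)] 
    by (simp add: smult_mult_l smult_mult_r M.finsum_rdistr[OF _ x cl(1)] M.finsum_ldistr[OF _ x cl(2)] 1)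
qed

lemma torus_e_sub:
  assumes S: "sub S" and a: "a \<in> carrier A" "\<And>y. y \<in> S \<Longrightarrow> y \<otimes> a \<in> S" and b: "b \<in> carrier A" "\<And>y. y \<in> S \<Longrightarrow> y \<otimes> b \<in> S"
    and x: "x \<in> S"
  shows "x \<otimes> torus_e K A r a b \<in> S"
proof -
  have pw: "y \<otimes> c [^] (s::nat) \<in> S" if "c \<in> carrier A" "\<And>y. y \<in> S \<Longrightarrow> y \<otimes> c \<in> S" "y \<in> S" for c y s
  proof (induction s)
    case (Suc s)
    have "y \<otimes> c [^] Suc s = (y \<otimes> c [^] s) \<otimes> c" using that subD(1)[OF S] by (simp add: M.m_assoc)
    then show ?case using that(2)[OF Suc] by simp
  qed (use that subD(1)[OF S] in simp)
  have xc: "x \<in> carrier A" using subD(1)[OF S x] .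
  have cl: "(\<lambda>s. a [^] s \<otimes> b [^] (r - s)) \<in> {..<r} \<rightarrow> carrier A"
    using a b by auto
  have "(\<Oplus>s\<in>{..<r}. x \<otimes> (a [^] s \<otimes> b [^] (r - s))) \<in> S"
  proof (rule sub_finsum[OF S])
    fix s
    have "x \<otimes> (a [^] s \<otimes> b [^] (r - s)) = (x \<otimes> a [^] s) \<otimes> b [^] (r - s)"
      using xc a b by (simp add: M.m_assoc)
    then show "x \<otimes> (a [^] s \<otimes> b [^] (r - s)) \<in> S" using pw[OF b pw[OF a x]] by simp
  qed
  then show ?thesis
    unfolding torus_e_def
    using xc r_unit M.finsum_closed[OF cl] subD(4)[OF S]
    by (simp add: smult_mult_r M.finsum_rdistr[OF _ xc cl])
qed

text \<open>The letters of \<open>desc m d\<close> have indices from \<open>m - d + 1\<close> to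
  \<open>m\<close>, all at distance at least 2 from \<open>i\<close>.\<close>

lemma desc_g_low: "m < n \<Longrightarrow> d \<le> m \<Longrightarrow> 1 \<le> i \<Longrightarrow> i < m - d \<Longrightarrow> desc m d \<otimes> g i = g i \<otimes> desc m d"
proof (induction d)
  case 0
  then show ?case using g_closed by simp
next
  case (Suc d)
  have c: "desc m d \<in> carrier A" "g (m - d) \<in> carrier A" "g i \<in> carrier A"
    using Suc.prems by (auto intro!: desc_closed g_closed)
  have gg: "g (m - d) \<otimes> g i = g i \<otimes> g (m - d)"
    using Suc.prems by (intro g_comm) auto
  have "desc m (Suc d) \<otimes> g i = desc m d \<otimes> (g i \<otimes> g (m - d))"
    using c gg by (simp add: M.m_assoc)
  also have "\<dots> = (desc m d \<otimes> g i) \<otimes> g (m - d)" using c by (simp add: M.m_assoc)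
  also have "\<dots> = (g i \<otimes> desc m d) \<otimes> g (m - d)" using Suc by simp
  finally show ?case using c by (simp add: M.m_assoc)
qed

text \<open>Here the word contains the adjacent letters \<open>g i\<close> and
  \<open>g (i - 1)\<close>. The new \<open>g i\<close> commutes with all letters after them, the
  braid relation turns \<open>g i g (i - 1) g i\<close> into \<open>g (i - 1) g i g (i - 1)\<close>,
  and the leading \<open>g (i - 1)\<close> commutes with the letters before them.\<close>

lemma desc_g_high: "m < n \<Longrightarrow> d \<le> m \<Longrightarrow> i \<le> m \<Longrightarrow> Suc m - d < i \<Longrightarrow> desc m d \<otimes> g i = g (i - 1) \<otimes> desc m d"
proof (induction d)
  case 0
  then show ?case by simp
next
  case (Suc d)
  let ?k = "m - d"
  have c: "desc m d \<in> carrier A" "g ?k \<in> carrier A" "g i \<in> carrier A" "g (i - 1) \<in> carrier A"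
    using Suc.prems by (auto intro!: desc_closed g_closed)
  show ?case
  proof (cases "Suc ?k < i")
    case True
    have gg: "g ?k \<otimes> g i = g i \<otimes> g ?k"
      using Suc.prems True by (intro g_comm) auto
    have IH: "desc m d \<otimes> g i = g (i - 1) \<otimes> desc m d"
      using Suc.prems True by (intro Suc.IH) auto
    have "desc m (Suc d) \<otimes> g i = desc m d \<otimes> (g i \<otimes> g ?k)"
      using c gg by (simp add: M.m_assoc)
    also have "\<dots> = (desc m d \<otimes> g i) \<otimes> g ?k" using c by (simp add: M.m_assoc)
    also have "\<dots> = (g (i - 1) \<otimes> desc m d) \<otimes> g ?k" unfolding IH by (rule refl)
    finally show ?thesis using c by (simp add: M.m_assoc)
  next
    case False
    then have i: "i = Suc ?k" using Suc.prems by simp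
    with Suc.prems obtain d' where d: "d = Suc d'" by (cases d) auto
    have k: "m - d' = Suc ?k" "?k \<in> {1..<n}" "Suc ?k \<in> {1..<n}" using Suc.prems d by auto
    have c': "desc m d' \<in> carrier A" "g (Suc ?k) \<in> carrier A" using Suc.prems d k by (auto intro!: desc_closed g_closed)
    have "desc m (Suc d) \<otimes> g i = desc m d' \<otimes> (g (Suc ?k) \<otimes> g ?k \<otimes> g (Suc ?k))"
      using c c' by (simp add: d k[unfolded d] i[unfolded d] M.m_assoc)
    also have "\<dots> = desc m d' \<otimes> g ?k \<otimes> (g (Suc ?k) \<otimes> g ?k)"
      unfolding braid[OF k(2,3), symmetric] using c c' by (simp add: M.m_assoc)
    also have "desc m d' \<otimes> g ?k = g ?k \<otimes> desc m d'"
      using Suc.prems d k by (intro desc_g_low) auto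
    finally show ?thesis using c c' by (simp add: d k[unfolded d] i[unfolded d] M.m_assoc)
  qed
qed

text \<open>The last letter is repeated. The quadratic relation creates an idempotent inside the
  word, which is carried to the left end, where it can be absorbed by the coefficient; its indices
  change according to \<open>shf\<close>.\<close>

lemma desc_g_eq:
  assumes "m < n" "Suc d \<le> m"
  shows "desc m (Suc d) \<otimes> g (m - d) = desc m d \<oplus> z \<odot>
    (torus_e K A r (t (shf m d (m - d))) (t (shf m d (Suc (m - d)))) \<otimes> desc m (Suc d))"
proof -
  let ?k = "m - d" and ?x = "desc m d"
  let ?e = "torus_e K A r (t ?k) (t (Suc ?k))" and ?e' = "torus_e K A r (t (shf m d ?k)) (t (shf m d (Suc ?k)))"
  have k: "?k \<in> {1..<n}" "?k \<in> {1..n}" "Suc ?k \<in> {1..n}" using assms by auto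
  have d: "d \<le> m" using assms by simp
  have c: "?x \<in> carrier A" "g ?k \<in> carrier A" using assms k by (auto intro!: desc_closed g_closed)
  note tc = t_closed[OF k(2)] t_closed[OF k(3)] t_closed[OF shf_range[OF assms(1) d k(2)]] t_closed[OF shf_range[OF assms(1) d k(3)]]
  have e: "?e \<in> carrier A" "?e' \<in> carrier A" by (intro torus_e_closed r_unit tc)+
  have "desc m (Suc d) \<otimes> g ?k = ?x \<otimes> (g ?k \<otimes> g ?k)" using c by (simp add: M.m_assoc)
  also have "\<dots> = ?x \<oplus> z \<odot> (?x \<otimes> ?e \<otimes> g ?k)"
    unfolding quad[OF k(1)] using c e z_closed by (simp add: M.r_distr smult_mult_r M.m_assoc)
  also have "?x \<otimes> ?e = ?e' \<otimes> ?x"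
    using desc_t[OF assms(1) d k(2)] desc_t[OF assms(1) d k(3)] by (intro torus_e_conj c tc)
  finally show ?thesis using c e by (simp add: M.m_assoc)
qed

text \<open>The \<open>m + 2\<close> words \<open>desc (Suc m) d\<close> represent the cosets of the
  symmetric group on \<open>m + 1\<close> points in the one on \<open>m + 2\<close> points. So
  \<open>H m\<close> is the span of all torus monomials times the normal words in the first
  \<open>m\<close> generators \<open>g\<close>.\<close>

primrec H :: "nat \<Rightarrow> 'a set" where
  "H 0 = D n"
| "H (Suc m) = comb (H m) (desc (Suc m)) {..Suc m}"

lemma desc_Pi: "m < n \<Longrightarrow> desc m \<in> {..m} \<rightarrow> carrier A"
  by (auto intro: desc_closed)

lemma sub_H: "m < n \<Longrightarrow> sub (H m)"
  by (induction m) (auto intro!: sub_comb desc_Pi simp: sub_D)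

lemma desc_H: "Suc m < n \<Longrightarrow> d \<le> Suc m \<Longrightarrow> h \<in> H m \<Longrightarrow> h \<otimes> desc (Suc m) d \<in> H (Suc m)"
  unfolding H.simps by (intro comb_incl sub_H desc_Pi) auto

lemma one_H: "m < n \<Longrightarrow> \<one> \<in> H m"
proof (induction m)
  case 0
  then show ?case by (simp add: one_D)
next
  case (Suc m)
  then show ?case using desc_H[of m 0 "\<one>"] by simp
qed

lemma H_mult_t: "m < n \<Longrightarrow> i \<in> {1..n} \<Longrightarrow> x \<in> H m \<Longrightarrow> x \<otimes> t i \<in> H m"
proof (induction m arbitrary: i x)
  case 0
  then show ?case using D_mult_t[of n i x] by simp
next
  case (Suc m)
  have m: "m < n" using Suc by simp
  show ?case
  proof (rule comb_mult[OF sub_H[OF m] _ desc_Pi[OF Suc.prems(1)] sub_H[OF Suc.prems(1)] t_closed[OF Suc.prems(2)] _ Suc.prems(3)[unfolded H.simps]])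
    fix d h assume "d \<in> {..Suc m}" and h: "h \<in> H m"
    then have d: "d \<le> Suc m" by simp
    let ?j = "shf (Suc m) d i"
    have j: "?j \<in> {1..n}" using Suc.prems d by (intro shf_range)
    have hc: "h \<in> carrier A" using subD(1)[OF sub_H[OF m] h] .
    have "h \<otimes> desc (Suc m) d \<otimes> t i = (h \<otimes> t ?j) \<otimes> desc (Suc m) d"
      using desc_t[OF Suc.prems(1) d Suc.prems(2)] hc t_closed[OF j] t_closed[OF Suc.prems(2)] desc_closed[OF Suc.prems(1) d]
      by (simp add: M.m_assoc)
    then show "h \<otimes> desc (Suc m) d \<otimes> t i \<in> H (Suc m)"
      using desc_H[OF Suc.prems(1) d Suc.IH[OF m j h]] by simp
  qed simp
qed

text \<open>A generator meets the final descending word in one of four ways: it lies below and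
  commutes with the word, extends it, repeats its last letter, or lies inside and comes out on the
  left with index lowered by one. Whatever comes out on the left is absorbed into \<open>H m\<close>
  by the induction hypothesis or by \<open>H_mult_t\<close>.\<close>

lemma H_mult_g: "m < n \<Longrightarrow> i \<in> {1..m} \<Longrightarrow> x \<in> H m \<Longrightarrow> x \<otimes> g i \<in> H m"
proof (induction m arbitrary: i x)
  case 0
  then show ?case by simp
next
  case (Suc m)
  have m: "m < n" using Suc by simp
  have gi: "g i \<in> carrier A" using Suc.prems by (intro g_closed) auto
  let ?m = "Suc m"
  note S = sub_H[OF m] and S' = sub_H[OF Suc.prems(1)]
  show ?case
  proof (rule comb_mult[OF S _ desc_Pi[OF Suc.prems(1)] S' gi _ Suc.prems(3)[unfolded H.simps]])
    fix d h assume "d \<in> {..Suc m}" and h: "h \<in> H m"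
    then have d: "d \<le> Suc m" by simp
    have hc: "h \<in> carrier A" using subD(1)[OF S h] .
    have dc: "desc ?m d \<in> carrier A" using Suc.prems d by (intro desc_closed)
    have comm: "h \<otimes> desc ?m d \<otimes> g i \<in> H ?m"
      if j: "j \<in> {1..m}" and e: "desc ?m d \<otimes> g i = g j \<otimes> desc ?m d" for j
    proof -
      have "g j \<in> carrier A" using j m by (intro g_closed) auto
      then have "h \<otimes> desc ?m d \<otimes> g i = (h \<otimes> g j) \<otimes> desc ?m d"
        using e hc dc gi by (simp add: M.m_assoc)
      then show ?thesis using desc_H[OF Suc.prems(1) d Suc.IH[OF m j h]] by (simp del: H.simps)
    qed
    consider "i < ?m - d" | "i = ?m - d" | "i = Suc ?m - d" | "Suc ?m - d < i" by linarith
    then show "h \<otimes> desc ?m d \<otimes> g i \<in> H ?m"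
    proof cases
      case 1
      then show ?thesis using Suc.prems d by (intro comm[of i] desc_g_low) auto
    next
      case 2
      then have "h \<otimes> desc ?m d \<otimes> g i = h \<otimes> desc ?m (Suc d)"
        using hc dc gi by (simp add: M.m_assoc)
      moreover have "Suc d \<le> ?m" using 2 Suc.prems by auto
      ultimately show ?thesis using desc_H[OF Suc.prems(1) _ h, of "Suc d"] by (simp del: H.simps desc.simps)
    next
      case 3
      then obtain d' where d': "d = Suc d'" using Suc.prems by (cases d) auto
      have i: "i = ?m - d'" using 3 d' by simp
      have d'm: "Suc d' \<le> ?m" "d' \<le> ?m" using d d' by auto
      let ?a = "shf ?m d' (?m - d')" and ?b = "shf ?m d' (Suc (?m - d'))"
      let ?e = "torus_e K A r (t ?a) (t ?b)"
      have ab: "?a \<in> {1..n}" "?b \<in> {1..n}" using Suc.prems d'm by (intro shf_range; auto)+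
      have ec: "?e \<in> carrier A" using ab by (intro torus_e_closed r_unit t_closed)
      have dc': "desc ?m d' \<in> carrier A" using Suc.prems d'm by (intro desc_closed)
      have "h \<otimes> desc ?m d \<otimes> g i = h \<otimes> desc ?m d' \<oplus> z \<odot> ((h \<otimes> ?e) \<otimes> desc ?m d)"
        using desc_g_eq[OF Suc.prems(1) d'm(1), folded i d'] hc dc dc' gi ec z_closed
        by (simp add: M.m_assoc M.r_distr smult_mult_r i)
      \<comment> \<open>The idempotent is a polynomial in torus generators, and \<open>H m\<close>
        is stable under right multiplication by these.\<close>
      moreover have "h \<otimes> ?e \<in> H m"
        using ab m by (intro torus_e_sub[OF S _ _ _ _ h] t_closed H_mult_t)
      ultimately show ?thesis
        using desc_H[OF Suc.prems(1) d'm(2) h] desc_H[OF Suc.prems(1) d] z_closed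
        by (simp add: subD(3,4)[OF S'] del: H.simps desc.simps)
    next
      case 4
      then show ?thesis using Suc.prems d by (intro comm[of "i - 1"] desc_g_high) auto
    qed
  qed simp
qed

end

locale yh_alg_gen = yh_alg +
  assumes generates_gens: "generates (t ` {1..n} \<union> g ` {1..<n})"
begin

lemma carrier_H: "carrier A \<subseteq> H (n - 1)"
proof (rule generatesD[OF generates_gens])
  show "x \<otimes> a \<in> H (n - 1)" if "x \<in> H (n - 1)" "a \<in> t ` {1..n} \<union> g ` {1..<n}" for x a
    using that(2,1) n_pos H_mult_t[of "n - 1"] H_mult_g[of "n - 1"] by fastforce
qed (use n_pos sub_H[of "n - 1"] one_H[of "n - 1"] in auto)

end

section \<open>The operators on tensor space, pointwise\<close>

lemma finite_words: "finite {w. w \<in> lists S \<and> length w = m}" if "finite S"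
  using finite_lists_length_eq[OF that, of m] by (simp add: lists_eq_set conj_commute)

lemma word_monoid_sel: "carrier (word_monoid S) = lists S" "monoid.mult (word_monoid S) = (@)" "one (word_monoid S) = []"
  by (simp_all add: word_monoid_def)

locale tensor_space = R: cring K for K :: "'b ring" (structure) +
  fixes r n :: nat
begin

definition letters :: "(nat \<times> nat) set" where
  "letters = {1..n} \<times> {0..<r}"

definition words :: "(nat \<times> nat) list set" where
  "words = {w. w \<in> lists letters \<and> length w = n}"

abbreviation TP where "TP \<equiv> tensor_power K r n n"

sublocale TA: monoid_alg K "word_monoid letters"
  by (intro monoid_alg.intro word_monoid_monoid R.is_cring)

lemma TA_eq: "tensor_algebra K r n = TA.P"
  by (simp add: tensor_algebra_def letters_def)

lemma TP_sel: "\<zero>\<^bsub>TP\<^esub> = (\<lambda>w. \<zero>)" "f \<oplus>\<^bsub>TP\<^esub> g = (\<lambda>w. f w \<oplus> g w)" "c \<odot>\<^bsub>TP\<^esub> f = (\<lambda>w. c \<otimes> f w)"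
  using TA.zero_P TA.add_P[of f g] TA.smult_P[of c f] by (simp_all add: tensor_power_def TA_eq)

lemma finite_tensor_words: "finite words"
  unfolding words_def by (rule finite_words) (simp add: letters_def)

text \<open>There are finitely many words of length \<open>n\<close>, so finite support is automatic
  and the tensor power consists of all functions on \<open>words\<close>, extended by zero.\<close>

lemma TP_carrier: "x \<in> carrier TP \<longleftrightarrow> (\<forall>w. x w \<in> carrier K) \<and> (\<forall>w. w \<notin> words \<longrightarrow> x w = \<zero>)"
proof -
  have "finite {w. x w \<noteq> \<zero>}" if "\<forall>w. w \<notin> words \<longrightarrow> x w = \<zero>"
    by (rule finite_subset[OF _ finite_tensor_words]) (use that in auto)
  then show ?thesis
    by (auto simp: tensor_power_def TA_eq TA.carrier_P words_def word_monoid_sel simp del: in_lists_conv_set)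
qed

lemma TP_closed: "x \<in> carrier TP \<Longrightarrow> x w \<in> carrier K"
  by (simp add: TP_carrier)

lemma module_TP: "module K TP"
proof (rule moduleI)
  show "abelian_group TP"
  proof (rule abelian_groupI)
    fix x assume "x \<in> carrier TP"
    then show "\<exists>y\<in>carrier TP. y \<oplus>\<^bsub>TP\<^esub> x = \<zero>\<^bsub>TP\<^esub>"
      by (intro bexI[of _ "\<lambda>w. \<ominus> x w"]) (auto simp: TP_sel TP_carrier R.l_neg)
  qed (auto simp: TP_sel TP_carrier R.a_ac)
qed (auto simp: TP_sel TP_carrier R.is_cring R.l_distr R.r_distr R.m_assoc)

sublocale TP: module K TP by (rule module_TP)

lemma finsum_TP: 
  assumes "f \<in> I \<rightarrow> carrier TP"
  shows "(\<Oplus>\<^bsub>TP\<^esub>i\<in>I. f i) w = (\<Oplus>i\<in>I. f i w)"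
  using assms
proof (induction I rule: infinite_finite_induct)
  case (insert i I)
  then have "f \<in> I \<rightarrow> carrier TP" "f i \<in> carrier TP" "(\<lambda>i. f i w) \<in> I \<rightarrow> carrier K" "f i w \<in> carrier K"
    using TP_closed by auto
  then show ?case using insert by (simp add: TP_sel)
qed (simp_all add: TP_sel)

text \<open>Terms outside the support are zero; summing over all words makes the index set
  independent of the tensor.\<close>

lemma linear_extension_TP:
  assumes x: "x \<in> carrier TP" and f: "\<And>w. w \<in> words \<Longrightarrow> f w \<in> carrier TP"
  shows "linear_extension K TP f x v = (\<Oplus>w\<in>words. x w \<otimes> f w v)"
proof -
  have sub: "{w. x w \<noteq> \<zero>} \<subseteq> words" using x by (auto simp: TP_carrier)
  have "(\<lambda>w. x w \<odot>\<^bsub>TP\<^esub> f w) \<in> {w. x w \<noteq> \<zero>} \<rightarrow> carrier TP"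
    using x f sub TP_closed[OF x] by auto
  from finsum_TP[OF this] have "linear_extension K TP f x v = (\<Oplus>w\<in>{w. x w \<noteq> \<zero>}. x w \<otimes> f w v)"
    using x by (simp add: linear_extension_def TP_sel)
  also have "\<dots> = (\<Oplus>w\<in>words. x w \<otimes> f w v)"
    by (rule R.add.finprod_mono_neutral_cong_left[OF finite_tensor_words sub])
       (use f TP_closed[OF x] TP_closed in auto)
  finally show ?thesis .
qed

lemma finsum_words_delta:
  assumes v: "v \<in> words" and c: "c \<in> carrier K"
  shows "(\<Oplus>w\<in>words. if w = v then c else \<zero>) = c"
  using R.add.finprod_singleton_swap[OF v finite_tensor_words, of "\<lambda>_. c"] c by simp

definition delta :: "(nat \<times> nat) list \<Rightarrow> (nat \<times> nat) list \<Rightarrow> 'b" where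
  "delta v = (\<lambda>w. if w = v then \<one> else \<zero>)"

lemma delta_closed: "v \<in> words \<Longrightarrow> delta v \<in> carrier TP"
  by (auto simp: delta_def TP_carrier)

lemma words_nth: "w \<in> words \<Longrightarrow> i < n \<Longrightarrow> w ! i \<in> letters"
  unfolding words_def using nth_mem by blast

lemma T_op_eq:
  assumes x: "x \<in> carrier TP" and i: "i \<in> {1..n}" and \<xi>: "\<xi> \<in> carrier K"
  shows "T_op K \<xi> r n i x v = \<xi> [^] snd (v ! (i - 1)) \<otimes> x v"
proof -
  define f where "f w = monomial K (take (i - 1) w) \<otimes>\<^bsub>TA.P\<^esub> T_basis K \<xi> r n (w ! (i - 1)) \<otimes>\<^bsub>TA.P\<^esub> monomial K (drop i w)" for w
  have f: "f w = (\<lambda>v. if v = w then \<xi> [^] snd (w ! (i - 1)) else \<zero>)" if w: "w \<in> words" for w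
  proof -
    have l: "length w = n" "i - 1 < n" "i \<le> n" and s: "set w \<subseteq> letters"
      using w i by (auto simp: words_def)
    have d: "take (i - 1) w @ [w ! (i - 1)] @ drop i w = w"
      using id_take_nth_drop[of "i - 1" w] l i by simp
    have m: "take (i - 1) w \<in> carrier (word_monoid letters)" 
       "[w ! (i - 1)] \<in> carrier (word_monoid letters)" 
       "drop i w \<in> carrier (word_monoid letters)"
      using s words_nth[OF w l(2)] by (auto simp: word_monoid_sel dest!: in_set_takeD in_set_dropD)
    have "f w = single K (\<xi> [^] snd (w ! (i - 1))) (take (i - 1) w @ [w ! (i - 1)] @ drop i w)"
      unfolding f_def T_basis_def monomial_single TA_eq using m \<xi>
      by (cases "w ! (i - 1)") (simp add: TA.smult_single TA.single_mult word_monoid_sel)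
    then show ?thesis unfolding d single_def .
  qed
  have fc: "f w \<in> carrier TP" if "w \<in> words" for w
    unfolding f[OF that] using that \<xi> by (auto simp: TP_carrier)
  have "T_op K \<xi> r n i x v = (\<Oplus>w\<in>words. x w \<otimes> f w v)"
    unfolding T_op_def Let_def TA_eq f_def[symmetric] by (rule linear_extension_TP[OF x fc])
  also have "\<dots> = (\<Oplus>w\<in>words. if w = v then \<xi> [^] snd (v ! (i - 1)) \<otimes> x v else \<zero>)"
    using \<xi> TP_closed[OF x] by (intro R.finsum_cong') (auto simp: f R.m_comm)
  also have "\<dots> = \<xi> [^] snd (v ! (i - 1)) \<otimes> x v"
  proof (cases "v \<in> words")
    case True
    then show ?thesis using \<xi> TP_closed[OF x] by (intro finsum_words_delta) auto
  next
    case False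
    then have "(\<Oplus>w\<in>words. if w = v then \<xi> [^] snd (v ! (i - 1)) \<otimes> x v else \<zero>) = \<zero>"
      by (intro R.add.finprod_one_eqI) auto
    then show ?thesis using False x \<xi> by (simp add: TP_carrier)
  qed
  finally show ?thesis .
qed

text \<open>The tensor factors \<open>i\<close> and \<open>i + 1\<close> are the list positions
  \<open>i - 1\<close> and \<open>i\<close>.\<close>

definition sw :: "nat \<Rightarrow> (nat \<times> nat) list \<Rightarrow> (nat \<times> nat) list" where
  "sw i w = w[i - 1 := w ! i, i := w ! (i - 1)]"

text \<open>The diagonal entry of the operator \<open>G\<close> at a pair of letters. Only this
  entry depends on colours and order: the entry that exchanges two letters is 1 whenever they
  differ.\<close>

definition alpha :: "'b \<Rightarrow> nat \<times> nat \<Rightarrow> nat \<times> nat \<Rightarrow> 'b" where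
  "alpha q a b = (if snd a \<noteq> snd b then \<zero> else if fst a = fst b then q
     else if fst a < fst b then q \<ominus> inv q else \<zero>)"

lemma alpha_closed: "q \<in> Units K \<Longrightarrow> alpha q a b \<in> carrier K"
  by (auto simp: alpha_def)

lemma sw_words: "w \<in> words \<Longrightarrow> i \<in> {1..<n} \<Longrightarrow> sw i w \<in> words"
proof -
  assume w: "w \<in> words" and i: "i \<in> {1..<n}"
  then have "w ! i \<in> letters" "w ! (i - 1) \<in> letters" "set w \<subseteq> letters"
    by (auto intro!: words_nth, auto simp: words_def)
  then have "set (sw i w) \<subseteq> letters"
    unfolding sw_def by (intro set_update_subsetI)
  then show ?thesis using w by (auto simp: words_def sw_def)
qed

lemma sw_sw: "i \<in> {1..<length w} \<Longrightarrow> sw i (sw i w) = w"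
  by (auto simp: sw_def nth_list_update list_eq_iff_nth_eq)

lemma length_sw: "length (sw i w) = length w" by (simp add: sw_def)

lemma sw_words_iff: "i \<in> {1..<n} \<Longrightarrow> sw i w \<in> words \<longleftrightarrow> w \<in> words"
  using sw_words[of w i] sw_words[of "sw i w" i] sw_sw[of i w] by (auto simp: words_def length_sw)

text \<open>The operator is read from the side of the target: the coefficient at \<open>v\<close>
  comes from \<open>v\<close> itself, with weight \<open>alpha\<close>, and from the unique word
  that is exchanged into \<open>v\<close>. All relations can then be checked as identities between
  coefficients.\<close>

lemma G_op_eq:
  assumes x: "x \<in> carrier TP" and i: "i \<in> {1..<n}" and q: "q \<in> Units K"
  shows "G_op K q r n i x v = alpha q (v ! (i - 1)) (v ! i) \<otimes> x v \<oplus> (if v ! (i - 1) = v ! i then \<zero> else x (sw i v))"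
proof -
  define f where "f w = monomial K (take (i - 1) w) \<otimes>\<^bsub>TA.P\<^esub> G_basis K q r n (w ! (i - 1)) (w ! i) \<otimes>\<^bsub>TA.P\<^esub> monomial K (drop (i + 1) w)" for w
  have z: "q \<ominus> inv q \<in> carrier K" "q \<in> carrier K" using q by auto
  have f: "f w = (\<lambda>v. (if v = w then alpha q (w ! (i - 1)) (w ! i) else \<zero>) \<oplus> (if w ! (i - 1) = w ! i then \<zero> else if v = sw i w then \<one> else \<zero>))" 
    if w: "w \<in> words" for w
  proof -
    have l: "length w = n" "i - 1 < n" "i < n" and s: "set w \<subseteq> letters"
      using w i by (auto simp: words_def)
    let ?a = "w ! (i - 1)" and ?b = "w ! i" and ?p = "take (i - 1) w" and ?d = "drop (i + 1) w"
    obtain p where p: "i = Suc p" using i by (cases i) auto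
    have d: "?p @ [?a, ?b] @ ?d = w"
      using id_take_nth_drop[of p w] l by (simp add: Cons_nth_drop_Suc p)
    have d': "?p @ [?b, ?a] @ ?d = sw i w"
      using l i unfolding sw_def by (intro nth_equalityI) (auto simp: nth_append nth_list_update nth_Cons' min_def)
    have m: "?p \<in> carrier (word_monoid letters)" "?d \<in> carrier (word_monoid letters)"
       "[?a] \<in> carrier (word_monoid letters)" "[?b] \<in> carrier (word_monoid letters)"
      using s words_nth[OF w l(2)] words_nth[OF w l(3)] by (auto simp: word_monoid_sel dest!: in_set_takeD in_set_dropD)
    have m2: "[?a, ?b] \<in> carrier (word_monoid letters)" "[?b, ?a] \<in> carrier (word_monoid letters)"
      "?p @ [?a, ?b] \<in> carrier (word_monoid letters)" "?p @ [?b, ?a] \<in> carrier (word_monoid letters)"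
      using m by (auto simp: word_monoid_sel)
    have X1: "single K \<one> [?a] \<otimes>\<^bsub>TA.P\<^esub> single K \<one> [?b] = single K \<one> [?a, ?b]"
      "single K \<one> [?b] \<otimes>\<^bsub>TA.P\<^esub> single K \<one> [?a] = single K \<one> [?b, ?a]"
      using m by (simp_all add: TA.single_mult word_monoid_sel)
    have X2: "single K \<one> ?p \<otimes>\<^bsub>TA.P\<^esub> single K c [?a, ?b] \<otimes>\<^bsub>TA.P\<^esub> single K \<one> ?d = single K c w"
      "single K \<one> ?p \<otimes>\<^bsub>TA.P\<^esub> single K c [?b, ?a] \<otimes>\<^bsub>TA.P\<^esub> single K \<one> ?d = single K c (sw i w)" if "c \<in> carrier K" for c
      using m m2 that d d' by (simp_all add: TA.single_mult word_monoid_sel)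
    have X3: "single K \<one> ?p \<otimes>\<^bsub>TA.P\<^esub> (single K c [?a, ?b] \<oplus>\<^bsub>TA.P\<^esub> single K e [?b, ?a]) \<otimes>\<^bsub>TA.P\<^esub> single K \<one> ?d
        = single K c w \<oplus>\<^bsub>TA.P\<^esub> single K e (sw i w)" if "c \<in> carrier K" "e \<in> carrier K" for c e
      using m m2 that X2[OF that(1)] X2[OF that(2)] by (simp add: TA.mult_add TA.add_mult TA.single_closed TA.mult_closed)
    have G: "G_basis K q r n ?a ?b = (if ?a = ?b then single K q [?a, ?b] 
       else single K (alpha q ?a ?b) [?a, ?b] \<oplus>\<^bsub>TA.P\<^esub> single K \<one> [?b, ?a])"
    proof -
      have s0: "single K \<zero> u \<oplus>\<^bsub>TA.P\<^esub> y = y" if "y = single K \<one> u'" for u u' and y :: "(nat \<times> nat) list \<Rightarrow> 'b" 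
        using that by (auto simp: TA.add_P single_def)
      obtain a1 a2 b1 b2 where ab: "?a = (a1, a2)" "?b = (b1, b2)" by (metis surj_pair)
      show ?thesis
        using X1 z unfolding G_basis_def Let_def TA_eq monomial_single ab
        by (auto simp: alpha_def TA.smult_single s0)
    qed
    show ?thesis
    proof (cases "?a = ?b")
      case True
      then show ?thesis unfolding f_def monomial_single G using X2(1)[OF z(2)] z
        by (auto simp: single_def alpha_def)
    next
      case False
      then show ?thesis unfolding f_def monomial_single G using X3[OF alpha_closed[OF q] R.one_closed]
        by (auto simp: single_def TA.add_P)
    qed
  qed
  have fc: "f w \<in> carrier TP" if "w \<in> words" for w
    unfolding f[OF that] using that q sw_words[OF that i] by (auto simp: TP_carrier alpha_closed)
  let ?A = "alpha q (v ! (i - 1)) (v ! i)" and ?x' = "if v ! (i - 1) = v ! i then \<zero> else x (sw i v)"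
  \<comment> \<open>Since \<open>sw i\<close> is an involution, the sum over source words picks out
    exactly \<open>sw i v\<close>.\<close>
  have eqs: "w = sw i v \<longleftrightarrow> v = sw i w" if "w \<in> words" for w
    using sw_sw[of i w] sw_sw[of i v] i that by (auto simp: words_def length_sw)
  have ab: "w ! (i - 1) = v ! i" "w ! i = v ! (i - 1)" if "w = sw i v" "w \<in> words" for w
    using that i by (auto simp: sw_def words_def nth_list_update)
  have c: "?A \<otimes> x v \<in> carrier K" "?x' \<in> carrier K" using TP_closed[OF x] alpha_closed[OF q] by auto
  have "G_op K q r n i x v = (\<Oplus>w\<in>words. x w \<otimes> f w v)"
    unfolding G_op_def Let_def TA_eq f_def[symmetric] by (rule linear_extension_TP[OF x fc])
  also have "\<dots> = (\<Oplus>w\<in>words. (if w = v then ?A \<otimes> x v else \<zero>) \<oplus> (if w = sw i v then ?x' else \<zero>))"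
  proof (intro R.finsum_cong')
    fix w assume w: "w \<in> words"
    show "x w \<otimes> f w v = (if w = v then ?A \<otimes> x v else \<zero>) \<oplus> (if w = sw i v then ?x' else \<zero>)"
    proof -
      have xc: "x w \<in> carrier K" using TP_closed[OF x] .
      have ac: "alpha q a b \<in> carrier K" for a b by (rule alpha_closed[OF q])
      have 1: "x w \<otimes> (if v = w then alpha q (w ! (i - 1)) (w ! i) else \<zero>) = (if w = v then ?A \<otimes> x v else \<zero>)"
        using xc ac[of "v ! (i - 1)" "v ! i"] by (cases "w = v") (simp_all add: R.m_comm)
      have 2: "x w \<otimes> (if w ! (i - 1) = w ! i then \<zero> else if v = sw i w then \<one> else \<zero>) = (if w = sw i v then ?x' else \<zero>)"
      proof (cases "w = sw i v")
        case True
        then have "v = sw i w" using eqs[OF w] by simp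
        then show ?thesis using xc ab[OF True w] True by simp
      next
        case False
        then have "v \<noteq> sw i w" using eqs[OF w] by simp
        then show ?thesis using xc False by simp
      qed
      show ?thesis
        unfolding f[OF w] 1[symmetric] 2[symmetric] by (rule R.r_distr) (use xc ac in auto)
    qed
  qed (use c in auto)
  also have "\<dots> = (\<Oplus>w\<in>words. (if w = v then ?A \<otimes> x v else \<zero>)) \<oplus> (\<Oplus>w\<in>words. if w = sw i v then ?x' else \<zero>)"
    using c by (intro R.finsum_addf) auto
  also have "\<dots> = ?A \<otimes> x v \<oplus> ?x'"
  proof (cases "v \<in> words")
    case True
    then show ?thesis using finsum_words_delta[OF True c(1)] finsum_words_delta[OF sw_words[OF True i] c(2)] by simp
  next
    case False
    then have F: "sw i v \<notin> words" using sw_words_iff[OF i] by simp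
    have "(\<Oplus>w\<in>words. (if w = v then ?A \<otimes> x v else \<zero>)) = \<zero>" "(\<Oplus>w\<in>words. if w = sw i v then ?x' else \<zero>) = \<zero>"
      using False F by (intro R.add.finprod_one_eqI; auto)+
    moreover have "x v = \<zero>" "x (sw i v) = \<zero>" using x False F by (auto simp: TP_carrier)
    ultimately show ?thesis using alpha_closed[OF q] by simp
  qed
  finally show ?thesis .
qed

end

section \<open>The representation\<close>

text \<open>\<open>diff_unit\<close> is the form in which the invertibility of the discriminant
  enters. In a ring with zero divisors nonzero differences of powers of \<open>\<xi>\<close> would
  not permit cancellation; units do.\<close>

locale tensor_rep = tensor_space +
  fixes q \<xi>
  assumes q_unit: "q \<in> Units K" and \<xi>_closed: "\<xi> \<in> carrier K" and \<xi>_pow: "\<xi> [^] r = \<one>"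
    and r_unit: "[r] \<cdot> \<one> \<in> Units K"
    and diff_unit: "\<lbrakk>i < r; j < r; i \<noteq> j\<rbrakk> \<Longrightarrow> \<xi> [^] i \<ominus> \<xi> [^] j \<in> Units K"
begin

text \<open>Orthogonality of the characters of the cyclic group of order \<open>r\<close>. For
  \<open>a = b\<close> every summand is 1; otherwise multiplication by the difference of the two
  roots makes the sum telescope to zero, and that difference is a unit.\<close>

lemma root_sum:
  assumes a: "a < r" and b: "b < r"
  shows "(\<Oplus>s\<in>{..<r}. (\<xi> [^] a) [^] s \<otimes> (\<xi> [^] b) [^] (r - s)) = (if a = b then [r] \<cdot> \<one> else \<zero>)"
proof -
  let ?x = "\<xi> [^] a" and ?y = "\<xi> [^] b"
  have c: "?x \<in> carrier K" "?y \<in> carrier K" using \<xi>_closed by auto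
  have pw: "(\<xi> [^] k) [^] r = \<one>" for k :: nat
    using \<xi>_closed \<xi>_pow by (metis R.nat_pow_one R.nat_pow_pow mult.commute)
  show ?thesis
  proof (cases "a = b")
    case True
    have "(\<Oplus>s\<in>{..<r}. ?x [^] s \<otimes> ?y [^] (r - s)) = (\<Oplus>s\<in>{..<r}. \<one>)"
      using c pw[of b] by (intro R.finsum_cong') (auto simp: True R.nat_pow_mult)
    then show ?thesis using True R.add.finprod_const[of \<one> "{..<r}"] by simp
  next
    case False
    let ?S = "\<lambda>m. \<Oplus>s\<in>{..<m}. ?x [^] s \<otimes> ?y [^] (r - s)"
    \<comment> \<open>The telescoping identity for partial sums. At \<open>m = r\<close> the
      right-hand side is \<open>?y \<ominus> ?y\<close>, because both roots have \<open>r\<close>-th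
      power 1.\<close>
    have "m \<le> r \<Longrightarrow> (?x \<ominus> ?y) \<otimes> ?S m = ?x [^] m \<otimes> ?y [^] (r - m + 1) \<ominus> ?y [^] (r + 1)" for m
    proof (induction m)
      case 0
      then show ?case using c by (simp add: R.minus_eq R.r_neg)
    next
      case (Suc m)
      have s: "(\<lambda>s. ?x [^] s \<otimes> ?y [^] (r - s)) \<in> {..<m} \<rightarrow> carrier K" using c by auto
      let ?X = "?x [^] m" and ?Y = "?y [^] (r - m)"
      have cc: "?X \<in> carrier K" "?Y \<in> carrier K" "?S m \<in> carrier K" "?y [^] (r + 1) \<in> carrier K"
        using c R.finsum_closed[OF s] by auto
      have e: "?y [^] (r - m + 1) = ?Y \<otimes> ?y" "?x [^] Suc m = ?X \<otimes> ?x" "r - Suc m + 1 = r - m" using Suc.prems by auto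
      have "?S (Suc m) = ?X \<otimes> ?Y \<oplus> ?S m"
        using s c by (simp add: lessThan_Suc)
      then have "(?x \<ominus> ?y) \<otimes> ?S (Suc m) = (?x \<ominus> ?y) \<otimes> (?X \<otimes> ?Y) \<oplus> (?x \<ominus> ?y) \<otimes> ?S m"
        using c cc by (simp add: R.r_distr)
      also have "(?x \<ominus> ?y) \<otimes> ?S m = ?X \<otimes> (?Y \<otimes> ?y) \<ominus> ?y [^] (r + 1)"
        using Suc e by simp
      also have "(?x \<ominus> ?y) \<otimes> (?X \<otimes> ?Y) \<oplus> (?X \<otimes> (?Y \<otimes> ?y) \<ominus> ?y [^] (r + 1)) = ?X \<otimes> ?x \<otimes> ?Y \<ominus> ?y [^] (r + 1)"
        using c(1,2) cc by algebra
      finally show ?case unfolding e .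
    qed
    from this[of r] have "(?x \<ominus> ?y) \<otimes> ?S r = \<zero>"
      using c pw by (simp add: R.minus_eq R.r_neg)
    moreover have "?S r \<in> carrier K" using c by (intro R.finsum_closed) auto
    ultimately have "?S r = \<zero>"
      using R.Units_l_cancel[OF diff_unit[OF a b False] _ R.zero_closed] R.Units_closed[OF diff_unit[OF a b False]]
      by simp
    then show ?thesis using False by simp
  qed
qed

lemma finsum_swap:
  assumes I: "finite I" and J: "finite J" and f: "\<And>i j. i \<in> I \<Longrightarrow> j \<in> J \<Longrightarrow> f i j \<in> carrier K"
  shows "(\<Oplus>i\<in>I. \<Oplus>j\<in>J. f i j) = (\<Oplus>j\<in>J. \<Oplus>i\<in>I. f i j)"
  using I f
proof (induction I rule: finite_induct)
  case empty
  then show ?case by simp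
next
  case (insert k I)
  have c: "(\<lambda>i. \<Oplus>j\<in>J. f i j) \<in> I \<rightarrow> carrier K" "(\<Oplus>j\<in>J. f k j) \<in> carrier K" "f k \<in> J \<rightarrow> carrier K"
    "(\<lambda>j. \<Oplus>i\<in>I. f i j) \<in> J \<rightarrow> carrier K"
    using insert.prems by (auto intro!: R.finsum_closed)
  have "(\<Oplus>i\<in>insert k I. \<Oplus>j\<in>J. f i j) = (\<Oplus>j\<in>J. f k j) \<oplus> (\<Oplus>j\<in>J. \<Oplus>i\<in>I. f i j)"
    using insert c by (simp add: R.finsum_insert)
  also have "\<dots> = (\<Oplus>j\<in>J. f k j \<oplus> (\<Oplus>i\<in>I. f i j))"
    using c by (intro R.finsum_addf[symmetric]) auto
  also have "\<dots> = (\<Oplus>j\<in>J. \<Oplus>i\<in>insert k I. f i j)"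
  proof (intro R.finsum_cong')
    fix j assume j: "j \<in> J"
    then have "(\<lambda>i. f i j) \<in> I \<rightarrow> carrier K" "f k j \<in> carrier K" using insert.prems by auto
    then show "f k j \<oplus> (\<Oplus>i\<in>I. f i j) = (\<Oplus>i\<in>insert k I. f i j)" using insert.hyps by simp
  qed (use insert.prems in \<open>auto intro!: R.finsum_closed\<close>)
  finally show ?case .
qed

text \<open>Multiplying the equation for \<open>c\<close> by the inverse character, written as
  \<open>(\<xi> [^] b) [^] (r - c)\<close>, and summing over \<open>c\<close> leaves
  \<open>r\<close> times \<open>d b\<close> by \<open>root_sum\<close>. Since \<open>r\<close> is a
  unit, \<open>d b\<close> vanishes.\<close>

lemma fourier_inj:
  assumes d: "d \<in> {..<r} \<rightarrow> carrier K"
    and 0: "\<And>c. c < r \<Longrightarrow> (\<Oplus>s\<in>{..<r}. d s \<otimes> (\<xi> [^] c) [^] s) = \<zero>" and b: "b < r"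
  shows "d b = \<zero>"
proof -
  have pp: "(\<xi> [^] c) [^] s = (\<xi> [^] s) [^] c" for c s :: nat
    using \<xi>_closed by (simp add: R.nat_pow_pow mult.commute)
  let ?w = "\<lambda>c. (\<xi> [^] b) [^] (r - c)"
  have wc: "?w c \<in> carrier K" "(\<xi> [^] c) [^] (s::nat) \<in> carrier K" for c s using \<xi>_closed by auto
  have dc: "d s \<in> carrier K" if "s < r" for s using d that by auto
  have "\<zero> = (\<Oplus>c\<in>{..<r}. (\<Oplus>s\<in>{..<r}. d s \<otimes> (\<xi> [^] c) [^] s) \<otimes> ?w c)"
    by (rule R.add.finprod_one_eqI[symmetric]) (use 0 wc in auto)
  also have "\<dots> = (\<Oplus>c\<in>{..<r}. \<Oplus>s\<in>{..<r}. d s \<otimes> (\<xi> [^] c) [^] s \<otimes> ?w c)"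
    using dc wc by (intro R.finsum_cong' R.finsum_ldistr) (auto intro!: R.finsum_closed)
  also have "\<dots> = (\<Oplus>s\<in>{..<r}. \<Oplus>c\<in>{..<r}. d s \<otimes> (\<xi> [^] c) [^] s \<otimes> ?w c)"
    using dc wc by (intro finsum_swap) auto
  also have "\<dots> = (\<Oplus>s\<in>{..<r}. d s \<otimes> (\<Oplus>c\<in>{..<r}. (\<xi> [^] s) [^] c \<otimes> ?w c))"
  proof (intro R.finsum_cong')
    fix s assume s: "s \<in> {..<r}"
    have "d s \<otimes> (\<Oplus>c\<in>{..<r}. (\<xi> [^] s) [^] c \<otimes> ?w c) = (\<Oplus>c\<in>{..<r}. d s \<otimes> ((\<xi> [^] s) [^] c \<otimes> ?w c))"
      using dc s wc by (intro R.finsum_rdistr) auto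
    also have "\<dots> = (\<Oplus>c\<in>{..<r}. d s \<otimes> (\<xi> [^] c) [^] s \<otimes> ?w c)"
      using dc s wc by (intro R.finsum_cong') (auto simp: R.m_assoc pp[of _ s])
    finally show "(\<Oplus>c\<in>{..<r}. d s \<otimes> (\<xi> [^] c) [^] s \<otimes> ?w c) = d s \<otimes> (\<Oplus>c\<in>{..<r}. (\<xi> [^] s) [^] c \<otimes> ?w c)" by simp
  qed (use dc wc in \<open>auto intro!: R.finsum_closed\<close>)
  also have "\<dots> = (\<Oplus>s\<in>{..<r}. if s = b then d s \<otimes> [r] \<cdot> \<one> else \<zero>)"
    using dc b by (intro R.finsum_cong') (auto simp: root_sum)
  also have "\<dots> = d b \<otimes> [r] \<cdot> \<one>"
    using dc b by (intro R.add.finprod_singleton_swap) auto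
  finally have e: "d b \<otimes> [r] \<cdot> \<one> = \<zero>" by simp
  have "d b = d b \<otimes> ([r] \<cdot> \<one> \<otimes> inv ([r] \<cdot> \<one>))" using r_unit dc[OF b] by simp
  also have "\<dots> = d b \<otimes> [r] \<cdot> \<one> \<otimes> inv ([r] \<cdot> \<one>)"
    by (rule R.m_assoc[symmetric]) (use r_unit dc[OF b] in auto)
  also have "\<dots> = \<zero>" unfolding e using r_unit by simp
  finally show ?thesis .
qed

section \<open>The operators as elements of the endomorphism algebra\<close>

abbreviation End where "End \<equiv> End_algebra K TP"
abbreviation TT where "TT \<equiv> T_op K \<xi> r n"
abbreviation GG where "GG \<equiv> G_op K q r n"

sublocale End: nc_algebra K End by (rule nc_algebra_End[OF module_TP])

lemma End_apply: "f \<in> carrier End \<Longrightarrow> x \<in> carrier TP \<Longrightarrow> f x \<in> carrier TP"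
  unfolding End_carrier by (blast dest: PiE_mem)

lemma mult_apply: "x \<in> carrier TP \<Longrightarrow> (f \<otimes>\<^bsub>End\<^esub> g) x = g (f x)"
  by (simp add: End_sel compose_def)

lemma TT_eq: "x \<in> carrier TP \<Longrightarrow> i \<in> {1..n} \<Longrightarrow> TT i x v = \<xi> [^] snd (v ! (i - 1)) \<otimes> x v"
  by (rule T_op_eq[OF _ _ \<xi>_closed])

lemma GG_eq: "x \<in> carrier TP \<Longrightarrow> i \<in> {1..<n} \<Longrightarrow>
    GG i x v = alpha q (v ! (i - 1)) (v ! i) \<otimes> x v \<oplus> (if v ! (i - 1) = v ! i then \<zero> else x (sw i v))"
  by (rule G_op_eq[OF _ _ q_unit])

lemma alpha_closed' [simp]: "alpha q a b \<in> carrier K" by (rule alpha_closed[OF q_unit])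

lemma TP_I: "(\<And>w. x w \<in> carrier K) \<Longrightarrow> (\<And>w. w \<notin> words \<Longrightarrow> x w = \<zero>) \<Longrightarrow> x \<in> carrier TP"
  by (simp add: TP_carrier)

lemma TP_outside: "x \<in> carrier TP \<Longrightarrow> w \<notin> words \<Longrightarrow> x w = \<zero>"
  by (simp add: TP_carrier)

lemma TT_TP: "i \<in> {1..n} \<Longrightarrow> x \<in> carrier TP \<Longrightarrow> TT i x \<in> carrier TP"
  by (rule TP_I) (simp_all add: TT_eq TP_closed TP_outside \<xi>_closed)

lemma GG_TP: "i \<in> {1..<n} \<Longrightarrow> x \<in> carrier TP \<Longrightarrow> GG i x \<in> carrier TP"
  by (rule TP_I) (simp_all add: GG_eq TP_closed TP_outside sw_words_iff)

lemma End_I: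
  assumes "f \<in> extensional (carrier TP)" "\<And>x. x \<in> carrier TP \<Longrightarrow> f x \<in> carrier TP"
    "\<And>x y v. x \<in> carrier TP \<Longrightarrow> y \<in> carrier TP \<Longrightarrow> f (\<lambda>w. x w \<oplus> y w) v = f x v \<oplus> f y v"
    "\<And>c x v. c \<in> carrier K \<Longrightarrow> x \<in> carrier TP \<Longrightarrow> f (\<lambda>w. c \<otimes> x w) v = c \<otimes> f x v"
  shows "f \<in> carrier End"
  unfolding End_carrier PiE_def TP_sel using assms by (auto intro!: ext)

lemma TP_add: "x \<in> carrier TP \<Longrightarrow> y \<in> carrier TP \<Longrightarrow> (\<lambda>w. x w \<oplus> y w) \<in> carrier TP"
  and TP_smult: "c \<in> carrier K \<Longrightarrow> x \<in> carrier TP \<Longrightarrow> (\<lambda>w. c \<otimes> x w) \<in> carrier TP"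
  by (auto simp: TP_carrier)

lemma TT_End: "i \<in> {1..n} \<Longrightarrow> TT i \<in> carrier End"
proof (rule End_I)
  show "TT i \<in> extensional (carrier TP)" by (simp add: T_op_def Let_def linear_extension_def)
qed (simp_all add: TT_TP TT_eq TP_add TP_smult R.r_distr R.m_lcomm TP_closed \<xi>_closed)

lemma GG_End: "i \<in> {1..<n} \<Longrightarrow> GG i \<in> carrier End"
proof (rule End_I)
  show "GG i \<in> extensional (carrier TP)" by (simp add: G_op_def Let_def linear_extension_def)
qed (simp_all add: GG_TP GG_eq TP_add TP_smult R.r_distr R.m_lcomm R.a_ac TP_closed)

lemma TT_pow: "i \<in> {1..n} \<Longrightarrow> x \<in> carrier TP \<Longrightarrow> (TT i [^]\<^bsub>End\<^esub> (s::nat)) x v = (\<xi> [^] snd (v ! (i - 1))) [^] s \<otimes> x v"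
proof (induction s arbitrary: v)
  case 0
  then show ?case by (simp add: End_sel TP_closed)
next
  case (Suc s)
  note i = Suc.prems(1) and x = Suc.prems(2)
  have "(TT i [^]\<^bsub>End\<^esub> s) x \<in> carrier TP"
    by (rule End_apply[OF End.M.nat_pow_closed[OF TT_End[OF i]] x])
  then have "(TT i [^]\<^bsub>End\<^esub> Suc s) x v = \<xi> [^] snd (v ! (i - 1)) \<otimes> ((\<xi> [^] snd (v ! (i - 1))) [^] s \<otimes> x v)"
    unfolding End.M.nat_pow_Suc mult_apply[OF x] by (subst TT_eq[OF _ i]) (simp_all only: Suc.IH[OF i x])
  then show ?case using \<xi>_closed TP_closed[OF x] by (simp add: R.m_ac)
qed

lemma finsum_End: 
  assumes "f \<in> I \<rightarrow> carrier End" "x \<in> carrier TP"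
  shows "(\<Oplus>\<^bsub>End\<^esub>i\<in>I. f i) x = (\<Oplus>\<^bsub>TP\<^esub>i\<in>I. f i x)"
  using assms(1)
proof (induction I rule: infinite_finite_induct)
  case (insert i I)
  then have "f \<in> I \<rightarrow> carrier End" "f i \<in> carrier End" "(\<lambda>i. f i x) \<in> I \<rightarrow> carrier TP" "f i x \<in> carrier TP"
    using End_apply[OF _ assms(2)] by auto
  then show ?case using insert assms(2) by (simp add: End_sel)
qed (simp_all add: End_sel assms(2))

text \<open>By orthogonality of characters the element \<open>e\<close> acts as the projection onto
  the words that have equal colours in the two factors.\<close>

lemma torus_e_apply:
  assumes i: "i \<in> {1..n}" and j: "j \<in> {1..n}" and x: "x \<in> carrier TP" and v: "v \<in> words"
  shows "torus_e K End r (TT i) (TT j) x v = (if snd (v ! (i - 1)) = snd (v ! (j - 1)) then x v else \<zero>)"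
proof -
  let ?F = "\<lambda>s. TT i [^]\<^bsub>End\<^esub> s \<otimes>\<^bsub>End\<^esub> TT j [^]\<^bsub>End\<^esub> (r - s)"
  let ?a = "snd (v ! (i - 1))" and ?b = "snd (v ! (j - 1))"
  have F: "?F \<in> {..<r} \<rightarrow> carrier End" using TT_End[OF i] TT_End[OF j] by auto
  have S: "(\<Oplus>\<^bsub>End\<^esub>s\<in>{..<r}. ?F s) \<in> carrier End" by (rule End.M.finsum_closed[OF F])
  have "i - 1 < n" "j - 1 < n" using i j by auto
  from words_nth[OF v this(1)] words_nth[OF v this(2)] have ab: "?a < r" "?b < r"
    by (auto simp: letters_def mem_Times_iff)
  have Fv: "?F s x v = ((\<xi> [^] ?a) [^] s \<otimes> (\<xi> [^] ?b) [^] (r - s)) \<otimes> x v" for s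
  proof -
    have y: "(TT i [^]\<^bsub>End\<^esub> s) x \<in> carrier TP"
      by (rule End_apply[OF End.M.nat_pow_closed[OF TT_End[OF i]] x])
    show ?thesis unfolding mult_apply[OF x] TT_pow[OF j y] TT_pow[OF i x]
      using \<xi>_closed TP_closed[OF x] by (simp add: R.m_ac)
  qed
  have "(\<Oplus>\<^bsub>End\<^esub>s\<in>{..<r}. ?F s) x v = (\<Oplus>s\<in>{..<r}. ?F s x v)"
    unfolding finsum_End[OF F x] by (rule finsum_TP) (use F x End_apply in auto)
  also have "\<dots> = (\<Oplus>s\<in>{..<r}. (\<xi> [^] ?a) [^] s \<otimes> (\<xi> [^] ?b) [^] (r - s)) \<otimes> x v"
    unfolding Fv using \<xi>_closed TP_closed[OF x] by (intro R.finsum_ldistr[symmetric]) auto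
  also have "\<dots> = (if ?a = ?b then [r] \<cdot> \<one> else \<zero>) \<otimes> x v"
    unfolding root_sum[OF ab] by (rule refl)
  finally have e: "(\<Oplus>\<^bsub>End\<^esub>s\<in>{..<r}. ?F s) x v = (if ?a = ?b then [r] \<cdot> \<one> else \<zero>) \<otimes> x v" .
  have "torus_e K End r (TT i) (TT j) x v = inv ([r] \<cdot> \<one>) \<otimes> (\<Oplus>\<^bsub>End\<^esub>s\<in>{..<r}. ?F s) x v"
    unfolding torus_e_def using x by (simp add: End_sel TP_sel)
  also have "\<dots> = (if ?a = ?b then x v else \<zero>)"
    unfolding e using r_unit TP_closed[OF x] by (simp add: R.m_assoc[symmetric])
  finally show ?thesis .
qed

end

section \<open>The Yokonuma-Hecke relations for the operators\<close>

context tensor_rep begin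

abbreviation (input) z where "z \<equiv> q \<ominus> inv q"

lemma z_q: "q \<otimes> q = \<one> \<oplus> z \<otimes> q"
proof -
  have c: "q \<in> carrier K" "inv q \<in> carrier K" using q_unit by auto
  have "z \<otimes> q = q \<otimes> q \<ominus> inv q \<otimes> q" using c by algebra
  then show ?thesis using c q_unit by (simp add: R.minus_eq R.a_comm[of \<one>] R.a_assoc R.l_neg)
qed

text \<open>Distinct letters of one colour differ in the lower index, so exactly one of the two
  orders carries the diagonal entry \<open>z\<close>.\<close>

lemma alpha_sum: "a \<noteq> b \<Longrightarrow> alpha q a b \<oplus> alpha q b a = (if snd a = snd b then z else \<zero>)"
proof -
  assume "a \<noteq> b"
  moreover have "z \<in> carrier K" using q_unit by auto
  ultimately show ?thesis by (cases a; cases b) (auto simp: alpha_def)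
qed

text \<open>\<open>hop\<close> and \<open>hop'\<close> are \<open>\<^bold>G\<^sub>i\<close> and \<open>\<^bold>G\<^sub>i\<^sub>+\<^sub>1\<close> read on the coefficients as functions of the letters in
  the factors \<open>i, i + 1, i + 2\<close>.\<close>

definition hop :: "(nat \<times> nat \<Rightarrow> nat \<times> nat \<Rightarrow> nat \<times> nat \<Rightarrow> 'a) \<Rightarrow> nat \<times> nat \<Rightarrow> nat \<times> nat \<Rightarrow> nat \<times> nat \<Rightarrow> 'a" where
  "hop y a b c = alpha q a b \<otimes> y a b c \<oplus> (if a = b then \<zero> else y b a c)"

definition hop' :: "(nat \<times> nat \<Rightarrow> nat \<times> nat \<Rightarrow> nat \<times> nat \<Rightarrow> 'a) \<Rightarrow> nat \<times> nat \<Rightarrow> nat \<times> nat \<Rightarrow> nat \<times> nat \<Rightarrow> 'a" where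
  "hop' y a b c = alpha q b c \<otimes> y a b c \<oplus> (if b = c then \<zero> else y a c b)"

lemma alpha_same: "alpha q a a = q" by (simp add: alpha_def)

lemma alpha_neq: "a \<noteq> b \<Longrightarrow> alpha q a b = \<zero> \<or> alpha q a b = z"
  by (cases a; cases b) (auto simp: alpha_def)

text \<open>These are the identities obtained by comparing coefficients in the braid relation on
  three distinct letters. They come down to comparing the colours and the order of the lower
  indices.\<close>

lemma alpha_rel:
  assumes "a \<noteq> b" "b \<noteq> c" "a \<noteq> c"
  shows "alpha q a b \<otimes> alpha q b c \<oplus> alpha q a c \<otimes> alpha q b a = alpha q b c \<otimes> alpha q a c"
    "alpha q b c \<otimes> alpha q a b \<oplus> alpha q a c \<otimes> alpha q c b = alpha q a b \<otimes> alpha q a c"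
    "alpha q a b \<otimes> alpha q a b \<otimes> alpha q b c = alpha q b c \<otimes> alpha q b c \<otimes> alpha q a b"
proof -
  have "z \<in> carrier K" using q_unit by auto
  then show "alpha q a b \<otimes> alpha q b c \<oplus> alpha q a c \<otimes> alpha q b a = alpha q b c \<otimes> alpha q a c"
    "alpha q b c \<otimes> alpha q a b \<oplus> alpha q a c \<otimes> alpha q c b = alpha q a b \<otimes> alpha q a c"
    "alpha q a b \<otimes> alpha q a b \<otimes> alpha q b c = alpha q b c \<otimes> alpha q b c \<otimes> alpha q a b"
    using assms by (cases a; cases b; cases c; auto simp: alpha_def)+
qed

text \<open>The counterpart when two of the three letters coincide. The first identity is
  \<open>z_q\<close> multiplied by the diagonal entry; the second holds because at most one order of
  two distinct letters has a nonzero diagonal entry.\<close>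

lemma alpha_rel2:
  assumes "a \<noteq> b"
  shows "q \<otimes> q \<otimes> alpha q a b = alpha q a b \<oplus> q \<otimes> alpha q a b \<otimes> alpha q a b"
    "alpha q a b \<otimes> alpha q b a = \<zero>"
proof -
  have c: "z \<in> carrier K" "q \<in> carrier K" using q_unit by auto
  have "q \<otimes> q \<otimes> z = z \<oplus> q \<otimes> z \<otimes> z"
    unfolding z_q using c by (simp only: R.l_distr R.one_closed R.m_closed R.l_one R.m_ac)
  then show "q \<otimes> q \<otimes> alpha q a b = alpha q a b \<oplus> q \<otimes> alpha q a b \<otimes> alpha q a b"
    using alpha_neq[OF assms] c by auto
  show "alpha q a b \<otimes> alpha q b a = \<zero>"
    using assms c by (cases a; cases b) (auto simp: alpha_def)
qed

text \<open>Equal letters are never exchanged, so the shape of the two sides depends on which of the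
  three letters coincide. The cases \<open>ab\<close> and \<open>bc\<close> mirror each other under
  exchanging \<open>hop\<close> with \<open>hop'\<close> and share the computation
  \<open>eq_case\<close>.\<close>

lemma hop_braid:
  assumes y: "\<And>a b c. y a b c \<in> carrier K"
  shows "hop (hop' (hop y)) a b c = hop' (hop (hop' y)) a b c"
proof -
  have qc: "q \<in> carrier K" using q_unit by auto
  note cl = alpha_closed' y qc
  have eq_case: "q \<otimes> (B \<otimes> (q \<otimes> y1) \<oplus> (B \<otimes> y3 \<oplus> y4)) = B \<otimes> (q \<otimes> (B \<otimes> y1 \<oplus> y3)) \<oplus> (B \<otimes> (B' \<otimes> y3 \<oplus> y1) \<oplus> q \<otimes> y4)"
    if c: "B \<in> carrier K" "B' \<in> carrier K" "y1 \<in> carrier K" "y3 \<in> carrier K" "y4 \<in> carrier K"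
      and e: "q \<otimes> q \<otimes> B = B \<oplus> q \<otimes> B \<otimes> B" "B \<otimes> B' = \<zero>" for B B' y1 y3 y4
  proof -
    have "q \<otimes> (B \<otimes> (q \<otimes> y1) \<oplus> (B \<otimes> y3 \<oplus> y4)) = (q \<otimes> q \<otimes> B) \<otimes> y1 \<oplus> q \<otimes> B \<otimes> y3 \<oplus> q \<otimes> y4"
      using c qc by algebra
    also have "\<dots> = (B \<oplus> q \<otimes> B \<otimes> B) \<otimes> y1 \<oplus> q \<otimes> B \<otimes> y3 \<oplus> (B \<otimes> B') \<otimes> y3 \<oplus> q \<otimes> y4"
      unfolding e using c qc by simp
    also have "\<dots> = B \<otimes> (q \<otimes> (B \<otimes> y1 \<oplus> y3)) \<oplus> (B \<otimes> (B' \<otimes> y3 \<oplus> y1) \<oplus> q \<otimes> y4)"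
      using c qc by algebra
    finally show ?thesis .
  qed
  consider (all) "a = b" "b = c" | (ab) "a = b" "b \<noteq> c" | (bc) "b = c" "a \<noteq> b" | (ac) "a = c" "a \<noteq> b" | (d) "a \<noteq> b" "b \<noteq> c" "a \<noteq> c"
    by blast
  then show ?thesis
  proof cases
    case all
    then show ?thesis by (simp add: hop_def hop'_def cl)
  next
    case ab
    have "hop (hop' (hop y)) a b c = q \<otimes> (alpha q b c \<otimes> (q \<otimes> y b b c) \<oplus> (alpha q b c \<otimes> y b c b \<oplus> y c b b))"
      using ab by (simp add: hop_def hop'_def cl alpha_same)
    moreover have "hop' (hop (hop' y)) a b c = alpha q b c \<otimes> (q \<otimes> (alpha q b c \<otimes> y b b c \<oplus> y b c b)) \<oplus>
        (alpha q b c \<otimes> (alpha q c b \<otimes> y b c b \<oplus> y b b c) \<oplus> q \<otimes> y c b b)"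
      using ab by (simp add: hop_def hop'_def cl alpha_same)
    ultimately show ?thesis using eq_case[OF cl(1) cl(1) y y y alpha_rel2[OF ab(2)]] by simp
  next
    case bc
    have "hop' (hop (hop' y)) a b c = q \<otimes> (alpha q a b \<otimes> (q \<otimes> y a b b) \<oplus> (alpha q a b \<otimes> y b a b \<oplus> y b b a))"
      using bc by (simp add: hop_def hop'_def cl alpha_same)
    moreover have "hop (hop' (hop y)) a b c = alpha q a b \<otimes> (q \<otimes> (alpha q a b \<otimes> y a b b \<oplus> y b a b)) \<oplus>
        (alpha q a b \<otimes> (alpha q b a \<otimes> y b a b \<oplus> y a b b) \<oplus> q \<otimes> y b b a)"
      using bc by (simp add: hop_def hop'_def cl alpha_same)
    ultimately show ?thesis using eq_case[OF cl(1) cl(1) y y y alpha_rel2[OF bc(2)]] by simp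
  next
    case ac
    let ?A = "alpha q a b" and ?A' = "alpha q b a"
    have "hop (hop' (hop y)) a b c = ?A \<otimes> (?A' \<otimes> (?A \<otimes> y a b a \<oplus> y b a a) \<oplus> q \<otimes> y a a b) \<oplus> q \<otimes> (?A' \<otimes> y b a a \<oplus> y a b a)"
      using ac by (simp add: hop_def hop'_def cl alpha_same)
    also have "\<dots> = (?A \<otimes> ?A') \<otimes> (?A \<otimes> y a b a \<oplus> y b a a) \<oplus> ?A \<otimes> q \<otimes> y a a b \<oplus> q \<otimes> (?A' \<otimes> y b a a \<oplus> y a b a)"
      using cl(1)[of a b] cl(1)[of b a] y[of a b a] y[of b a a] y[of a a b] qc by algebra
    \<comment> \<open>The two sides differ only in the bracket multiplied by
      \<open>?A \<otimes> ?A'\<close>. This product is zero, so one bracket may be replaced by the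
      other.\<close>
    also have "\<dots> = (?A \<otimes> ?A') \<otimes> (?A' \<otimes> y a b a \<oplus> y a a b) \<oplus> ?A \<otimes> q \<otimes> y a a b \<oplus> q \<otimes> (?A' \<otimes> y b a a \<oplus> y a b a)"
      unfolding alpha_rel2(2)[OF ac(2)] by (simp add: cl)
    also have "\<dots> = ?A' \<otimes> (?A \<otimes> (?A' \<otimes> y a b a \<oplus> y a a b) \<oplus> q \<otimes> y b a a) \<oplus> q \<otimes> (?A \<otimes> y a a b \<oplus> y a b a)"
      using cl(1)[of a b] cl(1)[of b a] y[of a b a] y[of b a a] y[of a a b] qc by algebra
    also have "\<dots> = hop' (hop (hop' y)) a b c"
      using ac by (simp add: hop_def hop'_def cl alpha_same)
    finally show ?thesis .
  next
    case d
    \<comment> \<open>The three hypotheses \<open>e\<close> match the coefficients of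
      \<open>y2\<close>, \<open>y3\<close> and \<open>y1\<close>; the other terms agree
      directly.\<close>
    have gen: "A \<otimes> (B \<otimes> (A \<otimes> y1 \<oplus> y2) \<oplus> (C \<otimes> y3 \<oplus> y4)) \<oplus> (C \<otimes> (A' \<otimes> y2 \<oplus> y1) \<oplus> (B \<otimes> y5 \<oplus> y6))
       = B \<otimes> (A \<otimes> (B \<otimes> y1 \<oplus> y3) \<oplus> (C \<otimes> y2 \<oplus> y5)) \<oplus> (C \<otimes> (B' \<otimes> y3 \<oplus> y1) \<oplus> (A \<otimes> y4 \<oplus> y6))"
      if c: "A \<in> carrier K" "A' \<in> carrier K" "B \<in> carrier K" "B' \<in> carrier K" "C \<in> carrier K" 
         "y1 \<in> carrier K" "y2 \<in> carrier K" "y3 \<in> carrier K" "y4 \<in> carrier K" "y5 \<in> carrier K" "y6 \<in> carrier K"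
        and e: "A \<otimes> B \<oplus> C \<otimes> A' = B \<otimes> C" "B \<otimes> A \<oplus> C \<otimes> B' = A \<otimes> C" "A \<otimes> A \<otimes> B = B \<otimes> B \<otimes> A" for A A' B B' C y1 y2 y3 y4 y5 y6
    proof -
      have "A \<otimes> (B \<otimes> (A \<otimes> y1 \<oplus> y2) \<oplus> (C \<otimes> y3 \<oplus> y4)) \<oplus> (C \<otimes> (A' \<otimes> y2 \<oplus> y1) \<oplus> (B \<otimes> y5 \<oplus> y6))
        = (A \<otimes> A \<otimes> B) \<otimes> y1 \<oplus> (A \<otimes> B \<oplus> C \<otimes> A') \<otimes> y2 \<oplus> (A \<otimes> C) \<otimes> y3 \<oplus> C \<otimes> y1 \<oplus> A \<otimes> y4 \<oplus> B \<otimes> y5 \<oplus> y6"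
        using c by algebra
      also have "\<dots> = (B \<otimes> B \<otimes> A) \<otimes> y1 \<oplus> (B \<otimes> C) \<otimes> y2 \<oplus> (B \<otimes> A \<oplus> C \<otimes> B') \<otimes> y3 \<oplus> C \<otimes> y1 \<oplus> A \<otimes> y4 \<oplus> B \<otimes> y5 \<oplus> y6"
        unfolding e by (rule refl)
      also have "\<dots> = B \<otimes> (A \<otimes> (B \<otimes> y1 \<oplus> y3) \<oplus> (C \<otimes> y2 \<oplus> y5)) \<oplus> (C \<otimes> (B' \<otimes> y3 \<oplus> y1) \<oplus> (A \<otimes> y4 \<oplus> y6))"
        using c by algebra
      finally show ?thesis .
    qed
    note neq = d d[symmetric]
    have L: "hop (hop' (hop y)) a b c = alpha q a b \<otimes> (alpha q b c \<otimes> (alpha q a b \<otimes> y a b c \<oplus> y b a c) \<oplus> (alpha q a c \<otimes> y a c b \<oplus> y c a b)) \<oplus>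
       (alpha q a c \<otimes> (alpha q b a \<otimes> y b a c \<oplus> y a b c) \<oplus> (alpha q b c \<otimes> y b c a \<oplus> y c b a))"
      by (simp add: hop_def hop'_def neq)
    have R: "hop' (hop (hop' y)) a b c = alpha q b c \<otimes> (alpha q a b \<otimes> (alpha q b c \<otimes> y a b c \<oplus> y a c b) \<oplus> (alpha q a c \<otimes> y b a c \<oplus> y b c a)) \<oplus>
       (alpha q a c \<otimes> (alpha q c b \<otimes> y a c b \<oplus> y a b c) \<oplus> (alpha q a b \<otimes> y c a b \<oplus> y c b a))"
      by (simp add: hop_def hop'_def neq)
    show ?thesis unfolding L R by (rule gen[OF cl(1) cl(1) cl(1) cl(1) cl(1) y y y y y y alpha_rel[OF d]])
  qed
qed

definition upd3 :: "nat \<Rightarrow> (nat \<times> nat) list \<Rightarrow> nat \<times> nat \<Rightarrow> nat \<times> nat \<Rightarrow> nat \<times> nat \<Rightarrow> (nat \<times> nat) list" where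
  "upd3 i v a b c = v[i - 1 := a, i := b, Suc i := c]"

text \<open>With the remaining letters frozen to those of \<open>v\<close>, two neighbouring
  operators act on functions of three letters. The braid relation on words of any length is thereby
  reduced to \<open>hop_braid\<close>.\<close>

lemma GG_upd3:
  assumes x: "x \<in> carrier TP" and i: "i \<in> {1..<n}" "Suc i \<in> {1..<n}" and v: "length v = n"
  shows "(\<lambda>a b c. GG i x (upd3 i v a b c)) = hop (\<lambda>a b c. x (upd3 i v a b c))"
    "(\<lambda>a b c. GG (Suc i) x (upd3 i v a b c)) = hop' (\<lambda>a b c. x (upd3 i v a b c))"
proof -
  have n: "upd3 i v a b c ! (i - 1) = a" "upd3 i v a b c ! i = b" "upd3 i v a b c ! (Suc i) = c" for a b c
    using i v by (auto simp: upd3_def nth_list_update)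
  have s: "sw i (upd3 i v a b c) = upd3 i v b a c" "sw (Suc i) (upd3 i v a b c) = upd3 i v a c b" for a b c
    using i v unfolding sw_def n by (auto simp: n upd3_def list_eq_iff_nth_eq nth_list_update)
  show "(\<lambda>a b c. GG i x (upd3 i v a b c)) = hop (\<lambda>a b c. x (upd3 i v a b c))"
    by (intro ext) (simp add: GG_eq[OF x i(1)] n[unfolded One_nat_def] s hop_def)
  show "(\<lambda>a b c. GG (Suc i) x (upd3 i v a b c)) = hop' (\<lambda>a b c. x (upd3 i v a b c))"
    by (intro ext) (simp add: GG_eq[OF x i(2)] n s hop'_def)
qed

lemma GG_braid:
  assumes x: "x \<in> carrier TP" and i: "i \<in> {1..<n}" "Suc i \<in> {1..<n}" and v: "v \<in> words"
  shows "GG i (GG (Suc i) (GG i x)) v = GG (Suc i) (GG i (GG (Suc i) x)) v"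
proof -
  have l: "length v = n" using v by (simp add: words_def)
  \<comment> \<open>Writing \<open>v\<close> as its own update recovers it from the identity proved
    for arbitrary three letters.\<close>
  have vu: "v = upd3 i v (v ! (i - 1)) (v ! i) (v ! Suc i)"
    by (simp add: upd3_def)
  note c = GG_TP[OF i(1)] GG_TP[OF i(2)]
  let ?y = "\<lambda>a b c. x (upd3 i v a b c)"
  have y: "?y a b c \<in> carrier K" for a b c by (rule TP_closed[OF x])
  have 1: "(\<lambda>a b c. GG i (GG (Suc i) (GG i x)) (upd3 i v a b c)) = hop (hop' (hop ?y))"
    by (simp only: GG_upd3[OF _ i l] c x)
  have 2: "(\<lambda>a b c. GG (Suc i) (GG i (GG (Suc i) x)) (upd3 i v a b c)) = hop' (hop (hop' ?y))"
    by (simp only: GG_upd3[OF _ i l] c x)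
  from fun_cong[OF fun_cong[OF fun_cong[OF 1]]] fun_cong[OF fun_cong[OF fun_cong[OF 2]]] hop_braid[of ?y, OF y]
  have "GG i (GG (Suc i) (GG i x)) (upd3 i v a b c) = GG (Suc i) (GG i (GG (Suc i) x)) (upd3 i v a b c)" for a b c by simp
  from this[of "v ! (i - 1)" "v ! i" "v ! Suc i"] show ?thesis unfolding vu[symmetric] .
qed

lemma TP_eqI:
  assumes "x \<in> carrier TP" "y \<in> carrier TP" "\<And>v. v \<in> words \<Longrightarrow> x v = y v"
  shows "x = y"
proof
  fix v show "x v = y v" using assms by (cases "v \<in> words") (auto simp: TP_outside)
qed

lemma End_TP_eqI:
  assumes f: "f \<in> carrier End" and g: "g \<in> carrier End" and e: "\<And>x v. x \<in> carrier TP \<Longrightarrow> v \<in> words \<Longrightarrow> f x v = g x v"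
  shows "f = g"
  by (rule End_eqI[OF f g]) (rule TP_eqI[OF End_apply[OF f] End_apply[OF g] e])

lemma GG_far:
  assumes x: "x \<in> carrier TP" and i: "i \<in> {1..<n}" "j \<in> {1..<n}" and ij: "\<bar>int i - int j\<bar> > 1" and v: "v \<in> words"
  shows "GG i (GG j x) v = GG j (GG i x) v"
proof -
  have l: "length v = n" using v by (simp add: words_def)
  have ne: "i - 1 \<noteq> j - 1" "i - 1 \<noteq> j" "i \<noteq> j - 1" "i \<noteq> j" using ij i by auto
  have n: "sw i v ! (j - 1) = v ! (j - 1)" "sw i v ! j = v ! j" "sw j v ! (i - 1) = v ! (i - 1)" "sw j v ! i = v ! i"
    using ne by (auto simp: sw_def)
  have s: "sw i (sw j v) = sw j (sw i v)"
    unfolding sw_def[of i "sw j v"] sw_def[of j "sw i v"] n using ne l i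
    by (auto simp: sw_def list_eq_iff_nth_eq nth_list_update)
  let ?a = "alpha q (v ! (i - 1)) (v ! i)" and ?b = "alpha q (v ! (j - 1)) (v ! j)"
  have c: "?a \<in> carrier K" "?b \<in> carrier K" "x u \<in> carrier K" for u using TP_closed[OF x] by auto
  show ?thesis
    unfolding GG_eq[OF GG_TP[OF i(2) x] i(1)] GG_eq[OF GG_TP[OF i(1) x] i(2)] GG_eq[OF x i(1)] GG_eq[OF x i(2)] n s
    using c by (auto simp: R.r_distr R.m_ac R.a_ac)
qed

lemma GG_TT:
  assumes x: "x \<in> carrier TP" and i: "i \<in> {1..<n}" and j: "j \<in> {1..n}" and v: "v \<in> words"
  shows "GG i (TT j x) v = TT (transpose i (Suc i) j) (GG i x) v"
proof -
  let ?k = "transpose i (Suc i) j"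
  have k: "?k \<in> {1..n}" using i j by (auto simp: transpose_def)
  have l: "length v = n" using v by (simp add: words_def)
  have s: "sw i v ! (j - 1) = v ! (?k - 1)" using l i j by (auto simp: sw_def transpose_def nth_list_update)
  let ?a = "alpha q (v ! (i - 1)) (v ! i)"
  \<comment> \<open>The diagonal term survives only if the letters in factors \<open>i\<close> and
    \<open>i + 1\<close> have equal colours, and then both torus operators multiply by the same
    power of \<open>\<xi>\<close>.\<close>
  have a: "?a = \<zero> \<or> snd (v ! (j - 1)) = snd (v ! (?k - 1))"
    using i by (auto simp: alpha_def transpose_def)
  have c: "?a \<in> carrier K" "x u \<in> carrier K" for u using TP_closed[OF x] by auto
  show ?thesis
    unfolding GG_eq[OF TT_TP[OF j x] i] TT_eq[OF GG_TP[OF i x] k] GG_eq[OF x i] TT_eq[OF x j] s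
    using a c \<xi>_closed by (auto simp: R.r_distr R.m_ac)
qed

text \<open>For equal letters this is \<open>z_q\<close>. For distinct letters of one colour the
  diagonal entries add up to \<open>z\<close> and \<open>e\<close> acts as the identity. For
  different colours the operator is a plain exchange of square one, and \<open>e\<close> annihilates
  the correction.\<close>

lemma GG_quad:
  assumes x: "x \<in> carrier TP" and i: "i \<in> {1..<n}" and v: "v \<in> words"
  shows "GG i (GG i x) v = x v \<oplus> z \<otimes> GG i (torus_e K End r (TT i) (TT (Suc i)) x) v"
proof -
  have l: "length v = n" using v by (simp add: words_def)
  have i': "i \<in> {1..n}" "Suc i \<in> {1..n}" using i by auto
  let ?E = "torus_e K End r (TT i) (TT (Suc i))"
  have E: "?E x \<in> carrier TP"
    by (rule End_apply[OF End.torus_e_closed[OF r_unit TT_End[OF i'(1)] TT_End[OF i'(2)]] x])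
  have n: "sw i v ! (i - 1) = v ! i" "sw i v ! i = v ! (i - 1)" "sw i (sw i v) = v"
    using l i sw_sw[of i v] by (auto simp: sw_def nth_list_update)
  note Ev = torus_e_apply[OF i' x, unfolded diff_Suc_1]
  let ?a = "v ! (i - 1)" and ?b = "v ! i"
  have qc: "q \<in> carrier K" "z \<in> carrier K" using q_unit by auto
  have c: "x u \<in> carrier K" for u using TP_closed[OF x] by auto
  note ex = GG_eq[OF GG_TP[OF i x] i] GG_eq[OF E i] GG_eq[OF x i] n Ev[OF v] Ev[OF sw_words[OF v i]]
  show ?thesis
  proof (cases "?a = ?b")
    case True
    have "q \<otimes> (q \<otimes> x v) = x v \<oplus> z \<otimes> (q \<otimes> x v)"
      using arg_cong[OF z_q, of "\<lambda>u. u \<otimes> x v"] qc c by (simp add: R.l_distr R.m_assoc)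
    then show ?thesis unfolding ex using True c qc by (simp add: alpha_same)
  next
    case False
    let ?A = "alpha q ?a ?b" and ?B = "alpha q ?b ?a"
    have "?A \<otimes> (?A \<otimes> x v \<oplus> x (sw i v)) \<oplus> (?B \<otimes> x (sw i v) \<oplus> x v) = 
       (?A \<otimes> ?A) \<otimes> x v \<oplus> (?A \<oplus> ?B) \<otimes> x (sw i v) \<oplus> x v"
      using c[of v] c[of "sw i v"] alpha_closed'[of ?a ?b] alpha_closed'[of ?b ?a] by algebra
    also have "?A \<otimes> ?A = z \<otimes> ?A" using alpha_neq[OF False] qc by auto
    also have "?A \<oplus> ?B = (if snd ?a = snd ?b then z else \<zero>)" by (rule alpha_sum[OF False])
    finally have 1: "?A \<otimes> (?A \<otimes> x v \<oplus> x (sw i v)) \<oplus> (?B \<otimes> x (sw i v) \<oplus> x v) =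
       z \<otimes> ?A \<otimes> x v \<oplus> (if snd ?a = snd ?b then z else \<zero>) \<otimes> x (sw i v) \<oplus> x v" .
    have 2: "?A = \<zero>" if "snd ?a \<noteq> snd ?b" using that by (simp add: alpha_def)
    show ?thesis
    proof (cases "snd ?a = snd ?b")
      case True
      have "z \<otimes> ?A \<otimes> x v \<oplus> z \<otimes> x (sw i v) \<oplus> x v = x v \<oplus> z \<otimes> (?A \<otimes> x v \<oplus> x (sw i v))"
        using c[of v] c[of "sw i v"] alpha_closed'[of ?a ?b] qc(2) by (simp add: R.r_distr R.m_ac R.a_ac)
      then show ?thesis unfolding ex using True False 1 by simp
    next
      case False': False
      show ?thesis unfolding ex using False False' 1 2[OF False'] c qc by simp
    qed
  qed
qed

lemma yh_rel_ops: "yh_rel K End q r n TT GG"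
  unfolding yh_rel_def
proof (intro conjI ballI impI)
  fix i assume i: "i \<in> {1..n}"
  have pw: "(\<xi> [^] k) [^] r = \<one>" for k :: nat
    using \<xi>_closed \<xi>_pow by (metis R.nat_pow_one R.nat_pow_pow mult.commute)
  show "TT i [^]\<^bsub>End\<^esub> r = \<one>\<^bsub>End\<^esub>"
  proof (rule End_TP_eqI)
    fix x v assume x: "x \<in> carrier TP"
    show "(TT i [^]\<^bsub>End\<^esub> r) x v = \<one>\<^bsub>End\<^esub> x v"
      unfolding TT_pow[OF i x] pw using x by (simp add: End_sel TP_closed)
  qed (use TT_End[OF i] in auto)
  fix j assume j: "j \<in> {1..n}"
  show "TT i \<otimes>\<^bsub>End\<^esub> TT j = TT j \<otimes>\<^bsub>End\<^esub> TT i"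
    by (rule End_TP_eqI) 
      (use i j \<xi>_closed TT_End[OF i] TT_End[OF j] in \<open>simp_all add: mult_apply TT_eq TT_TP R.m_lcomm TP_closed\<close>)
next
  fix i j assume i: "i \<in> {1..<n}" and j: "j \<in> {1..n}"
  have k: "transpose i (Suc i) j \<in> {1..n}" using i j by (auto simp: transpose_def)
  show "TT j \<otimes>\<^bsub>End\<^esub> GG i = GG i \<otimes>\<^bsub>End\<^esub> TT (transpose i (Suc i) j)"
    by (rule End_TP_eqI) 
     (use GG_End[OF i] TT_End[OF j] TT_End[OF k] GG_TT[OF _ i j] in \<open>auto simp: mult_apply\<close>)
next
  fix i j assume i: "i \<in> {1..<n}" and j: "j \<in> {1..<n}" and ij: "\<bar>int i - int j\<bar> > 1"
  show "GG i \<otimes>\<^bsub>End\<^esub> GG j = GG j \<otimes>\<^bsub>End\<^esub> GG i"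
    by (rule End_TP_eqI) (use GG_End[OF i] GG_End[OF j] GG_far[OF _ i j ij] in \<open>auto simp: mult_apply\<close>)
next
  fix i assume i: "i \<in> {1..<n}" "Suc i \<in> {1..<n}"
  show "GG i \<otimes>\<^bsub>End\<^esub> GG (Suc i) \<otimes>\<^bsub>End\<^esub> GG i = GG (Suc i) \<otimes>\<^bsub>End\<^esub> GG i \<otimes>\<^bsub>End\<^esub> GG (Suc i)"
  proof (rule End_TP_eqI)
    fix x v assume x: "x \<in> carrier TP" and v: "v \<in> words"
    show "(GG i \<otimes>\<^bsub>End\<^esub> GG (Suc i) \<otimes>\<^bsub>End\<^esub> GG i) x v = (GG (Suc i) \<otimes>\<^bsub>End\<^esub> GG i \<otimes>\<^bsub>End\<^esub> GG (Suc i)) x v"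
      unfolding mult_apply[OF x] by (rule GG_braid[OF x i v])
  qed (use GG_End[OF i(1)] GG_End[OF i(2)] in auto)
next
  fix i assume i: "i \<in> {1..<n}"
  then have i': "i \<in> {1..n}" "Suc i \<in> {1..n}" by auto
  let ?E = "torus_e K End r (TT i) (TT (Suc i))"
  have E: "?E \<in> carrier End" by (rule End.torus_e_closed[OF r_unit TT_End[OF i'(1)] TT_End[OF i'(2)]])
  have z: "z \<in> carrier K" using q_unit by auto
  show "GG i \<otimes>\<^bsub>End\<^esub> GG i = \<one>\<^bsub>End\<^esub> \<oplus>\<^bsub>End\<^esub> z \<odot>\<^bsub>End\<^esub> (?E \<otimes>\<^bsub>End\<^esub> GG i)"
  proof (rule End_TP_eqI)
    fix x v assume x: "x \<in> carrier TP" and v: "v \<in> words"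
    show "(GG i \<otimes>\<^bsub>End\<^esub> GG i) x v = (\<one>\<^bsub>End\<^esub> \<oplus>\<^bsub>End\<^esub> z \<odot>\<^bsub>End\<^esub> (?E \<otimes>\<^bsub>End\<^esub> GG i)) x v"
      unfolding mult_apply[OF x] GG_quad[OF x i v] using x by (simp add: End_sel(1,2,4,5) TP_sel mult_apply)
  qed (use GG_End[OF i] E z in auto)
qed

end

section \<open>Injectivity\<close>

locale tensor_rep_inj = tensor_rep K r n q \<xi> + Y: yh_alg_gen K A q r n t g
  for K :: "'b ring" (structure) and r n q \<xi> and A :: "('b, 'a) module" and t g +
  fixes \<rho>
  assumes \<rho>_hom: "\<rho> \<in> ring_hom A (End_algebra K (tensor_power K r n n))"
    and \<rho>_smult: "c \<in> carrier K \<Longrightarrow> x \<in> carrier A \<Longrightarrow> \<rho> (c \<odot>\<^bsub>A\<^esub> x) = c \<odot>\<^bsub>End_algebra K (tensor_power K r n n)\<^esub> \<rho> x"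
    and \<rho>_t: "i \<in> {1..n} \<Longrightarrow> \<rho> (t i) = T_op K \<xi> r n i"
    and \<rho>_g: "i \<in> {1..<n} \<Longrightarrow> \<rho> (g i) = G_op K q r n i"
begin

sublocale \<rho>: ring_hom_ring A End \<rho>
  by unfold_locales (rule \<rho>_hom)

lemma \<rho>_apply: "x \<in> carrier A \<Longrightarrow> v \<in> carrier TP \<Longrightarrow> \<rho> x v \<in> carrier TP"
  by (rule End_apply) auto

lemma \<rho>_mult: "x \<in> carrier A \<Longrightarrow> y \<in> carrier A \<Longrightarrow> v \<in> carrier TP \<Longrightarrow> \<rho> (x \<otimes>\<^bsub>A\<^esub> y) v = \<rho> y (\<rho> x v)"
  by (simp add: mult_apply)

text \<open>The order of the right action: the coefficient \<open>h i\<close> acts first and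
  \<open>N i\<close> afterwards. The induction can therefore describe the coefficient on the
  original tensor before the word is applied.\<close>

lemma \<rho>_comb:
  assumes h: "h \<in> I \<rightarrow> carrier A" and N: "N \<in> I \<rightarrow> carrier A" and u: "u \<in> carrier TP"
  shows "\<rho> (\<Oplus>\<^bsub>A\<^esub>i\<in>I. h i \<otimes>\<^bsub>A\<^esub> N i) u v = (\<Oplus>i\<in>I. \<rho> (N i) (\<rho> (h i) u) v)"
proof -
  have hN: "h i \<in> carrier A" "N i \<in> carrier A" if "i \<in> I" for i using h N that by auto
  have 1: "(\<lambda>i. h i \<otimes>\<^bsub>A\<^esub> N i) \<in> I \<rightarrow> carrier A" using hN by auto
  have 2: "(\<lambda>i. \<rho> (h i \<otimes>\<^bsub>A\<^esub> N i)) \<in> I \<rightarrow> carrier End" using hN by (auto intro!: \<rho>.hom_closed)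
  have "\<rho> (\<Oplus>\<^bsub>A\<^esub>i\<in>I. h i \<otimes>\<^bsub>A\<^esub> N i) u v = (\<Oplus>i\<in>I. \<rho> (h i \<otimes>\<^bsub>A\<^esub> N i) u v)"
    unfolding \<rho>.hom_finsum[OF 1] o_def finsum_End[OF 2 u]
    by (rule finsum_TP) (use hN u in \<open>auto intro!: \<rho>_apply\<close>)
  also have "\<dots> = (\<Oplus>i\<in>I. \<rho> (N i) (\<rho> (h i) u) v)"
  proof (intro R.finsum_cong')
    fix i assume i: "i \<in> I"
    show "\<rho> (h i \<otimes>\<^bsub>A\<^esub> N i) u v = \<rho> (N i) (\<rho> (h i) u) v" by (simp only: \<rho>_mult[OF hN[OF i] u])
  qed (use hN u in \<open>auto intro!: TP_closed \<rho>_apply\<close>)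
  finally show ?thesis .
qed

text \<open>The first components strictly decrease, so a product \<open>g\<^sub>m \<cdots> g\<^sub>m\<^sub>-\<^sub>d\<^sub>+\<^sub>1\<close> only meets the branches
  of \<open>\<^bold>G\<close> that are plain swaps.\<close>

definition W :: "(nat \<Rightarrow> nat) \<Rightarrow> (nat \<times> nat) list" where
  "W c = map (\<lambda>k. (n - k, c k)) [0..<n]"

definition colouring :: "(nat \<Rightarrow> nat) \<Rightarrow> bool" where
  "colouring c \<longleftrightarrow> (\<forall>k. c k < r)"

lemma W_words: "colouring c \<Longrightarrow> W c \<in> words"
  by (auto simp: words_def W_def letters_def colouring_def)

lemma W_nth: "k < n \<Longrightarrow> W c ! k = (n - k, c k)" by (simp add: W_def)

lemma length_W: "length (W c) = n" by (simp add: W_def)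

abbreviation u where "u c \<equiv> delta (W c)"

lemma u_closed: "colouring c \<Longrightarrow> u c \<in> carrier TP"
  by (intro delta_closed W_words)

text \<open>The scalar by which \<open>x\<close> acts depends only on the first \<open>k\<close>
  colours, and this makes the induction work. For a sum over powers of the next generator, varying
  the next colour alone keeps the scalars of the coefficients fixed, so \<open>fourier_inj\<close>
  shows that each of them vanishes; by induction so do the coefficients.\<close>

lemma torus_diag:
  assumes "k \<le> n" "x \<in> Y.D k"
  shows "\<exists>\<epsilon>. (\<forall>c. \<epsilon> c \<in> carrier K) \<and> (\<forall>c v. colouring c \<longrightarrow> \<rho> x (u c) v = \<epsilon> c \<otimes> u c v) \<and>
     (\<forall>c c'. (\<forall>i<k. c i = c' i) \<longrightarrow> \<epsilon> c = \<epsilon> c') \<and> ((\<forall>c. colouring c \<longrightarrow> \<epsilon> c = \<zero>) \<longrightarrow> x = \<zero>\<^bsub>A\<^esub>)"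
  using assms
proof (induction k arbitrary: x)
  case 0
  then obtain a where a: "a \<in> carrier K" "x = a \<odot>\<^bsub>A\<^esub> \<one>\<^bsub>A\<^esub>" by auto
  have "colouring (\<lambda>_. 0)" using Y.r_pos by (simp add: colouring_def)
  moreover have "\<rho> x (u c) v = a \<otimes> u c v" if "colouring c" for c v
    unfolding a(2) \<rho>_smult[OF a(1) Y.M.one_closed] using u_closed[OF that] by (simp add: End_sel TP_sel)
  ultimately show ?case using a by (intro exI[of _ "\<lambda>_. a"]) auto
next
  case (Suc k)
  have k: "k < n" "Suc k \<in> {1..n}" "k \<le> n" using Suc.prems by auto
  from Suc.prems(2) obtain h where h: "h \<in> {..<r} \<rightarrow> Y.D k" and x: "x = (\<Oplus>\<^bsub>A\<^esub>s\<in>{..<r}. h s \<otimes>\<^bsub>A\<^esub> t (Suc k) [^]\<^bsub>A\<^esub> s)"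
    by (auto simp: Y.comb_def)
  \<comment> \<open>A name for the induction hypothesis, so that scalar functions can be chosen for
    all exponents at once.\<close>
  define ok where "ok s \<epsilon> \<longleftrightarrow> (\<forall>c. \<epsilon> c \<in> carrier K) \<and> (\<forall>c v. colouring c \<longrightarrow> \<rho> (h s) (u c) v = \<epsilon> c \<otimes> u c v) \<and>
     (\<forall>c c'. (\<forall>i<k. c i = c' i) \<longrightarrow> \<epsilon> c = \<epsilon> c') \<and> ((\<forall>c. colouring c \<longrightarrow> \<epsilon> c = \<zero>) \<longrightarrow> h s = \<zero>\<^bsub>A\<^esub>)" for s \<epsilon>
  have "\<forall>s\<in>{..<r}. \<exists>\<epsilon>. ok s \<epsilon>" unfolding ok_def using Suc.IH[OF k(3)] h by (auto simp: Pi_iff)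
  then obtain E where E: "\<And>s. s < r \<Longrightarrow> ok s (E s)" by (metis lessThan_iff)
  have tc: "t (Suc k) \<in> carrier A" by (rule Y.t_closed[OF k(2)])
  have hc: "h s \<in> carrier A" if "s < r" for s using h that Y.subD(1)[OF Y.sub_D[OF k(3)]] by auto
  have Ec: "E s c \<in> carrier K" if "s < r" for s c using E[OF that] by (auto simp: ok_def)
  define \<epsilon> where "\<epsilon> c = (\<Oplus>s\<in>{..<r}. E s c \<otimes> (\<xi> [^] c k) [^] s)" for c
  have ec: "\<epsilon> c \<in> carrier K" for c unfolding \<epsilon>_def using Ec \<xi>_closed by (intro R.finsum_closed) auto
  have uc: "u c v \<in> carrier K" for c v by (simp add: delta_def)
  have act: "\<rho> x (u c) v = \<epsilon> c \<otimes> u c v" if c: "colouring c" for c v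
  proof -
    have "\<rho> x (u c) v = (\<Oplus>s\<in>{..<r}. \<rho> (t (Suc k) [^]\<^bsub>A\<^esub> s) (\<rho> (h s) (u c)) v)"
      unfolding x by (rule \<rho>_comb) (use hc tc u_closed[OF c] in auto)
    also have "\<dots> = (\<Oplus>s\<in>{..<r}. E s c \<otimes> (\<xi> [^] c k) [^] s \<otimes> u c v)"
    proof (intro R.finsum_cong')
      fix s assume "s \<in> {..<r}"
      then have s: "s < r" by simp
      have y: "\<rho> (h s) (u c) \<in> carrier TP" by (rule \<rho>_apply[OF hc[OF s] u_closed[OF c]])
      have "\<rho> (t (Suc k) [^]\<^bsub>A\<^esub> s) (\<rho> (h s) (u c)) v = (\<xi> [^] snd (v ! k)) [^] s \<otimes> \<rho> (h s) (u c) v"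
        unfolding \<rho>.hom_nat_pow[OF tc] \<rho>_t[OF k(2)] TT_pow[OF k(2) y] by simp
      also have "\<rho> (h s) (u c) v = E s c \<otimes> u c v" using E[OF s] c by (simp add: ok_def)
      also have "(\<xi> [^] snd (v ! k)) [^] s \<otimes> (E s c \<otimes> u c v) = E s c \<otimes> (\<xi> [^] c k) [^] s \<otimes> u c v"
        using Ec[OF s] \<xi>_closed k(1) by (auto simp: delta_def W_nth R.m_ac)
      finally show "\<rho> (t (Suc k) [^]\<^bsub>A\<^esub> s) (\<rho> (h s) (u c)) v = E s c \<otimes> (\<xi> [^] c k) [^] s \<otimes> u c v" .
    qed (use Ec \<xi>_closed uc in auto)
    also have "\<dots> = \<epsilon> c \<otimes> u c v"
      unfolding \<epsilon>_def using Ec \<xi>_closed uc by (intro R.finsum_ldistr[symmetric]) auto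
    finally show ?thesis .
  qed
  have loc: "E s c = E s c'" if "s < r" "\<And>i. i < k \<Longrightarrow> c i = c' i" for s c c'
    using E[OF that(1)] that(2) unfolding ok_def by blast
  have dep: "\<epsilon> c = \<epsilon> c'" if "\<forall>i<Suc k. c i = c' i" for c c'
    unfolding \<epsilon>_def using that Ec \<xi>_closed loc[of _ c c'] by (intro R.finsum_cong') auto
  have "x = \<zero>\<^bsub>A\<^esub>" if z: "\<forall>c. colouring c \<longrightarrow> \<epsilon> c = \<zero>"
  proof -
    have "h s = \<zero>\<^bsub>A\<^esub>" if s: "s < r" for s
    proof -
      have "E s c = \<zero>" if c: "colouring c" for c
      proof (rule fourier_inj[OF _ _ s, of "\<lambda>s. E s c"])
        show "(\<lambda>s. E s c) \<in> {..<r} \<rightarrow> carrier K" using Ec by auto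
        fix a assume a: "a < r"
        \<comment> \<open>Only the colour at position \<open>k\<close> changes. The functions
          \<open>E s\<close> depend on earlier colours, so the equations for varying
          \<open>a\<close> have the same coefficients.\<close>
        let ?c = "c(k := a)"
        have "colouring ?c" using c a by (auto simp: colouring_def)
        then have "\<zero> = \<epsilon> ?c" using z by simp
        also have "\<dots> = (\<Oplus>s\<in>{..<r}. E s c \<otimes> (\<xi> [^] a) [^] s)"
          unfolding \<epsilon>_def using Ec \<xi>_closed loc[of _ ?c c] by (intro R.finsum_cong') auto
        finally show "(\<Oplus>s\<in>{..<r}. E s c \<otimes> (\<xi> [^] a) [^] s) = \<zero>" by simp
      qed
      then show ?thesis using E[OF s] by (simp add: ok_def)
    qed
    then show ?thesis unfolding x using tc by (intro Y.M.add.finprod_one_eqI) auto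
  qed
  then show ?case using ec act dep by (intro exI[of _ \<epsilon>]) blast
qed

text \<open>The rearrangements of \<open>W c\<close> that move only the first \<open>m + 1\<close>
  letters. They bound the support of everything that \<open>H m\<close> can produce from
  \<open>u c\<close>.\<close>

definition Pm :: "nat \<Rightarrow> (nat \<Rightarrow> nat) \<Rightarrow> (nat \<times> nat) list set" where
  "Pm m c = {v. length v = n \<and> mset (take (Suc m) v) = mset (take (Suc m) (W c)) \<and> drop (Suc m) v = drop (Suc m) (W c)}"

lemma Pm_distinct:
  assumes "v \<in> Pm m c" "m < n" "i \<le> m" "j \<le> m" "i \<noteq> j"
  shows "v ! i \<noteq> v ! j"
proof -
  have "distinct (W c)" by (auto simp: W_def distinct_map inj_on_def)
  then have "distinct (take (Suc m) (W c))" by simp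
  then have "distinct (take (Suc m) v)" using assms(1) mset_eq_imp_distinct_iff by (auto simp: Pm_def)
  then have "take (Suc m) v ! i \<noteq> take (Suc m) v ! j"
    using assms by (subst nth_eq_iff_index_eq) (auto simp: Pm_def)
  then show ?thesis using assms by simp
qed

text \<open>Lower indices decrease along \<open>W c\<close>, so the letter at position
  \<open>m\<close> has the smallest one, \<open>n - m\<close>, among the first \<open>m + 1\<close>
  letters; rearranging does not alter this set.\<close>

lemma Pm_fst:
  assumes "v \<in> Pm m c" "m < n" "i \<le> m" "v ! i \<noteq> W c ! m"
  shows "fst (v ! i) > n - m"
proof -
  have "v ! i = take (Suc m) v ! i" using assms by simp
  moreover have "i < length (take (Suc m) v)" using assms by (simp add: Pm_def)
  ultimately have "v ! i \<in> set (take (Suc m) v)" by (metis nth_mem)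
  also have "set (take (Suc m) v) = set (take (Suc m) (W c))"
    using assms(1) by (auto simp: Pm_def dest: mset_eq_setD)
  finally obtain k where k: "k \<le> m" "v ! i = W c ! k"
    using assms(2) by (fastforce simp: in_set_conv_nth length_W less_Suc_eq_le)
  then have "k \<noteq> m" using assms(4) by auto
  then show ?thesis using k assms(2) by (simp add: W_nth)
qed

lemma Pm_Suc: "v \<in> Pm m c \<Longrightarrow> Suc m < n \<Longrightarrow> v \<in> Pm (Suc m) c \<and> v ! Suc m = W c ! Suc m"
proof -
  assume v: "v \<in> Pm m c" and m: "Suc m < n"
  then have l: "length v = n" by (simp add: Pm_def)
  have "drop (Suc m) v = v ! Suc m # drop (Suc (Suc m)) v" "drop (Suc m) (W c) = W c ! Suc m # drop (Suc (Suc m)) (W c)"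
    using m l by (simp_all add: Cons_nth_drop_Suc length_W)
  then have e: "v ! Suc m = W c ! Suc m" "drop (Suc (Suc m)) v = drop (Suc (Suc m)) (W c)"
    using v by (auto simp: Pm_def)
  have "take (Suc (Suc m)) v = take (Suc m) v @ [v ! Suc m]" "take (Suc (Suc m)) (W c) = take (Suc m) (W c) @ [W c ! Suc m]"
    using m l by (simp_all add: take_Suc_conv_app_nth length_W)
  then have "mset (take (Suc (Suc m)) v) = mset (take (Suc (Suc m)) (W c))"
    using v e by (simp add: Pm_def)
  then show ?thesis using e l by (simp add: Pm_def)
qed

lemma Pm_sw:
  assumes "i \<in> {1..m}" "m < n" "length v = n"
  shows "sw i v \<in> Pm m c \<longleftrightarrow> v \<in> Pm m c"
proof -
  have i: "i - 1 < Suc m" "i < Suc m" using assms by auto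
  then have "mset (take (Suc m) (sw i v)) = mset ((take (Suc m) v)[i - 1 := take (Suc m) v ! i, i := take (Suc m) v ! (i - 1)])"
    using assms by (simp add: sw_def take_update_swap)
  also have "\<dots> = mset (take (Suc m) v)"
    by (rule mset_swap) (use assms in auto)
  finally have "mset (take (Suc m) (sw i v)) = mset (take (Suc m) v)" .
  moreover have "drop (Suc m) (sw i v) = drop (Suc m) v" using i by (simp add: sw_def)
  ultimately show ?thesis by (simp add: Pm_def length_sw)
qed

text \<open>The letter at position \<open>Suc m\<close> has the smallest lower index among the
  letters in play. Each generator of the word moves it one place to the left past a letter with
  larger index, where \<open>G\<close> is a plain exchange. The word thus permutes coefficients, so
  nothing is lost, and the final position of this letter reveals \<open>d\<close>.\<close>

lemma desc_act:
  assumes m: "Suc m < n" and y: "y \<in> carrier TP" and supp: "\<And>v. y v \<noteq> \<zero> \<Longrightarrow> v \<in> Pm m c" and d: "d \<le> Suc m"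
  shows "(\<forall>v. \<rho> (Y.desc (Suc m) d) y v \<noteq> \<zero> \<longrightarrow> v \<in> Pm (Suc m) c \<and> v ! (Suc m - d) = W c ! Suc m) \<and>
    ((\<forall>v. \<rho> (Y.desc (Suc m) d) y v = \<zero>) \<longrightarrow> (\<forall>v. y v = \<zero>))"
  using d
proof (induction d)
  case 0
  have "\<rho> (Y.desc (Suc m) 0) y = y" using y by (simp add: End_sel)
  then show ?case using supp Pm_Suc[OF _ m] by auto
next
  case (Suc d)
  let ?i = "Suc m - d" and ?l = "W c ! Suc m"
  have i: "?i \<in> {1..<n}" "?i \<in> {1..Suc m}" "Suc m - Suc d = ?i - 1" using m Suc.prems by auto
  have d: "d \<le> Suc m" using Suc.prems by simp
  have gc: "g ?i \<in> carrier A" "Y.desc (Suc m) d \<in> carrier A"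
    using i m d by (auto intro!: Y.g_closed Y.desc_closed)
  define y' where "y' = \<rho> (Y.desc (Suc m) d) y"
  have y': "y' \<in> carrier TP" unfolding y'_def by (rule \<rho>_apply[OF gc(2) y])
  have s: "v \<in> Pm (Suc m) c" "v ! ?i = ?l" if "y' v \<noteq> \<zero>" for v
    using Suc.IH[OF d] that unfolding y'_def by auto
  have z: "\<forall>v. y v = \<zero>" if "\<forall>v. y' v = \<zero>" using Suc.IH[OF d] that unfolding y'_def by auto
  have e: "\<rho> (Y.desc (Suc m) (Suc d)) y = GG ?i y'"
    unfolding y'_def Y.desc.simps \<rho>_mult[OF gc(2,1) y] \<rho>_g[OF i(1)] by (rule refl)
  have ne: "v ! (?i - 1) \<noteq> v ! ?i" if "v \<in> Pm (Suc m) c" for v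
    by (rule Pm_distinct[OF that m]) (use i in auto)
  have act: "GG ?i y' v = y' (sw ?i v)" if l: "length v = n" for v
  proof -
    have 1: "alpha q (v ! (?i - 1)) (v ! ?i) \<otimes> y' v = \<zero>"
    proof (cases "y' v = \<zero>")
      case False
      have "fst (v ! (?i - 1)) > n - Suc m"
        by (rule Pm_fst[OF s(1)[OF False] m]) (use i ne[OF s(1)[OF False]] s(2)[OF False] in auto)
      then have "fst (v ! (?i - 1)) > fst (v ! ?i)" using s(2)[OF False] m by (simp add: W_nth)
      then show ?thesis using TP_closed[OF y'] by (simp add: alpha_def)
    qed simp
    \<comment> \<open>\<open>GG_eq\<close> has no exchange term when the letters coincide. The
      coefficient is zero in this case anyway, because the words in the support have distinct
      letters.\<close>
    have 2: "y' (sw ?i v) = \<zero>" if eq: "v ! (?i - 1) = v ! ?i"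
    proof (rule ccontr)
      assume "y' (sw ?i v) \<noteq> \<zero>"
      from s(1)[OF this] have "v \<in> Pm (Suc m) c" using Pm_sw[OF i(2) m l] by simp
      from ne[OF this] eq show False by simp
    qed
    show ?thesis unfolding GG_eq[OF y' i(1)] 1 using 2 TP_closed[OF y'] by auto
  qed
  have sup: "v \<in> Pm (Suc m) c \<and> v ! (Suc m - Suc d) = ?l" if v: "GG ?i y' v \<noteq> \<zero>" for v
  proof -
    have l: "length v = n" using v TP_outside[OF GG_TP[OF i(1) y']] by (auto simp: words_def)
    have nz: "y' (sw ?i v) \<noteq> \<zero>" using v act[OF l] by simp
    have "sw ?i v ! ?i = v ! (?i - 1)" using l i by (auto simp: sw_def)
    then show ?thesis using s[OF nz] Pm_sw[OF i(2) m l] i(3) by simp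
  qed
  \<comment> \<open>Being a mere relabelling of words by \<open>sw\<close>, the step can be undone
    by evaluating at the exchanged word.\<close>
  have "y' v = \<zero>" if 0: "\<forall>v. GG ?i y' v = \<zero>" for v
  proof (cases "length v = n")
    case True
    then have "y' v = GG ?i y' (sw ?i v)" using act[of "sw ?i v"] i by (simp add: length_sw sw_sw)
    then show ?thesis using 0 by simp
  next
    case False
    then show ?thesis using TP_outside[OF y'] by (auto simp: words_def)
  qed
  then show ?case unfolding e using sup z by blast
qed

text \<open>Summands with different \<open>d\<close> place the distinguished letter at different
  positions, so their supports are disjoint and a vanishing sum forces each summand to vanish. By
  \<open>desc_act\<close> each coefficient then annihilates every \<open>u c\<close>, and the
  induction applies to it. The support statement provides the hypothesis of \<open>desc_act\<close>
  at the next stage.\<close>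

lemma H_inj:
  assumes "m < n" "x \<in> Y.H m"
  shows "(\<forall>c v. colouring c \<longrightarrow> \<rho> x (u c) v \<noteq> \<zero> \<longrightarrow> v \<in> Pm m c) \<and>
    ((\<forall>c v. colouring c \<longrightarrow> \<rho> x (u c) v = \<zero>) \<longrightarrow> x = \<zero>\<^bsub>A\<^esub>)"
  using assms
proof (induction m arbitrary: x)
  case 0
  then obtain \<epsilon> where e: "\<And>c. \<epsilon> c \<in> carrier K" "\<And>c v. colouring c \<Longrightarrow> \<rho> x (u c) v = \<epsilon> c \<otimes> u c v"
     "(\<forall>c. colouring c \<longrightarrow> \<epsilon> c = \<zero>) \<longrightarrow> x = \<zero>\<^bsub>A\<^esub>"
    using torus_diag[of n x] by auto
  show ?case
  proof (intro conjI allI impI)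
    fix c v assume "colouring c" "\<rho> x (u c) v \<noteq> \<zero>"
    then have "v = W c" using e(1,2) by (auto simp: delta_def split: if_splits)
    then show "v \<in> Pm 0 c" by (simp add: Pm_def length_W)
  next
    assume z: "\<forall>c v. colouring c \<longrightarrow> \<rho> x (u c) v = \<zero>"
    have "\<epsilon> c = \<zero>" if "colouring c" for c
      using z e(1)[of c] e(2)[OF that, of "W c"] that by (simp add: delta_def)
    then show "x = \<zero>\<^bsub>A\<^esub>" using e(3) by simp
  qed
next
  case (Suc m)
  have m: "Suc m < n" "m < n" using Suc.prems by auto
  from Suc.prems(2) obtain h where h: "h \<in> {..Suc m} \<rightarrow> Y.H m" and x: "x = (\<Oplus>\<^bsub>A\<^esub>d\<in>{..Suc m}. h d \<otimes>\<^bsub>A\<^esub> Y.desc (Suc m) d)"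
    by (auto simp: Y.comb_def)
  have hc: "h d \<in> carrier A" "h d \<in> Y.H m" if "d \<le> Suc m" for d using h that Y.subD(1)[OF Y.sub_H[OF m(2)]] by auto
  define Z where "Z c d = \<rho> (Y.desc (Suc m) d) (\<rho> (h d) (u c))" for c d
  have ZT: "Z c d \<in> carrier TP" if "d \<le> Suc m" "colouring c" for c d
    unfolding Z_def by (intro \<rho>_apply u_closed that hc Y.desc_closed m)
  have act: "\<rho> x (u c) v = (\<Oplus>d\<in>{..Suc m}. Z c d v)" if "colouring c" for c v
    unfolding x Z_def by (rule \<rho>_comb) (use hc that m in \<open>auto intro!: u_closed Y.desc_closed\<close>)
  have da: "(\<forall>v. Z c d v \<noteq> \<zero> \<longrightarrow> v \<in> Pm (Suc m) c \<and> v ! (Suc m - d) = W c ! Suc m) \<and>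
    ((\<forall>v. Z c d v = \<zero>) \<longrightarrow> (\<forall>v. \<rho> (h d) (u c) v = \<zero>))" if c: "colouring c" and d: "d \<le> Suc m" for c d
    unfolding Z_def
  proof (rule desc_act[OF m(1) _ _ d])
    show "\<rho> (h d) (u c) \<in> carrier TP" by (intro \<rho>_apply hc d u_closed c)
    fix v assume "\<rho> (h d) (u c) v \<noteq> \<zero>"
    then show "v \<in> Pm m c" using Suc.IH[OF m(2) hc(2)[OF d]] c by blast
  qed
  show ?case
  proof (intro conjI allI impI)
    fix c v assume c: "colouring c" and "\<rho> x (u c) v \<noteq> \<zero>"
    then have nz: "(\<Oplus>d\<in>{..Suc m}. Z c d v) \<noteq> \<zero>" using act by simp
    have "\<exists>d\<in>{..Suc m}. Z c d v \<noteq> \<zero>"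
    proof (rule ccontr)
      assume "\<not> ?thesis"
      then have "(\<Oplus>d\<in>{..Suc m}. Z c d v) = \<zero>" by (intro R.add.finprod_one_eqI) auto
      with nz show False by simp
    qed
    then show "v \<in> Pm (Suc m) c" using da[OF c] by auto
  next
    assume z: "\<forall>c v. colouring c \<longrightarrow> \<rho> x (u c) v = \<zero>"
    have "h d = \<zero>\<^bsub>A\<^esub>" if d: "d \<le> Suc m" for d
    proof -
      have "\<rho> (h d) (u c) v = \<zero>" if c: "colouring c" for c v
      proof -
        have "Z c d v = \<zero>" for v
        proof (rule ccontr)
          assume nz: "Z c d v \<noteq> \<zero>"
          then have v: "v \<in> Pm (Suc m) c" "v ! (Suc m - d) = W c ! Suc m" using da[OF c d] by auto
          \<comment> \<open>A second nonzero summand would put the same letter at two positions of a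
            word with distinct letters.\<close>
          have other: "Z c d' v = \<zero>" if d': "d' \<le> Suc m" "d' \<noteq> d" for d'
          proof (rule ccontr)
            assume "Z c d' v \<noteq> \<zero>"
            then have "v ! (Suc m - d') = v ! (Suc m - d)" using da[OF c d'(1)] v by auto
            moreover have "v ! (Suc m - d') \<noteq> v ! (Suc m - d)"
              by (rule Pm_distinct[OF v(1) m(1)]) (use d d' in auto)
            ultimately show False by simp
          qed
          have "\<zero> = (\<Oplus>d\<in>{..Suc m}. Z c d v)" using z act[OF c] c by metis
          also have "\<dots> = (\<Oplus>d'\<in>{..Suc m}. if d' = d then Z c d' v else \<zero>)"
            using other TP_closed[OF ZT[OF _ c]] by (intro R.finsum_cong') auto
          also have "\<dots> = Z c d v"
            using d TP_closed[OF ZT[OF _ c]] by (intro R.add.finprod_singleton_swap) auto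
          finally show False using nz by simp
        qed
        then show ?thesis using da[OF c d] by blast
      qed
      then show ?thesis using Suc.IH[OF m(2) hc(2)[OF d]] by blast
    qed
    then show "x = \<zero>\<^bsub>A\<^esub>" unfolding x using Y.desc_closed[OF m(1)] by (intro Y.M.add.finprod_one_eqI) auto
  qed
qed

theorem \<rho>_inj: "inj_on \<rho> (carrier A)"
proof (rule inj_onI)
  fix x y assume x: "x \<in> carrier A" and y: "y \<in> carrier A" and e: "\<rho> x = \<rho> y"
  have d: "x \<ominus>\<^bsub>A\<^esub> y \<in> carrier A" using x y by simp
  have "\<rho> (x \<ominus>\<^bsub>A\<^esub> y) = \<zero>\<^bsub>End\<^esub>"
    using x y e by (simp add: Y.M.minus_eq End.M.r_neg)
  then have "\<rho> (x \<ominus>\<^bsub>A\<^esub> y) (u c) v = \<zero>" if "colouring c" for c v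
    using u_closed[OF that] by (simp add: End_sel TP_sel)
  moreover have "n - 1 < n" using Y.n_pos by simp
  ultimately have "x \<ominus>\<^bsub>A\<^esub> y = \<zero>\<^bsub>A\<^esub>" using H_inj[of "n - 1"] Y.carrier_H d by blast
  then show "x = y" using x y Y.M.r_right_minus_eq by simp
qed

end

section \<open>The presented algebra\<close>

definition gen_image :: "(nat \<Rightarrow> 'e) \<Rightarrow> (nat \<Rightarrow> 'e) \<Rightarrow> yh_gen \<Rightarrow> 'e" where
  "gen_image t g x = (case x of Gen_t i \<Rightarrow> t i | Gen_g i \<Rightarrow> g i)"

definition word_image :: "('e, 'x) monoid_scheme \<Rightarrow> ('s \<Rightarrow> 'e) \<Rightarrow> 's list \<Rightarrow> 'e" where
  "word_image E f w = foldr (\<lambda>x y. f x \<otimes>\<^bsub>E\<^esub> y) w \<one>\<^bsub>E\<^esub>"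

lemma (in monoid) word_image_closed:
  "f \<in> S \<rightarrow> carrier G \<Longrightarrow> w \<in> lists S \<Longrightarrow> word_image G f w \<in> carrier G"
  by (induction w) (auto simp: word_image_def)

lemma (in monoid) word_image_append:
  "f \<in> S \<rightarrow> carrier G \<Longrightarrow> w \<in> lists S \<Longrightarrow> w' \<in> lists S \<Longrightarrow>
    word_image G f (w @ w') = word_image G f w \<otimes> word_image G f w'"
proof (induction w)
  case Nil
  then show ?case using word_image_closed[of f S w'] by (simp add: word_image_def)
next
  case (Cons a w)
  then have "f a \<in> carrier G" "word_image G f w \<in> carrier G" "word_image G f w' \<in> carrier G"
    using word_image_closed by auto
  then show ?case using Cons by (simp add: word_image_def m_assoc)
qed

locale yh_presentation = B: cring B for B :: "'b ring" +
  fixes q :: 'b and r n :: nat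
  assumes r_unit: "[r] \<cdot>\<^bsub>B\<^esub> \<one>\<^bsub>B\<^esub> \<in> Units B" and q_unit: "q \<in> Units B" and n_pos: "n \<ge> 1" and r_pos: "r \<ge> 1"
begin

sublocale W: monoid_alg B "word_monoid (yh_gens n)"
  by (intro monoid_alg.intro B.is_cring word_monoid_monoid)

abbreviation F where "F \<equiv> yh_free B n"
abbreviation I where "I \<equiv> yh_ideal B q r n"
abbreviation Y where "Y \<equiv> yh_algebra B q r n"

lemma F_eq: "F = W.P" by (simp add: yh_free_def)

sublocale F: nc_algebra B F
  unfolding F_eq by (rule W.nc_algebra_P)

text \<open>The identity map makes the facts of \<open>yh_free_map\<close> about the free algebra
  itself available.\<close>

lemma alg_map_id: "yh_free_map B n B F (\<lambda>x. x) (\<lambda>x. x) r q"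
  by (intro yh_free_map.intro yh_free_map_axioms.intro alg_mapI F.nc_algebra_axioms id_ring_hom r_unit q_unit) auto

lemma relators_closed: "yh_relators B q r n \<subseteq> carrier F"
  by (rule yh_free_map.relators_closed[OF alg_map_id])

sublocale I: quot_alg B F I
  unfolding quot_alg_def yh_ideal_def
  by (intro conjI F.nc_algebra_axioms F.M.genideal_ideal relators_closed)

lemma Y_eq: "Y = I.Q" by (simp add: yh_algebra_def)

sublocale Y: nc_algebra B Y
  unfolding Y_eq by (rule I.nc_algebra_Q)

lemma cls_map: "yh_free_map B n B Y (\<lambda>x. x) I.cls r q"
proof (intro yh_free_map.intro yh_free_map_axioms.intro alg_mapI F.nc_algebra_axioms Y.nc_algebra_axioms id_ring_hom r_unit q_unit)
  show "I.cls \<in> ring_hom F Y" unfolding Y_eq by (rule I.cls_hom)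
  show "I.cls (c \<odot>\<^bsub>F\<^esub> x) = c \<odot>\<^bsub>Y\<^esub> I.cls x" if "c \<in> carrier B" "x \<in> carrier F" for c x
    unfolding Y_eq by (rule I.smult_cls[OF that, symmetric])
qed

lemma cls_relator: "x \<in> yh_relators B q r n \<Longrightarrow> I.cls x = \<zero>\<^bsub>Y\<^esub>"
proof -
  assume "x \<in> yh_relators B q r n"
  then have "x \<in> I" unfolding yh_ideal_def using F.M.genideal_self[OF relators_closed] by auto
  then have "I.cls x = I" by (rule F.M.a_rcos_zero[OF I.is_ideal])
  then show ?thesis unfolding Y_eq I.Q_sel FactRing_sel .
qed

lemma yh_rel_Y: "yh_rel B Y q r n (yh_t B q r n) (yh_g B q r n)"
  using yh_free_map.relators_iff[OF cls_map] cls_relator unfolding yh_t_def yh_g_def by blast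

lemma gens_closed: "i \<in> {1..n} \<Longrightarrow> monomial B [Gen_t i] \<in> carrier F" "i \<in> {1..<n} \<Longrightarrow> monomial B [Gen_g i] \<in> carrier F"
  using yh_free_map.gens_closed[OF alg_map_id] by auto

lemma cls_closed: "x \<in> carrier F \<Longrightarrow> I.cls x \<in> carrier Y"
  unfolding Y_eq I.carrier_Q by blast

lemma yh_t_closed: "i \<in> {1..n} \<Longrightarrow> yh_t B q r n i \<in> carrier Y"
  and yh_g_closed: "i \<in> {1..<n} \<Longrightarrow> yh_g B q r n i \<in> carrier Y"
  unfolding yh_t_def yh_g_def by (intro cls_closed gens_closed; assumption)+

lemma F_generates: "F.generates ((\<lambda>i. monomial B [Gen_t i]) ` {1..n} \<union> (\<lambda>i. monomial B [Gen_g i]) ` {1..<n})"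
  unfolding F.generates_def
proof (intro allI impI subsetI)
  fix S assume S: "F.sub S" and one: "\<one>\<^bsub>F\<^esub> \<in> S"
    and mult: "\<forall>x\<in>S. \<forall>a\<in>(\<lambda>i. monomial B [Gen_t i]) ` {1..n} \<union> (\<lambda>i. monomial B [Gen_g i]) ` {1..<n}. x \<otimes>\<^bsub>F\<^esub> a \<in> S"
  have mon: "w \<in> lists (yh_gens n) \<Longrightarrow> monomial B w \<in> S" for w
  proof (induction w rule: rev_induct)
    case Nil
    then show ?case using one by (simp add: F_eq W.one_P word_monoid_sel monomial_single)
  next
    case (snoc a w)
    then have a: "a \<in> yh_gens n" and w: "w \<in> lists (yh_gens n)" by auto
    have "monomial B (w @ [a]) = monomial B w \<otimes>\<^bsub>F\<^esub> monomial B [a]"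
      unfolding F_eq monomial_single using a w by (subst W.single_mult) (auto simp: word_monoid_sel)
    moreover have "monomial B [a] \<in> (\<lambda>i. monomial B [Gen_t i]) ` {1..n} \<union> (\<lambda>i. monomial B [Gen_g i]) ` {1..<n}"
      using a unfolding yh_gens_def by blast
    ultimately show ?case using snoc.IH[OF w] mult by simp
  qed
  fix x assume "x \<in> carrier F"
  then have "x \<in> carrier W.P" by (simp only: F_eq)
  then show "x \<in> S"
  proof (induction x rule: W.P_induct)
    case zero
    then show ?case using F.subD(2)[OF S] by (simp add: F_eq W.zero_P)
  next
    case (add c m f)
    have "single B c m = c \<odot>\<^bsub>F\<^esub> monomial B m"
      using add.hyps(1) by (simp add: F_eq monomial_single W.smult_single)
    also have "\<dots> \<in> S" using add.hyps mon F.subD(4)[OF S] by (simp add: word_monoid_sel)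
    finally show ?case using F.subD(3)[OF S _ add.IH] by (simp only: F_eq)
  qed
qed

lemma Y_generates: "Y.generates (yh_t B q r n ` {1..n} \<union> yh_g B q r n ` {1..<n})"
  unfolding Y.generates_def
proof (intro allI impI)
  interpret c: yh_free_map B n B Y "\<lambda>x. x" I.cls r q by (rule cls_map)
  fix S assume S: "Y.sub S" "\<one>\<^bsub>Y\<^esub> \<in> S" "\<forall>x\<in>S. \<forall>a\<in>yh_t B q r n ` {1..n} \<union> yh_g B q r n ` {1..<n}. x \<otimes>\<^bsub>Y\<^esub> a \<in> S"
  have "I.cls x \<in> S" if "x \<in> carrier F" for x
    by (rule c.generates_image[OF F_generates _ S(1,2) _ that])
      (use S(3) gens_closed in \<open>auto simp: yh_t_def yh_g_def\<close>)
  then show "carrier Y \<subseteq> S" unfolding Y_eq I.carrier_Q by auto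
qed

lemma yh_alg_gen_Y: "yh_alg_gen B Y q r n (yh_t B q r n) (yh_g B q r n)"
  by (intro yh_alg_gen.intro yh_alg.intro yh_alg_axioms.intro yh_alg_gen_axioms.intro Y.nc_algebra_axioms
      n_pos r_pos yh_t_closed yh_g_closed yh_rel_Y r_unit q_unit Y_generates)

text \<open>The universal property of the presentation, with a change of ground ring built in. The
  generic algebra can thus be mapped straight into endomorphisms over \<open>K\<close>, before any
  scalar extension is formed.\<close>

lemma Y_lift:
  assumes E: "nc_algebra K E" and \<phi>: "\<phi> \<in> ring_hom B K" and rel: "yh_rel K E (\<phi> q) r n t g"
    and t: "\<And>i. i \<in> {1..n} \<Longrightarrow> t i \<in> carrier E" and g: "\<And>i. i \<in> {1..<n} \<Longrightarrow> g i \<in> carrier E"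
  shows "\<exists>\<Psi>. alg_map B Y K E \<phi> \<Psi> \<and> (\<forall>i\<in>{1..n}. \<Psi> (yh_t B q r n i) = t i) \<and> (\<forall>i\<in>{1..<n}. \<Psi> (yh_g B q r n i) = g i)"
proof -
  interpret E: nc_algebra K E by fact
  interpret \<phi>: ring_hom_ring B K \<phi> by unfold_locales fact
  \<comment> \<open>Multiples of the unit are central in \<open>E\<close>, which supplies the
    commutation required by \<open>monoid_alg_lift\<close>.\<close>
  define \<psi> where "\<psi> c = \<phi> c \<odot>\<^bsub>E\<^esub> \<one>\<^bsub>E\<^esub>" for c
  define h where "h = word_image E (gen_image t g)"
  have \<psi>: "\<psi> \<in> ring_hom B E"
    by (rule ring_hom_memI) (auto simp: \<psi>_def E.smult_l_distr E.smult_assoc1 E.smult_mult_l)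
  have gi: "gen_image t g \<in> yh_gens n \<rightarrow> carrier E"
    using t g by (auto simp: yh_gens_def gen_image_def)
  have \<psi>x: "\<psi> c \<otimes>\<^bsub>E\<^esub> x = \<phi> c \<odot>\<^bsub>E\<^esub> x" "x \<otimes>\<^bsub>E\<^esub> \<psi> c = \<phi> c \<odot>\<^bsub>E\<^esub> x" if "c \<in> carrier B" "x \<in> carrier E" for c x
    using that by (simp_all add: \<psi>_def E.smult_mult_l E.smult_mult_r)
  interpret L: monoid_alg_lift B "word_monoid (yh_gens n)" E \<psi> h
  proof (unfold_locales)
    show "\<psi> \<in> ring_hom B E" by (rule \<psi>)
    show hc: "h w \<in> carrier E" if "w \<in> carrier (word_monoid (yh_gens n))" for w
      using that E.M.word_image_closed[OF gi] by (simp add: h_def word_monoid_sel)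
    show "h \<one>\<^bsub>word_monoid (yh_gens n)\<^esub> = \<one>\<^bsub>E\<^esub>" by (simp add: h_def word_image_def word_monoid_sel)
    show "h (w \<otimes>\<^bsub>word_monoid (yh_gens n)\<^esub> w') = h w \<otimes>\<^bsub>E\<^esub> h w'"
      if "w \<in> carrier (word_monoid (yh_gens n))" "w' \<in> carrier (word_monoid (yh_gens n))" for w w'
      using that E.M.word_image_append[OF gi] by (simp add: h_def word_monoid_sel)
    show "h w \<otimes>\<^bsub>E\<^esub> \<psi> c = \<psi> c \<otimes>\<^bsub>E\<^esub> h w" if "w \<in> carrier (word_monoid (yh_gens n))" "c \<in> carrier B" for w c
      using \<psi>x[OF that(2) hc[OF that(1)]] by simp
  qed
  have hom: "L.L \<in> ring_hom F E" unfolding F_eq by (rule L.lift_ring_hom)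
  have one_w: "[] \<in> carrier (word_monoid (yh_gens n))" by (simp add: word_monoid_sel)
  have sm: "L.L (c \<odot>\<^bsub>F\<^esub> x) = \<phi> c \<odot>\<^bsub>E\<^esub> L.L x" if c: "c \<in> carrier B" and x: "x \<in> carrier F" for c x
  proof -
    have x': "x \<in> carrier W.P" using x by (simp only: F_eq)
    have "c \<odot>\<^bsub>F\<^esub> x = single B c [] \<otimes>\<^bsub>W.P\<^esub> x"
      using W.smult_as_mult(1)[OF c x'] by (simp only: F_eq word_monoid_sel)
    then have "L.L (c \<odot>\<^bsub>F\<^esub> x) = L.L (single B c []) \<otimes>\<^bsub>E\<^esub> L.L x"
      using L.lift_mult[OF W.single_closed[OF c one_w] x'] by simp
    also have "L.L (single B c []) = \<psi> c"
      using c by (subst L.lift_single[OF c one_w]) (simp add: h_def word_image_def)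
    finally show ?thesis using \<psi>x(1)[OF c L.lift_closed[OF x']] by simp
  qed
  have val: "L.L (monomial B [a]) = gen_image t g a" if a: "a \<in> yh_gens n" for a
  proof -
    have "[a] \<in> carrier (word_monoid (yh_gens n))" using a by (simp add: word_monoid_sel)
    from L.lift_single[OF B.one_closed this] gi a show ?thesis
      by (auto simp: monomial_single h_def word_image_def Pi_iff)
  qed
  have vt: "L.L (monomial B [Gen_t i]) = t i" if "i \<in> {1..n}" for i
    using val[of "Gen_t i"] that by (simp add: yh_gens_def gen_image_def)
  have vg: "L.L (monomial B [Gen_g i]) = g i" if "i \<in> {1..<n}" for i
    using val[of "Gen_g i"] that by (simp add: yh_gens_def gen_image_def image_iff)
  interpret M: yh_free_map B n K E \<phi> L.L r q
    by (intro yh_free_map.intro yh_free_map_axioms.intro alg_mapI F.nc_algebra_axioms E \<phi> hom sm r_unit q_unit)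
  have "yh_rel K E (\<phi> q) r n (\<lambda>i. L.L (monomial B [Gen_t i])) (\<lambda>i. L.L (monomial B [Gen_g i]))"
    using rel unfolding yh_rel_def by (auto simp: vt vg transpose_def)
  then have ker: "\<forall>x\<in>yh_relators B q r n. L.L x = \<zero>\<^bsub>E\<^esub>" using M.relators_iff by blast
  have "yh_relators B q r n \<subseteq> a_kernel F E L.L"
    unfolding a_kernel_def' using ker relators_closed by blast
  then have "I \<subseteq> a_kernel F E L.L"
    unfolding yh_ideal_def by (rule F.M.genideal_minimal[OF M.h.kernel_is_ideal])
  then have kI: "L.L x = \<zero>\<^bsub>E\<^esub>" if "x \<in> I" for x using that unfolding a_kernel_def' by blast
  define \<Psi> where "\<Psi> = quot_lift L.L"
  have \<Psi>c: "\<Psi> (I.cls x) = L.L x" if "x \<in> carrier F" for x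
    unfolding \<Psi>_def by (rule quot_lift_coset[OF I.is_ideal M.h.is_ring_hom_ring kI that])
  have "\<Psi> \<in> ring_hom Y E"
    unfolding Y_eq ring_hom_cong_left[OF I.Q_sel(1-3,5)] \<Psi>_def
    by (rule quot_lift_ring_hom[OF I.is_ideal M.h.is_ring_hom_ring kI])
  moreover have "\<Psi> (c \<odot>\<^bsub>Y\<^esub> x) = \<phi> c \<odot>\<^bsub>E\<^esub> \<Psi> x" if c: "c \<in> carrier B" and x: "x \<in> carrier Y" for c x
  proof -
    from x obtain y where y: "y \<in> carrier F" "x = I.cls y" unfolding Y_eq I.carrier_Q by auto
    have "c \<odot>\<^bsub>Y\<^esub> x = I.cls (c \<odot>\<^bsub>F\<^esub> y)" unfolding Y_eq y(2) by (rule I.smult_cls[OF c y(1)])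
    then show ?thesis using \<Psi>c[OF y(1)] \<Psi>c[OF F.smult_closed[OF c y(1)]] sm[OF c y(1)] y(2) by simp
  qed
  ultimately have "alg_map B Y K E \<phi> \<Psi>"
    by (intro alg_mapI Y.nc_algebra_axioms E \<phi>)
  moreover have "\<Psi> (yh_t B q r n i) = t i" if "i \<in> {1..n}" for i
    unfolding yh_t_def \<Psi>c[OF gens_closed(1)[OF that]] by (rule vt[OF that])
  moreover have "\<Psi> (yh_g B q r n i) = g i" if "i \<in> {1..<n}" for i
    unfolding yh_g_def \<Psi>c[OF gens_closed(2)[OF that]] by (rule vg[OF that])
  ultimately show ?thesis by blast
qed

end

section \<open>Extension of scalars\<close>

lemma (in ring) int_embed_ring_hom: "(\<lambda>k::int. [k] \<cdot> \<one>) \<in> ring_hom \<Z> R"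
proof (rule ring_hom_memI)
  fix j k :: int
  have c: "[k] \<cdot> \<one> \<in> carrier R" for k :: int by (rule add.int_pow_closed) simp
  show "[j] \<cdot> \<one> \<in> carrier R" by (rule c)
  have "[(j + k)] \<cdot> \<one> = [j] \<cdot> \<one> \<oplus> [k] \<cdot> \<one>" by (rule add.int_pow_mult) simp
  then show "[(j \<oplus>\<^bsub>\<Z>\<^esub> k)] \<cdot> \<one> = [j] \<cdot> \<one> \<oplus> [k] \<cdot> \<one>" by simp
  have "[(j * k)] \<cdot> \<one> = [k] \<cdot> ([j] \<cdot> \<one>)"
    using add.int_pow_pow[of \<one> k j] by (simp add: mult.commute)
  also have "\<dots> = [j] \<cdot> \<one> \<otimes> [k] \<cdot> \<one>"
    using add_pow_rdistr_int[OF c[of j] one_closed, of k] c by simp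
  finally show "[(j \<otimes>\<^bsub>\<Z>\<^esub> k)] \<cdot> \<one> = [j] \<cdot> \<one> \<otimes> [k] \<cdot> \<one>" by simp
next
  show "[\<one>\<^bsub>\<Z>\<^esub>] \<cdot> \<one> = \<one>" using add.int_pow_1 by simp
qed

lemma (in ring) int_embed_comm: "x \<in> carrier R \<Longrightarrow> x \<otimes> [(k::int)] \<cdot> \<one> = [k] \<cdot> \<one> \<otimes> x"
  by (simp add: add_pow_ldistr_int add_pow_rdistr_int)

locale scalar_ext = Y: nc_algebra B Y + K: cring K + \<phi>: ring_hom_ring B K \<phi>
  for B :: "'r ring" and Y :: "('r, 'a) module" and K :: "'k ring" and \<phi>
begin

sublocale W: monoid_alg \<Z> "Y \<times>\<times> K"
  by (intro monoid_alg.intro int_is_cring DirProd_monoid Y.M.monoid_axioms K.monoid_axioms)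

abbreviation T where "T \<equiv> tensor_monoid_ring Y K"
abbreviation J where "J \<equiv> tensor_ideal B Y K \<phi>"
abbreviation SE where "SE \<equiv> scalar_extension B Y K \<phi>"
abbreviation pt where "pt \<equiv> pure_tensor B Y K \<phi>"
abbreviation mono :: "'a \<Rightarrow> 'k \<Rightarrow> 'a \<times> 'k \<Rightarrow> int" where "mono a k \<equiv> monomial \<Z> (a, k)"

lemma T_eq: "T = W.P" by (simp add: tensor_monoid_ring_def)

sublocale T: ring T
  unfolding T_eq by (rule W.ring_P)

lemma mono_closed: "a \<in> carrier Y \<Longrightarrow> k \<in> carrier K \<Longrightarrow> mono a k \<in> carrier T"
  unfolding T_eq monomial_single by (rule W.single_closed) auto

lemma mono_mult: "a \<in> carrier Y \<Longrightarrow> b \<in> carrier Y \<Longrightarrow> k \<in> carrier K \<Longrightarrow> l \<in> carrier K \<Longrightarrow>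
    mono a k \<otimes>\<^bsub>T\<^esub> mono b l = mono (a \<otimes>\<^bsub>Y\<^esub> b) (k \<otimes>\<^bsub>K\<^esub> l)"
  unfolding T_eq monomial_single by (subst W.single_mult) auto

lemma mono_one: "mono \<one>\<^bsub>Y\<^esub> \<one>\<^bsub>K\<^esub> = \<one>\<^bsub>T\<^esub>"
  unfolding T_eq monomial_single W.one_P by simp

lemma relators_closed: "tensor_relators B Y K \<phi> \<subseteq> carrier T"
  unfolding tensor_relators_def Let_def
  by (intro Un_least subsetI; clarify; intro T.minus_closed T.a_closed mono_closed Y.M.a_closed K.a_closed Y.smult_closed K.m_closed \<phi>.hom_closed; assumption)

sublocale J: ideal J T
  unfolding tensor_ideal_def by (rule T.genideal_ideal[OF relators_closed])

abbreviation cls where "cls x \<equiv> J +>\<^bsub>T\<^esub> x"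

lemma SE_sel: "carrier SE = carrier (T Quot J)" "monoid.mult SE = monoid.mult (T Quot J)" "one SE = one (T Quot J)"
  "ring.zero SE = ring.zero (T Quot J)" "add SE = add (T Quot J)"
  by (simp_all add: scalar_extension_def Let_def ring.defs)

lemma SE_smult: "c \<odot>\<^bsub>SE\<^esub> x = pt \<one>\<^bsub>Y\<^esub> c \<otimes>\<^bsub>SE\<^esub> x"
  by (simp add: scalar_extension_def Let_def ring.defs)

sublocale SE: ring SE
  by (rule ring_cong[OF J.quotient_is_ring SE_sel])

lemma cls_hom: "cls \<in> ring_hom T SE"
  unfolding ring_hom_cong_right[OF SE_sel(1-3,5)] by (rule J.rcos_ring_hom)

sublocale c: ring_hom_ring T SE cls
  by unfold_locales (rule cls_hom)

lemma carrier_SE: "carrier SE = cls ` carrier T"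
  by (simp only: SE_sel carrier_Quot)

lemma pt_eq: "pt a k = cls (mono a k)" by (simp add: pure_tensor_def)

lemma pt_closed: "a \<in> carrier Y \<Longrightarrow> k \<in> carrier K \<Longrightarrow> pt a k \<in> carrier SE"
  unfolding pt_eq by (intro c.hom_closed mono_closed)

lemma pt_mult: "a \<in> carrier Y \<Longrightarrow> b \<in> carrier Y \<Longrightarrow> k \<in> carrier K \<Longrightarrow> l \<in> carrier K \<Longrightarrow>
    pt a k \<otimes>\<^bsub>SE\<^esub> pt b l = pt (a \<otimes>\<^bsub>Y\<^esub> b) (k \<otimes>\<^bsub>K\<^esub> l)"
  unfolding pt_eq by (simp only: mono_mult[symmetric] c.hom_mult mono_closed)

lemma pt_one: "pt \<one>\<^bsub>Y\<^esub> \<one>\<^bsub>K\<^esub> = \<one>\<^bsub>SE\<^esub>"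
  unfolding pt_eq mono_one by (rule c.hom_one)

lemma relator_eq: 
  assumes "x \<in> carrier T" "y \<in> carrier T" "x \<ominus>\<^bsub>T\<^esub> y \<in> tensor_relators B Y K \<phi>"
  shows "cls x = cls y"
proof -
  have "x \<ominus>\<^bsub>T\<^esub> y \<in> J" unfolding tensor_ideal_def using assms(3) T.genideal_self[OF relators_closed] by blast
  then show ?thesis using T.quotient_eq_iff_same_a_r_cos[OF J.is_ideal assms(1,2)] by simp
qed

lemma pt_add_l:
  assumes "a \<in> carrier Y" "b \<in> carrier Y" "k \<in> carrier K"
  shows "pt (a \<oplus>\<^bsub>Y\<^esub> b) k = pt a k \<oplus>\<^bsub>SE\<^esub> pt b k"
proof -
  have "cls (mono (a \<oplus>\<^bsub>Y\<^esub> b) k) = cls (mono a k \<oplus>\<^bsub>T\<^esub> mono b k)"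
  proof (rule relator_eq)
    show "mono (a \<oplus>\<^bsub>Y\<^esub> b) k \<ominus>\<^bsub>T\<^esub> (mono a k \<oplus>\<^bsub>T\<^esub> mono b k) \<in> tensor_relators B Y K \<phi>"
      unfolding tensor_relators_def Let_def using assms by blast
  qed (use assms in \<open>auto intro!: mono_closed\<close>)
  also have "\<dots> = pt a k \<oplus>\<^bsub>SE\<^esub> pt b k" unfolding pt_eq by (intro c.hom_add mono_closed assms)
  finally show ?thesis unfolding pt_eq .
qed

lemma pt_add_r:
  assumes "a \<in> carrier Y" "k \<in> carrier K" "l \<in> carrier K"
  shows "pt a (k \<oplus>\<^bsub>K\<^esub> l) = pt a k \<oplus>\<^bsub>SE\<^esub> pt a l"
proof -
  have "cls (mono a (k \<oplus>\<^bsub>K\<^esub> l)) = cls (mono a k \<oplus>\<^bsub>T\<^esub> mono a l)"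
  proof (rule relator_eq)
    show "mono a (k \<oplus>\<^bsub>K\<^esub> l) \<ominus>\<^bsub>T\<^esub> (mono a k \<oplus>\<^bsub>T\<^esub> mono a l) \<in> tensor_relators B Y K \<phi>"
      unfolding tensor_relators_def Let_def using assms by blast
  qed (use assms in \<open>auto intro!: mono_closed\<close>)
  also have "\<dots> = pt a k \<oplus>\<^bsub>SE\<^esub> pt a l" unfolding pt_eq by (intro c.hom_add mono_closed assms)
  finally show ?thesis unfolding pt_eq .
qed

lemma pt_smult:
  assumes "d \<in> carrier B" "a \<in> carrier Y" "k \<in> carrier K"
  shows "pt (d \<odot>\<^bsub>Y\<^esub> a) k = pt a (\<phi> d \<otimes>\<^bsub>K\<^esub> k)"
  unfolding pt_eq
proof (rule relator_eq)
  show "mono (d \<odot>\<^bsub>Y\<^esub> a) k \<ominus>\<^bsub>T\<^esub> mono a (\<phi> d \<otimes>\<^bsub>K\<^esub> k) \<in> tensor_relators B Y K \<phi>"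
    unfolding tensor_relators_def Let_def using assms by blast
qed (use assms in \<open>auto intro!: mono_closed\<close>)

text \<open>Scalars of the extension are defined by left multiplication with
  \<open>1 \<otimes> k\<close>. Centrality, which rests on the commutativity of \<open>K\<close>, is
  what makes this an algebra structure.\<close>

lemma mono_central: 
  assumes k: "k \<in> carrier K" and f: "f \<in> carrier T"
  shows "f \<otimes>\<^bsub>T\<^esub> mono \<one>\<^bsub>Y\<^esub> k = mono \<one>\<^bsub>Y\<^esub> k \<otimes>\<^bsub>T\<^esub> f"
proof -
  have m: "mono \<one>\<^bsub>Y\<^esub> k \<in> carrier W.P" using mono_closed[OF Y.M.one_closed k] by (simp only: T_eq)
  have "f \<in> carrier W.P" using f by (simp only: T_eq)
  then show ?thesis unfolding T_eq
  proof (induction f rule: W.P_induct)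
    case zero
    then show ?case using W.mult_zero[OF m] by simp
  next
    case (add j x f)
    obtain a l where x: "x = (a, l)" by (cases x)
    have al: "a \<in> carrier Y" "l \<in> carrier K" using add.hyps(2) by (simp_all add: x)
    have "single \<Z> j x \<otimes>\<^bsub>W.P\<^esub> mono \<one>\<^bsub>Y\<^esub> k = mono \<one>\<^bsub>Y\<^esub> k \<otimes>\<^bsub>W.P\<^esub> single \<Z> j x"
      unfolding monomial_single x using al k by (simp add: W.single_mult K.m_comm)
    then show ?case
      using add m W.single_closed[OF add.hyps(1,2)] by (simp add: W.mult_add W.add_mult)
  qed
qed

lemma pt_central: "k \<in> carrier K \<Longrightarrow> x \<in> carrier SE \<Longrightarrow> x \<otimes>\<^bsub>SE\<^esub> pt \<one>\<^bsub>Y\<^esub> k = pt \<one>\<^bsub>Y\<^esub> k \<otimes>\<^bsub>SE\<^esub> x"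
proof -
  assume k: "k \<in> carrier K" and "x \<in> carrier SE"
  then obtain f where f: "f \<in> carrier T" "x = cls f" unfolding carrier_SE by auto
  show ?thesis unfolding pt_eq f(2)
    using c.hom_mult[OF f(1) mono_closed[OF Y.M.one_closed k]] c.hom_mult[OF mono_closed[OF Y.M.one_closed k] f(1)]
      mono_central[OF k f(1)] by simp
qed

sublocale SE: nc_algebra K SE
proof (rule nc_algebraI)
  note pc = pt_closed[OF Y.M.one_closed]
  show "ring SE" by (rule SE.ring_axioms)
  show "module K SE"
  proof (rule moduleI)
    show "cring K" by (rule K.is_cring)
    show "abelian_group SE" by (rule SE.is_abelian_group)
  next
    fix a b x assume *: "a \<in> carrier K" "b \<in> carrier K" "x \<in> carrier SE"
    show "(a \<oplus>\<^bsub>K\<^esub> b) \<odot>\<^bsub>SE\<^esub> x = a \<odot>\<^bsub>SE\<^esub> x \<oplus>\<^bsub>SE\<^esub> b \<odot>\<^bsub>SE\<^esub> x"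
      unfolding SE_smult pt_add_r[OF Y.M.one_closed *(1,2)] by (rule SE.l_distr[OF pc[OF *(1)] pc[OF *(2)] *(3)])
    have "pt \<one>\<^bsub>Y\<^esub> (a \<otimes>\<^bsub>K\<^esub> b) = pt \<one>\<^bsub>Y\<^esub> a \<otimes>\<^bsub>SE\<^esub> pt \<one>\<^bsub>Y\<^esub> b"
      using pt_mult[OF Y.M.one_closed Y.M.one_closed *(1,2)] by simp
    then show "(a \<otimes>\<^bsub>K\<^esub> b) \<odot>\<^bsub>SE\<^esub> x = a \<odot>\<^bsub>SE\<^esub> (b \<odot>\<^bsub>SE\<^esub> x)"
      unfolding SE_smult using SE.m_assoc[OF pc[OF *(1)] pc[OF *(2)] *(3)] by simp
  qed (simp_all add: SE_smult pc SE.r_distr pt_one)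
  fix a x y assume *: "a \<in> carrier K" "x \<in> carrier SE" "y \<in> carrier SE"
  show "(a \<odot>\<^bsub>SE\<^esub> x) \<otimes>\<^bsub>SE\<^esub> y = a \<odot>\<^bsub>SE\<^esub> (x \<otimes>\<^bsub>SE\<^esub> y)"
    unfolding SE_smult by (rule SE.m_assoc[OF pc[OF *(1)] *(2,3)])
  have "x \<otimes>\<^bsub>SE\<^esub> (a \<odot>\<^bsub>SE\<^esub> y) = (x \<otimes>\<^bsub>SE\<^esub> pt \<one>\<^bsub>Y\<^esub> a) \<otimes>\<^bsub>SE\<^esub> y"
    unfolding SE_smult by (rule SE.m_assoc[OF *(2) pc[OF *(1)] *(3), symmetric])
  also have "\<dots> = a \<odot>\<^bsub>SE\<^esub> (x \<otimes>\<^bsub>SE\<^esub> y)"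
    unfolding SE_smult pt_central[OF *(1,2)] by (rule SE.m_assoc[OF pc[OF *(1)] *(2,3)])
  finally show "x \<otimes>\<^bsub>SE\<^esub> (a \<odot>\<^bsub>SE\<^esub> y) = a \<odot>\<^bsub>SE\<^esub> (x \<otimes>\<^bsub>SE\<^esub> y)" .
qed

abbreviation emb where "emb a \<equiv> pt a \<one>\<^bsub>K\<^esub>"

lemma emb_map: "alg_map B Y K SE \<phi> emb"
proof (rule alg_mapI[OF Y.nc_algebra_axioms SE.nc_algebra_axioms \<phi>.homh])
  show "emb \<in> ring_hom Y SE"
    by (rule ring_hom_memI) (simp_all add: pt_closed pt_mult pt_add_l pt_one)
  show "emb (d \<odot>\<^bsub>Y\<^esub> a) = \<phi> d \<odot>\<^bsub>SE\<^esub> emb a" if "d \<in> carrier B" "a \<in> carrier Y" for d a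
    using that by (simp add: pt_smult SE_smult pt_mult)
qed

lemma pt_smult_emb: "a \<in> carrier Y \<Longrightarrow> k \<in> carrier K \<Longrightarrow> pt a k = k \<odot>\<^bsub>SE\<^esub> emb a"
  by (simp add: SE_smult pt_mult)

text \<open>Every class is an integral combination of pure tensors. Integer multiples are reached by
  adding a pure tensor or its negative repeatedly.\<close>

lemma SE_induct:
  assumes S: "SE.sub S" and pt: "\<And>a k. a \<in> carrier Y \<Longrightarrow> k \<in> carrier K \<Longrightarrow> pt a k \<in> S"
  shows "carrier SE \<subseteq> S"
proof
  fix x assume "x \<in> carrier SE"
  then obtain f where f: "f \<in> carrier W.P" "x = cls f" unfolding carrier_SE T_eq by blast
  have s: "cls (single \<Z> j (a, k)) \<in> S" if ak: "a \<in> carrier Y" "k \<in> carrier K" for j a k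
  proof -
    have m: "(a, k) \<in> carrier (Y \<times>\<times> K)" using ak by simp
    have sc: "single \<Z> i (a, k) \<in> carrier T" for i
      unfolding T_eq by (rule W.single_closed[OF _ m]) simp
    have p: "cls (single \<Z> 1 (a, k)) = pt a k" unfolding pt_eq monomial_single by simp
    have add: "cls (single \<Z> (i + l) (a, k)) = cls (single \<Z> i (a, k)) \<oplus>\<^bsub>SE\<^esub> cls (single \<Z> l (a, k))" for i l
    proof -
      have "single \<Z> (i + l) (a, k) = single \<Z> i (a, k) \<oplus>\<^bsub>T\<^esub> single \<Z> l (a, k)"
        unfolding T_eq by (auto simp: W.add_P single_def)
      then show ?thesis using c.hom_add[OF sc sc] by simp
    qed
    have zero: "cls (single \<Z> 0 (a, k)) = \<zero>\<^bsub>SE\<^esub>"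
    proof -
      have "single \<Z> 0 (a, k) = \<zero>\<^bsub>T\<^esub>" unfolding T_eq by (auto simp: W.zero_P single_def)
      then show ?thesis using c.hom_zero by simp
    qed
    \<comment> \<open>Negatives lie in \<open>S\<close> because it is stable under the scalar -1 of
      \<open>K\<close>.\<close>
    have m1: "cls (single \<Z> (-1) (a, k)) \<in> S"
    proof -
      have "cls (single \<Z> (-1) (a, k)) \<oplus>\<^bsub>SE\<^esub> pt a k = \<zero>\<^bsub>SE\<^esub>"
        using add[of "-1" 1] zero p by simp
      then have "cls (single \<Z> (-1) (a, k)) = \<ominus>\<^bsub>SE\<^esub> pt a k"
        using SE.minus_equality[OF _ pt_closed[OF ak] c.hom_closed[OF sc]] by simp
      also have "\<dots> = (\<ominus>\<^bsub>K\<^esub> \<one>\<^bsub>K\<^esub>) \<odot>\<^bsub>SE\<^esub> pt a k"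
        using pt_closed[OF ak] by (simp add: SE.smult_l_minus)
      finally show ?thesis using SE.subD(4)[OF S _ pt[OF ak]] by simp
    qed
    show ?thesis
    proof (induction j rule: int_induct[where k = 0])
      case base
      then show ?case using SE.subD(2)[OF S] zero by simp
    next
      case (step1 i)
      then show ?case using SE.subD(3)[OF S step1(2) pt[OF ak]] add[of i 1] p by simp
    next
      case (step2 i)
      then show ?case using SE.subD(3)[OF S step2(2) m1] add[of i "-1"] by simp
    qed
  qed
  show "x \<in> S" unfolding f(2) using f(1)
  proof (induction f rule: W.P_induct)
    case zero
    have "(\<lambda>w. \<zero>\<^bsub>\<Z>\<^esub>) = \<zero>\<^bsub>T\<^esub>" unfolding T_eq W.zero_P by simp
    then show ?case using SE.subD(2)[OF S] c.hom_zero by simp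
  next
    case (add j m f)
    obtain a k where m: "m = (a, k)" by (cases m)
    have ak: "a \<in> carrier Y" "k \<in> carrier K" using add.hyps(2) by (simp_all add: m)
    have "single \<Z> j m \<in> carrier T" "f \<in> carrier T"
      unfolding T_eq using add.hyps W.single_closed by auto
    from c.hom_add[OF this] show ?case
      using SE.subD(3)[OF S s[OF ak, of j] add.IH] unfolding T_eq m by simp
  qed
qed

text \<open>The universal property of the extension: \<open>a \<otimes> k\<close> goes to
  \<open>k\<close> times the image of \<open>a\<close>. This is multiplicative since scalars are
  central and \<open>K\<close> is commutative; bilinearity and semilinearity annihilate the three
  kinds of relators.\<close>

lemma SE_lift:
  assumes \<Psi>: "alg_map B Y K E \<phi> \<Psi>"
  shows "\<exists>\<Theta>. \<Theta> \<in> ring_hom SE E \<and> (\<forall>k\<in>carrier K. \<forall>x\<in>carrier SE. \<Theta> (k \<odot>\<^bsub>SE\<^esub> x) = k \<odot>\<^bsub>E\<^esub> \<Theta> x) \<and> (\<forall>a\<in>carrier Y. \<Theta> (emb a) = \<Psi> a)"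
proof -
  interpret E: nc_algebra K E using \<Psi> by (simp add: alg_map_def)
  interpret \<Psi>: alg_map B Y K E \<phi> \<Psi> by fact
  let ?\<zeta> = "\<lambda>j::int. [j] \<cdot>\<^bsub>E\<^esub> \<one>\<^bsub>E\<^esub>"
  define h where "h m = snd m \<odot>\<^bsub>E\<^esub> \<Psi> (fst m)" for m
  have hc: "h m \<in> carrier E" if "m \<in> carrier (Y \<times>\<times> K)" for m
    using that by (auto simp: h_def)
  interpret L: monoid_alg_lift \<Z> "Y \<times>\<times> K" E ?\<zeta> h
  proof (unfold_locales)
    show "?\<zeta> \<in> ring_hom \<Z> E" by (rule E.M.int_embed_ring_hom)
    show "h m \<in> carrier E" if "m \<in> carrier (Y \<times>\<times> K)" for m by (rule hc[OF that])
    show "h \<one>\<^bsub>Y \<times>\<times> K\<^esub> = \<one>\<^bsub>E\<^esub>" by (simp add: h_def)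
    show "h (m \<otimes>\<^bsub>Y \<times>\<times> K\<^esub> m') = h m \<otimes>\<^bsub>E\<^esub> h m'" if "m \<in> carrier (Y \<times>\<times> K)" "m' \<in> carrier (Y \<times>\<times> K)" for m m'
      using that by (auto simp: h_def E.smult_mult_l E.smult_mult_r E.smult_assoc1[symmetric] K.m_comm)
    show "h m \<otimes>\<^bsub>E\<^esub> ?\<zeta> j = ?\<zeta> j \<otimes>\<^bsub>E\<^esub> h m" if "m \<in> carrier (Y \<times>\<times> K)" for m j
      by (rule E.M.int_embed_comm[OF hc[OF that]])
  qed
  have hom: "L.L \<in> ring_hom T E" unfolding T_eq by (rule L.lift_ring_hom)
  interpret H: ring_hom_ring T E L.L by unfold_locales (rule hom)
  have val: "L.L (mono a k) = k \<odot>\<^bsub>E\<^esub> \<Psi> a" if "a \<in> carrier Y" "k \<in> carrier K" for a k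
  proof -
    have m: "(a, k) \<in> carrier (Y \<times>\<times> K)" using that by simp
    have "L.L (mono a k) = ?\<zeta> 1 \<otimes>\<^bsub>E\<^esub> h (a, k)"
      unfolding monomial_single using L.lift_single[OF _ m, of 1] by simp
    also have "?\<zeta> 1 = \<one>\<^bsub>E\<^esub>" using ring_hom_one[OF E.M.int_embed_ring_hom] by simp
    finally have "L.L (mono a k) = h (a, k)" using hc[OF m] by simp
    also have "\<dots> = k \<odot>\<^bsub>E\<^esub> \<Psi> a" unfolding h_def by simp
    finally show ?thesis .
  qed
  have sub: "L.L (x \<ominus>\<^bsub>T\<^esub> y) = \<zero>\<^bsub>E\<^esub>" if "x \<in> carrier T" "y \<in> carrier T" "L.L x = L.L y" for x y
    using that by (simp add: T.minus_eq E.M.r_neg)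
  note cl = mono_closed Y.M.a_closed K.a_closed Y.smult_closed K.m_closed \<phi>.hom_closed T.a_closed
  have "L.L x = \<zero>\<^bsub>E\<^esub>" if "x \<in> tensor_relators B Y K \<phi>" for x
  proof -
    consider a b k where "x = mono (a \<oplus>\<^bsub>Y\<^esub> b) k \<ominus>\<^bsub>T\<^esub> (mono a k \<oplus>\<^bsub>T\<^esub> mono b k)" "a \<in> carrier Y" "b \<in> carrier Y" "k \<in> carrier K"
      | a k l where "x = mono a (k \<oplus>\<^bsub>K\<^esub> l) \<ominus>\<^bsub>T\<^esub> (mono a k \<oplus>\<^bsub>T\<^esub> mono a l)" "a \<in> carrier Y" "k \<in> carrier K" "l \<in> carrier K"
      | d a k where "x = mono (d \<odot>\<^bsub>Y\<^esub> a) k \<ominus>\<^bsub>T\<^esub> mono a (\<phi> d \<otimes>\<^bsub>K\<^esub> k)" "d \<in> carrier B" "a \<in> carrier Y" "k \<in> carrier K"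
      using \<open>x \<in> tensor_relators B Y K \<phi>\<close> unfolding tensor_relators_def Let_def by blast
    then show ?thesis
    proof cases
      case 1
      then show ?thesis unfolding 1(1) by (intro sub cl) (simp_all add: mono_closed val E.smult_r_distr)
    next
      case 2
      then show ?thesis unfolding 2(1) by (intro sub cl) (simp_all add: mono_closed val E.smult_l_distr)
    next
      case 3
      have "k \<odot>\<^bsub>E\<^esub> (\<phi> d \<odot>\<^bsub>E\<^esub> \<Psi> a) = (\<phi> d \<otimes>\<^bsub>K\<^esub> k) \<odot>\<^bsub>E\<^esub> \<Psi> a"
        using 3 by (simp add: E.smult_assoc1[symmetric] K.m_comm)
      then show ?thesis unfolding 3(1) using 3 by (intro sub cl) (simp_all add: val \<Psi>.h_smult)
    qed
  qed
  then have "tensor_relators B Y K \<phi> \<subseteq> a_kernel T E L.L"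
    unfolding a_kernel_def' using relators_closed by blast
  then have "J \<subseteq> a_kernel T E L.L"
    unfolding tensor_ideal_def by (rule T.genideal_minimal[OF H.kernel_is_ideal])
  then have kJ: "L.L x = \<zero>\<^bsub>E\<^esub>" if "x \<in> J" for x using that unfolding a_kernel_def' by blast
  define \<Theta> where "\<Theta> = quot_lift L.L"
  have hom': "\<Theta> \<in> ring_hom SE E"
    unfolding ring_hom_cong_left[OF SE_sel(1-3,5)] \<Theta>_def
    by (rule quot_lift_ring_hom[OF J.is_ideal H.is_ring_hom_ring kJ])
  have pv: "\<Theta> (pt a k) = k \<odot>\<^bsub>E\<^esub> \<Psi> a" if "a \<in> carrier Y" "k \<in> carrier K" for a k
  proof -
    have "\<Theta> (cls (mono a k)) = L.L (mono a k)"
      unfolding \<Theta>_def by (rule quot_lift_coset[OF J.is_ideal H.is_ring_hom_ring kJ mono_closed[OF that]])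
    also have "\<dots> = k \<odot>\<^bsub>E\<^esub> \<Psi> a" by (rule val[OF that])
    finally show ?thesis unfolding pt_eq .
  qed
  have "\<Theta> (k \<odot>\<^bsub>SE\<^esub> x) = k \<odot>\<^bsub>E\<^esub> \<Theta> x" if k: "k \<in> carrier K" and x: "x \<in> carrier SE" for k x
  proof -
    have "\<Theta> (k \<odot>\<^bsub>SE\<^esub> x) = \<Theta> (pt \<one>\<^bsub>Y\<^esub> k) \<otimes>\<^bsub>E\<^esub> \<Theta> x"
      unfolding SE_smult by (rule ring_hom_mult[OF hom' pt_closed[OF Y.M.one_closed k] x])
    also have "\<dots> = k \<odot>\<^bsub>E\<^esub> \<Theta> x"
      unfolding pv[OF Y.M.one_closed k] using k ring_hom_closed[OF hom' x] by (simp add: E.smult_mult_l)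
    finally show ?thesis .
  qed
  moreover have "\<Theta> (emb a) = \<Psi> a" if "a \<in> carrier Y" for a
    unfolding pv[OF that K.one_closed] using that by simp
  ultimately show ?thesis using hom' by blast
qed

end

section \<open>The Yokonuma-Hecke algebra after extension of scalars\<close>

locale yh_scalar_ext = yh_presentation B q r n + S: scalar_ext B "yh_algebra B q r n" K \<phi>
  for B :: "'b ring" and q r n and K :: "'k ring" and \<phi>
begin

lemma SE_map: "yh_free_map B n K S.SE \<phi> (\<lambda>x. S.emb (I.cls x)) r q"
proof -
  interpret c: yh_free_map B n B Y "\<lambda>x. x" I.cls r q by (rule cls_map)
  interpret e: alg_map B Y K S.SE \<phi> S.emb by (rule S.emb_map)
  show ?thesis
  proof (intro yh_free_map.intro yh_free_map_axioms.intro alg_mapI F.nc_algebra_axioms S.SE.nc_algebra_axioms r_unit q_unit)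
    show "\<phi> \<in> ring_hom B K" by (rule S.\<phi>.homh)
    show "(\<lambda>x. S.emb (I.cls x)) \<in> ring_hom F S.SE"
      by (rule ring_hom_memI) (simp_all add: cls_closed)
    show "S.emb (I.cls (d \<odot>\<^bsub>F\<^esub> x)) = \<phi> d \<odot>\<^bsub>S.SE\<^esub> S.emb (I.cls x)" if "d \<in> carrier B" "x \<in> carrier F" for d x
      unfolding c.h_smult[OF that] by (rule e.h_smult[OF that(1) cls_closed[OF that(2)]])
  qed
qed

lemma yh_rel_SE: "yh_rel K S.SE (\<phi> q) r n (\<lambda>i. S.emb (yh_t B q r n i)) (\<lambda>i. S.emb (yh_g B q r n i))"
proof -
  interpret e: alg_map B Y K S.SE \<phi> S.emb by (rule S.emb_map)
  have "S.emb (I.cls x) = \<zero>\<^bsub>S.SE\<^esub>" if "x \<in> yh_relators B q r n" for x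
    unfolding cls_relator[OF that] by (rule e.h.hom_zero)
  then show ?thesis
    using yh_free_map.relators_iff[OF SE_map] unfolding yh_t_def yh_g_def by blast
qed

text \<open>A submodule stable under the generators contains all \<open>a \<otimes> 1\<close> by
  \<open>Y_generates\<close>, hence all pure tensors as their \<open>K\<close>-multiples.\<close>

lemma SE_generates:
  "S.SE.generates ((\<lambda>i. S.emb (yh_t B q r n i)) ` {1..n} \<union> (\<lambda>i. S.emb (yh_g B q r n i)) ` {1..<n})" (is "S.SE.generates ?G")
  unfolding S.SE.generates_def
proof (intro allI impI)
  interpret e: alg_map B Y K S.SE \<phi> S.emb by (rule S.emb_map)
  fix T assume T: "S.SE.sub T" "\<one>\<^bsub>S.SE\<^esub> \<in> T" "\<forall>x\<in>T. \<forall>a\<in>?G. x \<otimes>\<^bsub>S.SE\<^esub> a \<in> T"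
  have "S.emb a \<in> T" if "a \<in> carrier Y" for a
    by (rule e.generates_image[OF Y_generates _ T(1,2) _ that])
      (use T(3) yh_t_closed yh_g_closed in auto)
  then have "S.pt a k \<in> T" if "a \<in> carrier Y" "k \<in> carrier K" for a k
    unfolding S.pt_smult_emb[OF that] using S.SE.subD(4)[OF T(1)] that by blast
  then show "carrier S.SE \<subseteq> T" by (rule S.SE_induct[OF T(1)])
qed

lemma yh_alg_gen_SE: "yh_alg_gen K S.SE (\<phi> q) r n (\<lambda>i. S.emb (yh_t B q r n i)) (\<lambda>i. S.emb (yh_g B q r n i))"
proof -
  have u: "[r] \<cdot>\<^bsub>K\<^esub> \<one>\<^bsub>K\<^esub> \<in> Units K"
    using ring_hom_inv(2)[OF B.is_cring S.K.is_cring S.\<phi>.homh r_unit] ring_hom_nat[OF B.ring_axioms S.K.ring_axioms S.\<phi>.homh] by simp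
  show ?thesis
    by (intro yh_alg_gen.intro yh_alg.intro yh_alg_axioms.intro yh_alg_gen_axioms.intro S.SE.nc_algebra_axioms
      n_pos r_pos S.pt_closed yh_t_closed yh_g_closed yh_rel_SE SE_generates u S.K.one_closed
      ring_hom_inv(2)[OF B.is_cring S.K.is_cring S.\<phi>.homh q_unit])
qed

end

section \<open>The generic ground ring\<close>

text \<open>This recovers the invertibility of each single difference of powers of
  \<open>\<xi>\<close> from that of their product.\<close>

lemma (in cring) Units_factor:
  assumes "x \<in> carrier R" "y \<in> carrier R" "x \<otimes> y \<in> Units R"
  shows "x \<in> Units R"
proof -
  have c: "inv (x \<otimes> y) \<in> carrier R" using assms(3) by simp
  have "x \<otimes> (y \<otimes> inv (x \<otimes> y)) = \<one>"
    using assms c by (simp add: m_assoc[symmetric])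
  moreover from this have "(y \<otimes> inv (x \<otimes> y)) \<otimes> x = \<one>" using assms c by (simp add: m_comm)
  ultimately show ?thesis using assms(1,2) c unfolding Units_def by blast
qed

lemma (in cring) Units_finprod_factor:
  assumes "finite S" "f \<in> S \<rightarrow> carrier R" "(\<Otimes>p\<in>S. f p) \<in> Units R" "p \<in> S"
  shows "f p \<in> Units R"
proof -
  have S: "insert p (S - {p}) = S" using assms(4) by auto
  have "f \<in> S - {p} \<rightarrow> carrier R" "f p \<in> carrier R" using assms(2,4) by auto
  moreover from this have "(\<Otimes>p\<in>S. f p) = f p \<otimes> (\<Otimes>p\<in>S - {p}. f p)"
    using finprod_insert[of "S - {p}" p f] assms(1) S by simp
  ultimately show ?thesis using assms(3) Units_factor[of "f p" "\<Otimes>p\<in>S - {p}. f p"] by simp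
qed

lemma (in cring) Units_neg: "x \<in> Units R \<Longrightarrow> \<ominus> x \<in> Units R"
proof -
  assume x: "x \<in> Units R"
  then have c: "x \<in> carrier R" "inv x \<in> carrier R" by auto
  have "(\<ominus> x) \<otimes> (\<ominus> (inv x)) = \<one>" "(\<ominus> (inv x)) \<otimes> (\<ominus> x) = \<one>" using c x by (simp_all add: l_minus r_minus)
  then show ?thesis unfolding Units_def using c by blast
qed

text \<open>The product in the hypothesis only runs over \<open>i < j\<close>; the differences with
  \<open>i > j\<close> are units up to sign.\<close>

lemma specialization_tensor_rep:
  assumes "is_specialization r K q \<xi> \<phi>"
  shows "tensor_rep K r q \<xi>"
proof -
  interpret K: cring K using assms by (simp add: is_specialization_def)
  let ?S = "{(i, j). i < j \<and> j < r}"
  let ?f = "\<lambda>p. (\<xi> [^]\<^bsub>K\<^esub> fst p) \<ominus>\<^bsub>K\<^esub> (\<xi> [^]\<^bsub>K\<^esub> snd p)"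
  have \<xi>: "\<xi> \<in> carrier K" using assms by (auto simp: is_specialization_def)
  have fin: "finite ?S" by (rule finite_subset[of _ "{..<r} \<times> {..<r}"]) auto
  have u: "\<xi> [^]\<^bsub>K\<^esub> i \<ominus>\<^bsub>K\<^esub> \<xi> [^]\<^bsub>K\<^esub> j \<in> Units K" if "i < j" "j < r" for i j
    using K.Units_finprod_factor[OF fin, of ?f "(i, j)"] assms \<xi> that by (simp add: is_specialization_def Pi_iff)
  have "\<xi> [^]\<^bsub>K\<^esub> i \<ominus>\<^bsub>K\<^esub> \<xi> [^]\<^bsub>K\<^esub> j \<in> Units K" if "i < r" "j < r" "i \<noteq> j" for i j
  proof (cases "i < j")
    case True
    then show ?thesis using u that by blast
  next
    case False
    have "\<ominus>\<^bsub>K\<^esub> (\<xi> [^]\<^bsub>K\<^esub> j \<ominus>\<^bsub>K\<^esub> \<xi> [^]\<^bsub>K\<^esub> i) = \<xi> [^]\<^bsub>K\<^esub> i \<ominus>\<^bsub>K\<^esub> \<xi> [^]\<^bsub>K\<^esub> j"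
      using \<xi> by (simp add: K.minus_eq K.minus_add K.a_comm)
    then show ?thesis using K.Units_neg[OF u[of j i]] False that by simp
  qed
  then show ?thesis
    using assms \<xi> by unfold_locales (auto simp: is_specialization_def)
qed

section \<open>Arithmetic of the generic ring inside the field of rational functions\<close>

lemma gen_ring_sel: "monoid.mult (gen_ring r) = (*)" "one (gen_ring r) = 1" "ring.zero (gen_ring r) = 0" "add (gen_ring r) = (+)"
  by (simp_all add: gen_ring_def ring_of_type_algebra_def)

lemma ring_of_type_algebra_sel: "carrier ring_of_type_algebra = UNIV" "monoid.mult ring_of_type_algebra = (*)"
  "one ring_of_type_algebra = 1" "ring.zero ring_of_type_algebra = 0" "add ring_of_type_algebra = (+)"
  by (simp_all add: ring_of_type_algebra_def)

lemma cring_gen_ring: "cring (gen_ring r)"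
proof -
  interpret U: ring "ring_of_type_algebra :: complex poly fract ring" by (rule ring_from_type_algebra)
  have "ring (gen_ring r)" unfolding gen_ring_def
    by (rule U.generate_ring_is_ring) (simp add: ring_of_type_algebra_sel)
  then interpret R: ring "gen_ring r" .
  show ?thesis
    by (intro cring.intro R.ring_axioms R.monoid_comm_monoidI) (simp add: gen_ring_sel mult.commute)
qed

lemma gen_ring_gens:
  "{gen_q, inverse gen_q, gen_xi r, inverse (of_nat r), inverse (gen_Delta r)} \<subseteq> carrier (gen_ring r)"
  unfolding gen_ring_def by (auto intro: generate_ring.incl)

lemma gen_ring_minus:
  assumes "x \<in> carrier (gen_ring r)" "y \<in> carrier (gen_ring r)"
  shows "x \<ominus>\<^bsub>gen_ring r\<^esub> y = x - y"
proof -
  interpret R: cring "gen_ring r" by (rule cring_gen_ring)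
  have "x \<ominus>\<^bsub>gen_ring r\<^esub> y \<oplus>\<^bsub>gen_ring r\<^esub> y = x"
    using assms by (simp add: R.minus_eq R.a_assoc R.l_neg)
  then show ?thesis by (simp add: gen_ring_sel eq_diff_eq)
qed

lemma gen_ring_pow: "x [^]\<^bsub>gen_ring r\<^esub> (k::nat) = x ^ k"
proof -
  interpret R: cring "gen_ring r" by (rule cring_gen_ring)
  show ?thesis by (induction k) (simp_all add: gen_ring_sel mult.commute)
qed

lemma gen_ring_of_nat: "[(k::nat)] \<cdot>\<^bsub>gen_ring r\<^esub> \<one>\<^bsub>gen_ring r\<^esub> = of_nat k"
proof -
  interpret R: cring "gen_ring r" by (rule cring_gen_ring)
  show ?thesis by (induction k) (simp_all add: R.add.nat_pow_Suc gen_ring_sel add.commute)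
qed

lemma gen_ring_prod: "f \<in> S \<rightarrow> carrier (gen_ring r) \<Longrightarrow> finprod (gen_ring r) f S = prod f S"
proof -
  interpret R: cring "gen_ring r" by (rule cring_gen_ring)
  show "f \<in> S \<rightarrow> carrier (gen_ring r) \<Longrightarrow> finprod (gen_ring r) f S = prod f S"
    by (induction S rule: infinite_finite_induct) (auto simp: gen_ring_sel Pi_iff)
qed

lemma gen_ring_Unit:
  assumes "x \<in> carrier (gen_ring r)" "inverse x \<in> carrier (gen_ring r)" "x \<noteq> 0"
  shows "x \<in> Units (gen_ring r)"
  unfolding Units_def using assms by (auto simp: gen_ring_sel intro!: bexI[of _ "inverse x"])

lemma gen_q_nonzero: "gen_q \<noteq> 0"
  by (simp add: gen_q_def Zero_fract_def eq_fract)

lemma gen_xi_pow: "gen_xi r ^ k = Fract [:exp (2 * of_real pi * \<i> / of_nat r) ^ k:] 1"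
  by (induction k) (simp_all add: gen_xi_def One_fract_def mult.commute pCons_one)

lemma exp_root: "exp (2 * of_real pi * \<i> / of_nat r) ^ k = cis (2 * pi * real k / real r)"
  by (simp add: cis_conv_exp exp_of_nat_mult[symmetric] mult_ac)

lemma gen_xi_root: "r \<ge> 1 \<Longrightarrow> gen_xi r ^ r = 1"
  by (simp add: gen_xi_pow exp_root One_fract_def pCons_one)

lemma gen_xi_inj:
  assumes "i < r" "j < r" "gen_xi r ^ i = gen_xi r ^ j"
  shows "i = j"
proof -
  have "cis (2 * pi * real i / real r) = cis (2 * pi * real j / real r)"
    using assms(3) by (simp add: gen_xi_pow exp_root eq_fract)
  moreover have "inj_on (\<lambda>k. cis (2 * pi * real k / real r)) {..<r}"
    using bij_betw_roots_unity[of r] assms(1) by (auto simp: bij_betw_def)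
  ultimately show ?thesis using assms(1,2) by (auto simp: inj_on_def)
qed

lemma of_nat_fract_nonzero: "r \<ge> 1 \<Longrightarrow> (of_nat r :: complex poly fract) \<noteq> 0"
  by (simp add: of_nat_fract Zero_fract_def eq_fract)

lemma finite_pairs: "finite {(i, j). i < j \<and> j < (r::nat)}"
  by (rule finite_subset[of _ "{..<r} \<times> {..<r}"]) auto

lemma gen_Delta_nonzero: "gen_Delta r \<noteq> 0"
proof
  assume "gen_Delta r = 0"
  then obtain i j where "i < j" "j < r" "gen_xi r ^ i = gen_xi r ^ j"
    unfolding gen_Delta_def using finite_pairs[of r] by (auto simp: prod_zero_iff)
  then show False using gen_xi_inj[of i r j] by simp
qed

text \<open>The generic ring is a specialization of itself along the identity, so
  \<open>specialization_tensor_rep\<close> serves both ground rings.\<close>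

lemma generic_specialization:
  assumes r: "r \<ge> 1"
  shows "is_specialization r (gen_ring r) gen_q (gen_xi r) (\<lambda>x. x)"
proof -
  interpret R: cring "gen_ring r" by (rule cring_gen_ring)
  note g = gen_ring_gens[of r]
  have \<xi>: "gen_xi r \<in> carrier (gen_ring r)" using g by simp
  have pow: "gen_xi r ^ k \<in> carrier (gen_ring r)" for k
    using R.nat_pow_closed[OF \<xi>, of k] by (simp only: gen_ring_pow)
  have "gen_xi r [^]\<^bsub>gen_ring r\<^esub> r = \<one>\<^bsub>gen_ring r\<^esub>" using gen_xi_root[OF r] by (simp add: gen_ring_pow gen_ring_sel)
  moreover have "gen_xi r \<in> Units (gen_ring r)"
  proof -
    obtain k where k: "r = Suc k" using r by (cases r) auto
    have "gen_xi r * gen_xi r ^ k = 1" using gen_xi_root[OF r] k by (metis power_Suc)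
    then show ?thesis unfolding Units_def using \<xi> pow[of k] by (auto simp: gen_ring_sel mult.commute intro!: bexI[of _ "gen_xi r ^ k"])
  qed
  moreover have "gen_q \<in> Units (gen_ring r)" using g gen_q_nonzero by (intro gen_ring_Unit) auto
  moreover have "[r] \<cdot>\<^bsub>gen_ring r\<^esub> \<one>\<^bsub>gen_ring r\<^esub> \<in> Units (gen_ring r)"
  proof -
    \<comment> \<open>Only the inverse of \<open>r\<close> is among the ring generators;
      \<open>r\<close> itself belongs to the ring as a multiple of 1. Likewise the discriminant
      belongs to it as a product of differences.\<close>
    have "[r] \<cdot>\<^bsub>gen_ring r\<^esub> \<one>\<^bsub>gen_ring r\<^esub> \<in> carrier (gen_ring r)" by simp
    then show ?thesis unfolding gen_ring_of_nat using g of_nat_fract_nonzero[OF r] by (intro gen_ring_Unit) auto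
  qed
  moreover have "(\<Otimes>\<^bsub>gen_ring r\<^esub>p\<in>{(i, j). i < j \<and> j < r}. (gen_xi r [^]\<^bsub>gen_ring r\<^esub> fst p) \<ominus>\<^bsub>gen_ring r\<^esub> (gen_xi r [^]\<^bsub>gen_ring r\<^esub> snd p))
     \<in> Units (gen_ring r)" (is "?D \<in> _")
  proof -
    have c: "(\<lambda>p. (gen_xi r [^]\<^bsub>gen_ring r\<^esub> fst p) \<ominus>\<^bsub>gen_ring r\<^esub> (gen_xi r [^]\<^bsub>gen_ring r\<^esub> snd p)) \<in> {(i, j). i < j \<and> j < r} \<rightarrow> carrier (gen_ring r)"
      using \<xi> by auto
    have "?D = (\<Prod>p\<in>{(i, j). i < j \<and> j < r}. gen_xi r ^ fst p - gen_xi r ^ snd p)"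
      unfolding gen_ring_prod[OF c] by (simp add: gen_ring_pow gen_ring_minus pow)
    also have "\<dots> = gen_Delta r" unfolding gen_Delta_def by (simp add: case_prod_beta)
    finally have "?D = gen_Delta r" .
    moreover have "?D \<in> carrier (gen_ring r)" by (rule R.finprod_closed[OF c])
    ultimately show ?thesis using g gen_Delta_nonzero by (auto intro!: gen_ring_Unit)
  qed
  ultimately show ?thesis
    unfolding is_specialization_def using R.is_cring id_ring_hom by blast
qed

section \<open>Faithfulness over the generic ring and over its specializations\<close>

lemma tensor_rep_injective:
  assumes "tensor_rep K r q \<xi>" "yh_alg_gen K A q r n t g" "is_tensor_rep K q \<xi> r n A t g \<rho>"
  shows "inj_on \<rho> (carrier A)"
proof -
  interpret tensor_rep K r n q \<xi> by fact
  interpret Y: yh_alg_gen K A q r n t g by fact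
  interpret tensor_rep_inj K r n q \<xi> A t g \<rho>
    by unfold_locales (use assms(3) in \<open>auto simp: is_tensor_rep_def algebra_hom_def\<close>)
  show ?thesis by (rule \<rho>_inj)
qed

theorem theorem10:
  fixes n r :: nat
  assumes "n \<ge> 1" and "r \<ge> 1"
  shows
    "((\<exists>\<rho>. is_tensor_rep (gen_ring r) gen_q (gen_xi r) r n (YH r n) (YH_t r n) (YH_g r n) \<rho>) \<and>
      (\<forall>\<rho>. is_tensor_rep (gen_ring r) gen_q (gen_xi r) r n (YH r n) (YH_t r n) (YH_g r n) \<rho> \<longrightarrow>
         inj_on \<rho> (carrier (YH r n)))) \<and>
     (\<forall>(K :: 'k ring) q \<xi> \<phi>. is_specialization r K q \<xi> \<phi> \<longrightarrow>
       (\<exists>\<rho>. is_tensor_rep K q \<xi> r n (YH_spec r n K \<phi>)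
              (YH_spec_t r n K \<phi>) (YH_spec_g r n K \<phi>) \<rho>) \<and>
       (\<forall>\<rho>. is_tensor_rep K q \<xi> r n (YH_spec r n K \<phi>)
              (YH_spec_t r n K \<phi>) (YH_spec_g r n K \<phi>) \<rho> \<longrightarrow>
         inj_on \<rho> (carrier (YH_spec r n K \<phi>))))"
proof -
  note gs = generic_specialization[OF assms(2)]
  interpret P: yh_presentation "gen_ring r" gen_q r n
    using gs assms by (intro yh_presentation.intro cring_gen_ring yh_presentation_axioms.intro) (auto simp: is_specialization_def)
  show ?thesis
  proof (intro conjI allI impI)
    interpret R: tensor_rep "gen_ring r" r n gen_q "gen_xi r" by (rule specialization_tensor_rep[OF gs])
    obtain \<Psi> where \<Psi>: "alg_map (gen_ring r) (YH r n) (gen_ring r) R.End (\<lambda>x. x) \<Psi>"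
       "\<forall>i\<in>{1..n}. \<Psi> (YH_t r n i) = R.TT i" "\<forall>i\<in>{1..<n}. \<Psi> (YH_g r n i) = R.GG i"
      using P.Y_lift[OF R.End.nc_algebra_axioms id_ring_hom R.yh_rel_ops R.TT_End R.GG_End] by blast
    interpret \<Psi>: alg_map "gen_ring r" "YH r n" "gen_ring r" R.End "\<lambda>x. x" \<Psi> by (rule \<Psi>(1))
    have "is_tensor_rep (gen_ring r) gen_q (gen_xi r) r n (YH r n) (YH_t r n) (YH_g r n) \<Psi>"
      unfolding is_tensor_rep_def algebra_hom_def using \<Psi>(2,3) \<Psi>.h.homh \<Psi>.h_smult by blast
    then show "\<exists>\<rho>. is_tensor_rep (gen_ring r) gen_q (gen_xi r) r n (YH r n) (YH_t r n) (YH_g r n) \<rho>" by blast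
    fix \<rho> assume "is_tensor_rep (gen_ring r) gen_q (gen_xi r) r n (YH r n) (YH_t r n) (YH_g r n) \<rho>"
    then show "inj_on \<rho> (carrier (YH r n))"
      by (rule tensor_rep_injective[OF R.tensor_rep_axioms P.yh_alg_gen_Y])
  next
    fix K :: "'k ring" and q \<xi> \<phi>
    assume s: "is_specialization r K q \<xi> \<phi>"
    have \<phi>: "\<phi> gen_q = q" "\<phi> \<in> ring_hom (gen_ring r) K" using s by (auto simp: is_specialization_def)
    interpret T: tensor_rep K r n q \<xi> by (rule specialization_tensor_rep[OF s])
    interpret E: yh_scalar_ext "gen_ring r" gen_q r n K \<phi>
      by unfold_locales (rule \<phi>(2))
    note gen = E.yh_alg_gen_SE[unfolded \<phi>(1)]
    have rel: "yh_rel K T.End (\<phi> gen_q) r n T.TT T.GG" unfolding \<phi>(1) by (rule T.yh_rel_ops)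
    \<comment> \<open>The specialized representation arises in two stages: a semilinear map from the
      generic algebra into endomorphisms over \<open>K\<close>, and its extension to the tensor
      product by \<open>SE_lift\<close>.\<close>
    obtain \<Psi> where \<Psi>: "alg_map (gen_ring r) (YH r n) K T.End \<phi> \<Psi>"
       "\<forall>i\<in>{1..n}. \<Psi> (YH_t r n i) = T.TT i" "\<forall>i\<in>{1..<n}. \<Psi> (YH_g r n i) = T.GG i"
      using P.Y_lift[OF T.End.nc_algebra_axioms \<phi>(2) rel T.TT_End T.GG_End] by blast
    obtain \<Theta> where \<Theta>: "\<Theta> \<in> ring_hom (YH_spec r n K \<phi>) T.End"
      "\<forall>k\<in>carrier K. \<forall>x\<in>carrier (YH_spec r n K \<phi>). \<Theta> (k \<odot>\<^bsub>YH_spec r n K \<phi>\<^esub> x) = k \<odot>\<^bsub>T.End\<^esub> \<Theta> x"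
      "\<forall>a\<in>carrier (YH r n). \<Theta> (E.S.emb a) = \<Psi> a"
      using E.S.SE_lift[OF \<Psi>(1)] by blast
    have "is_tensor_rep K q \<xi> r n (YH_spec r n K \<phi>) (YH_spec_t r n K \<phi>) (YH_spec_g r n K \<phi>) \<Theta>"
      unfolding is_tensor_rep_def algebra_hom_def
      using \<Theta>(1,2) \<Theta>(3)[rule_format, OF P.yh_t_closed] \<Theta>(3)[rule_format, OF P.yh_g_closed] \<Psi>(2,3) by simp
    then show "\<exists>\<rho>. is_tensor_rep K q \<xi> r n (YH_spec r n K \<phi>) (YH_spec_t r n K \<phi>) (YH_spec_g r n K \<phi>) \<rho>" by blast
    fix \<rho> assume "is_tensor_rep K q \<xi> r n (YH_spec r n K \<phi>) (YH_spec_t r n K \<phi>) (YH_spec_g r n K \<phi>) \<rho>"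
    then show "inj_on \<rho> (carrier (YH_spec r n K \<phi>))"
      by (rule tensor_rep_injective[OF T.tensor_rep_axioms gen])
  qed
qed

end
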